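(* There exists a uniform constant $c_b>0$ such that $$|a_h(\boldsymbol x_h,\boldsymbol y_h)|\le c_b\,\|\boldsymbol x_h\|_{\boldsymbol X_h}\,\|\boldsymbol y_h\|_{\boldsymbol X_h}\qquad\forall\,\boldsymbol x_h,\boldsymbol y_h\in\boldsymbol X_h .$$
   Context: Setting. $\Omega\subset\mathbb R^d$, $d\in\{2,3\}$, is a bounded polygonal (polyhedral) domain; $\nu>0$ and $\tau>0$ are constants (problem parameters); $\eta>1$ is the interior penalty parameter; $k\ge1$ is an integer. $\mathcal T_h$ is a quasi-uniform (shape-regular) conforming simplicial mesh of $\Omega$ with cells $K$ of diameter $h_K$ and mesh size $h$; $\mathcal F_h$ is the set of faces, $\Gamma_0$ the union of all faces, $n$ the outward unit normal on $\partial K$. A uniform constant is one independent of the mesh size and of the problem parameters $\nu,\tau$. Spaces ($\mathbb P_m$ = polynomials of degree at most $m$; $L^2_0(\Omega)$ = zero-mean functions in $L^2(\Omega)$): $V_h=\{v_h\in[L^2(\Omega)]^d: v_h|_K\in[\mathbb P_k(K)]^d\ \forall K\}$, $\bar V_h=\{\bar v_h\in[L^2(\Gamma_0)]^d:\bar v_h|_F\in[\mathbb P_k(F)]^d\ \forall F\in\mathcal F_h,\ \bar v_h=0\text{ on }\partial\Omega\}$, $Q_h=\{q_h\in L^2(\Omega):q_h|_K\in\mathbb P_{k-1}(K)\ \forall K\}\cap L^2_0(\Omega)$, $\bar Q_h=\{\bar q_h\in L^2(\Gamma_0):\bar q_h|_F\in\mathbb P_k(F)\ \forall F\in\mathcal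 F_h\}$, $\boldsymbol V_h=V_h\times\bar V_h$, $\boldsymbol Q_h=Q_h\times\bar Q_h$, $\boldsymbol X_h=\boldsymbol V_h\times\boldsymbol Q_h$. $(\cdot,\cdot)_{\mathcal T_h}=\sum_K\int_K$ and $\langle\cdot,\cdot\rangle_{\partial\mathcal T_h}=\sum_K\int_{\partial K}$ are the sums of the cell and cell-boundary $L^2$ inner products, with induced norms $\|\cdot\|_{\mathcal T_h}$, $\|\cdot\|_{\partial\mathcal T_h}$; gradients and divergences are taken cell-wise. Bilinear forms: $d_h(\boldsymbol u_h,\boldsymbol v_h)=(\nu\nabla u_h,\nabla v_h)_{\mathcal T_h}+\langle\nu\eta h_K^{-1}(u_h-\bar u_h),v_h-\bar v_h\rangle_{\partial\mathcal T_h}-\langle\nu\nabla u_h n,v_h-\bar v_h\rangle_{\partial\mathcal T_h}-\langle\nu\nabla v_h n,u_h-\bar u_h\rangle_{\partial\mathcal T_h}$, $b_h(v_h,\boldsymbol q_h)=-(q_h,\nabla\cdot v_h)_{\mathcal T_h}+\langle\bar q_h,v_h\cdot n\rangle_{\partial\mathcal T_h}$, $a_h((\boldsymbol u_h,\boldsymbol p_h),(\boldsymbol v_h,\boldsymbol q_h))=\tau(u_h,v_h)_{\mathcal T_h}+d_h(\boldsymbol u_h,\boldsymbol v_h)+b_h(v_h,\boldsymbol p_h)+b_h(u_h,\boldsymbol q_h)$. Norms: $\|\boldsymbol v_h\|_{v,1}^2=\|\nabla v_h\|_{\mathcal T_h}^2+\eta\|h_K^{-1/2}(v_h-\bar v_h)\|_{\partial\mathcal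 T_h}^2$, $\|\boldsymbol v_h\|_v^2=\tau\|v_h\|_{\mathcal T_h}^2+\nu\|\boldsymbol v_h\|_{v,1}^2$, $\|\boldsymbol q_h\|_{q,0}^2=\|q_h\|_{\mathcal T_h}^2+\eta^{-1}\|h_K^{1/2}\bar q_h\|_{\partial\mathcal T_h}^2$, $\|\boldsymbol q_h\|_{q,1}^2=\|\nabla q_h\|_{\mathcal T_h}^2+\eta\|h_K^{-1/2}(q_h-\bar q_h)\|_{\partial\mathcal T_h}^2$, $\|\boldsymbol q_h\|_q^2=\inf\{\nu^{-1}\|\boldsymbol q_{1,h}\|_{q,0}^2+\tau^{-1}\|\boldsymbol q_{2,h}\|_{q,1}^2:\ \boldsymbol q_h=\boldsymbol q_{1,h}+\boldsymbol q_{2,h},\ \boldsymbol q_{1,h},\boldsymbol q_{2,h}\in\boldsymbol Q_h\}$, $\|(\boldsymbol v_h,\boldsymbol q_h)\|_{\boldsymbol X_h}^2=\|\boldsymbol v_h\|_v^2+\|\boldsymbol q_h\|_q^2$. *)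

theory Defs
  imports "HOL-Analysis.Analysis"
begin

text \<open>The condition \<open>interior (closure \<Omega>) = \<Omega>\<close> excludes slit domains, for which a mesh cannot be
  described as a set of closed simplices.\<close>

definition polyhedral_domain :: "'a::euclidean_space set \<Rightarrow> bool" where
  "polyhedral_domain \<Omega> \<longleftrightarrow>
     open \<Omega> \<and> connected \<Omega> \<and> \<Omega> \<noteq> {} \<and> bounded \<Omega> \<and> interior (closure \<Omega>) = \<Omega> \<and>
     (\<exists>\<P>. finite \<P> \<and> (\<forall>P\<in>\<P>. polytope P) \<and> closure \<Omega> = \<Union>\<P>)"

text \<open>Cells are closed simplices of full dimension; the library's \<^const>\<open>triangulation\<close> demands that
  any two of them meet in a common face, which is conformity.\<close>

definition conforming_mesh :: "'a::euclidean_space set \<Rightarrow> 'a set set \<Rightarrow> bool" where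
  "conforming_mesh \<Omega> \<T> \<longleftrightarrow>
     triangulation \<T> \<and> (\<forall>K\<in>\<T>. int DIM('a) simplex K) \<and> \<Union>\<T> = closure \<Omega>"

definition mesh_size :: "'a::euclidean_space set set \<Rightarrow> real" where
  "mesh_size \<T> = Max (diameter ` \<T>)"

definition inscribed_diameter :: "'a::euclidean_space set \<Rightarrow> real" where
  "inscribed_diameter K = Sup {2 * r | r c. 0 < r \<and> ball c r \<subseteq> K}"

text \<open>A family of meshes of \<open>\<Omega>\<close> is shape-regular and quasi-uniform if the regularity constant
  \<open>\<sigma>\<close> can be chosen the same for all its members.\<close>

definition quasi_uniform_family :: "'a::euclidean_space set \<Rightarrow> 'a set set set \<Rightarrow> bool" where
  "quasi_uniform_family \<Omega> \<M> \<longleftrightarrow>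
     (\<forall>\<T>\<in>\<M>. conforming_mesh \<Omega> \<T>) \<and>
     (\<exists>\<sigma>>0. \<forall>\<T>\<in>\<M>. \<forall>K\<in>\<T>.
        diameter K \<le> \<sigma> * inscribed_diameter K \<and> mesh_size \<T> \<le> \<sigma> * diameter K)"

definition mesh_faces :: "'a::euclidean_space set set \<Rightarrow> 'a set set" where
  "mesh_faces \<T> = {F. \<exists>K\<in>\<T>. F facet_of K}"

definition outward_normal :: "'a::euclidean_space set \<Rightarrow> 'a set \<Rightarrow> 'a" where
  "outward_normal K F = (THE n. norm n = 1 \<and> (\<forall>x\<in>K. \<forall>y\<in>F. n \<bullet> x \<le> n \<bullet> y))"

text \<open>Surface measure on a flat piece \<open>F\<close>: Lebesgue measure of the affine hull of \<open>F\<close>, obtained from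
  the product Lebesgue measure by an isometric parametrisation \<open>t \<mapsto> a + (\<Sum>b\<in>B. t b *\<^sub>R b)\<close> with
  \<open>B\<close> an orthonormal basis of the direction space. (Compare \<open>lborel_def\<close>, which is the case
  \<open>a = 0\<close>, \<open>B = Basis\<close>.) The result does not depend on the choice of \<open>a\<close> and \<open>B\<close>.\<close>

definition orthonormal_directions :: "'a::euclidean_space set \<Rightarrow> 'a set" where
  "orthonormal_directions F =
     (SOME B. pairwise orthogonal B \<and> (\<forall>b\<in>B. norm b = 1) \<and>
              span B = span {x - y | x y. x \<in> F \<and> y \<in> F})"

definition face_lborel :: "'a::euclidean_space set \<Rightarrow> 'a measure" where
  "face_lborel F =
     distr (\<Pi>\<^sub>M b\<in>orthonormal_directions F. lborel) borel
       (\<lambda>t. (SOME a. a \<in> F) + (\<Sum>b\<in>orthonormal_directions F. t b *\<^sub>R b))"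

text \<open>Integrals are taken over open cells and relatively open faces. What is left out has measure
  zero, and it is there that representatives of elements of the discrete spaces are unspecified.
  Integrands on cell boundaries may depend on the cell \<open>K\<close> and on the face \<open>F\<close> of \<open>K\<close> (through
  one-sided traces, \<open>h\<^sub>K\<close> and the normal).\<close>

definition cell_ip ::
  "'a::euclidean_space set set \<Rightarrow> ('a \<Rightarrow> 'b::real_inner) \<Rightarrow> ('a \<Rightarrow> 'b) \<Rightarrow> real" where
  "cell_ip \<T> f g = (\<Sum>K\<in>\<T>. LINT x:interior K|lebesgue. f x \<bullet> g x)"

definition bdry_ip ::
  "'a::euclidean_space set set \<Rightarrow> ('a set \<Rightarrow> 'a set \<Rightarrow> 'a \<Rightarrow> 'b::real_inner) \<Rightarrow>
    ('a set \<Rightarrow> 'a set \<Rightarrow> 'a \<Rightarrow> 'b) \<Rightarrow> real" where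
  "bdry_ip \<T> f g =
     (\<Sum>K\<in>\<T>. \<Sum>F | F facet_of K. LINT x:rel_interior F|face_lborel F. f K F x \<bullet> g K F x)"

definition cell_norm ::
  "'a::euclidean_space set set \<Rightarrow> ('a \<Rightarrow> 'b::real_inner) \<Rightarrow> real" where
  "cell_norm \<T> f = sqrt (cell_ip \<T> f f)"

definition bdry_norm ::
  "'a::euclidean_space set set \<Rightarrow> ('a set \<Rightarrow> 'a set \<Rightarrow> 'a \<Rightarrow> 'b::real_inner) \<Rightarrow> real" where
  "bdry_norm \<T> f = sqrt (bdry_ip \<T> f f)"

text \<open>One-sided trace, from inside \<open>K\<close>, at points of the boundary of \<open>K\<close>.\<close>

definition cell_trace ::
  "'a::euclidean_space set \<Rightarrow> ('a \<Rightarrow> 'b::t2_space) \<Rightarrow> 'a \<Rightarrow> 'b" where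
  "cell_trace K f x = Lim (at x within interior K) f"

text \<open>\<open>(grad_vec v x)$i$j = \<partial>v\<^sub>i/\<partial>x\<^sub>j\<close>, so \<open>grad_vec v x *v n\<close> is the derivative in direction \<open>n\<close>;
  the inner product on \<open>real^'d^'d\<close> is the Frobenius product.\<close>

definition grad_vec :: "(real^'d \<Rightarrow> real^'d) \<Rightarrow> real^'d \<Rightarrow> real^'d^'d" where
  "grad_vec v x = jacobian v (at x)"

definition divergence :: "(real^'d \<Rightarrow> real^'d) \<Rightarrow> real^'d \<Rightarrow> real" where
  "divergence v x = trace (grad_vec v x)"

definition grad :: "(real^'d \<Rightarrow> real) \<Rightarrow> real^'d \<Rightarrow> real^'d" where
  "grad q x = (\<chi> i. frechet_derivative q (at x) (axis i 1))"

definition polys :: "nat \<Rightarrow> (real^'d \<Rightarrow> real) set" where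
  "polys m = {p. \<exists>c. p = (\<lambda>x. \<Sum>\<alpha> | (\<Sum>i\<in>UNIV. \<alpha> i) \<le> m. c \<alpha> * (\<Prod>i\<in>UNIV. (x $ i) ^ \<alpha> i))}"

definition vec_polys :: "nat \<Rightarrow> (real^'d \<Rightarrow> real^'d) set" where
  "vec_polys m = {p. \<forall>i. (\<lambda>x. p x $ i) \<in> polys m}"

text \<open>An \<open>L\<^sup>2\<close> class is represented by any function that is polynomial on each open cell
  (resp. each relatively open face); the values elsewhere are arbitrary. Square integrability
  is automatic, as the mesh is finite. Polynomials on a face are the restrictions of polynomials of
  the same degree on the whole space.\<close>

type_synonym 'd vfun = "real^'d \<Rightarrow> real^'d"
type_synonym 'd sfun = "real^'d \<Rightarrow> real"

definition V_cell :: "nat \<Rightarrow> (real^'d) set set \<Rightarrow> 'd vfun set" where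
  "V_cell k \<T> = {v. \<forall>K\<in>\<T>. \<exists>p\<in>vec_polys k. \<forall>x\<in>interior K. v x = p x}"

definition V_face :: "(real^'d) set \<Rightarrow> nat \<Rightarrow> (real^'d) set set \<Rightarrow> 'd vfun set" where
  "V_face \<Omega> k \<T> = {v. (\<forall>F\<in>mesh_faces \<T>. \<exists>p\<in>vec_polys k. \<forall>x\<in>rel_interior F. v x = p x) \<and>
                      (\<forall>x\<in>frontier \<Omega>. v x = 0)}"

definition Q_cell :: "(real^'d) set \<Rightarrow> nat \<Rightarrow> (real^'d) set set \<Rightarrow> 'd sfun set" where
  "Q_cell \<Omega> k \<T> = {q. (\<forall>K\<in>\<T>. \<exists>p\<in>polys (k - 1). \<forall>x\<in>interior K. q x = p x) \<and>
                      (LINT x:\<Omega>|lebesgue. q x) = 0}"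

definition Q_face :: "nat \<Rightarrow> (real^'d) set set \<Rightarrow> 'd sfun set" where
  "Q_face k \<T> = {q. \<forall>F\<in>mesh_faces \<T>. \<exists>p\<in>polys k. \<forall>x\<in>rel_interior F. q x = p x}"

definition V_space :: "(real^'d) set \<Rightarrow> nat \<Rightarrow> (real^'d) set set \<Rightarrow> ('d vfun \<times> 'd vfun) set" where
  "V_space \<Omega> k \<T> = V_cell k \<T> \<times> V_face \<Omega> k \<T>"

definition Q_space :: "(real^'d) set \<Rightarrow> nat \<Rightarrow> (real^'d) set set \<Rightarrow> ('d sfun \<times> 'd sfun) set" where
  "Q_space \<Omega> k \<T> = Q_cell \<Omega> k \<T> \<times> Q_face k \<T>"

definition X_space ::
  "(real^'d) set \<Rightarrow> nat \<Rightarrow> (real^'d) set set \<Rightarrow>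
    (('d vfun \<times> 'd vfun) \<times> ('d sfun \<times> 'd sfun)) set" where
  "X_space \<Omega> k \<T> = V_space \<Omega> k \<T> \<times> Q_space \<Omega> k \<T>"

fun d_form ::
  "(real^'d) set set \<Rightarrow> real \<Rightarrow> real \<Rightarrow> 'd vfun \<times> 'd vfun \<Rightarrow> 'd vfun \<times> 'd vfun \<Rightarrow> real" where
  "d_form \<T> \<nu> \<eta> (u, ub) (v, vb) =
     cell_ip \<T> (\<lambda>x. \<nu> *\<^sub>R grad_vec u x) (grad_vec v)
     + bdry_ip \<T> (\<lambda>K F x. (\<nu> * \<eta> * inverse (diameter K)) *\<^sub>R (cell_trace K u x - ub x))
                 (\<lambda>K F x. cell_trace K v x - vb x)
     - bdry_ip \<T> (\<lambda>K F x. \<nu> *\<^sub>R (cell_trace K (grad_vec u) x *v outward_normal K F))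
                 (\<lambda>K F x. cell_trace K v x - vb x)
     - bdry_ip \<T> (\<lambda>K F x. \<nu> *\<^sub>R (cell_trace K (grad_vec v) x *v outward_normal K F))
                 (\<lambda>K F x. cell_trace K u x - ub x)"

fun b_form :: "(real^'d) set set \<Rightarrow> 'd vfun \<Rightarrow> 'd sfun \<times> 'd sfun \<Rightarrow> real" where
  "b_form \<T> v (q, qb) =
     - cell_ip \<T> q (divergence v)
     + bdry_ip \<T> (\<lambda>K F x. qb x) (\<lambda>K F x. cell_trace K v x \<bullet> outward_normal K F)"

fun a_form ::
  "(real^'d) set set \<Rightarrow> real \<Rightarrow> real \<Rightarrow> real \<Rightarrow>
    ('d vfun \<times> 'd vfun) \<times> ('d sfun \<times> 'd sfun) \<Rightarrow>
    ('d vfun \<times> 'd vfun) \<times> ('d sfun \<times> 'd sfun) \<Rightarrow> real" where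
  "a_form \<T> \<nu> \<tau> \<eta> ((u, ub), p) ((v, vb), q) =
     \<tau> * cell_ip \<T> u v + d_form \<T> \<nu> \<eta> (u, ub) (v, vb) + b_form \<T> v p + b_form \<T> u q"

fun norm_v1 :: "(real^'d) set set \<Rightarrow> real \<Rightarrow> 'd vfun \<times> 'd vfun \<Rightarrow> real" where
  "norm_v1 \<T> \<eta> (v, vb) = sqrt (
     (cell_norm \<T> (grad_vec v))\<^sup>2
     + \<eta> * (bdry_norm \<T> (\<lambda>K F x. (diameter K powr (-1/2)) *\<^sub>R (cell_trace K v x - vb x)))\<^sup>2)"

fun norm_v ::
  "(real^'d) set set \<Rightarrow> real \<Rightarrow> real \<Rightarrow> real \<Rightarrow> 'd vfun \<times> 'd vfun \<Rightarrow> real" where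
  "norm_v \<T> \<nu> \<tau> \<eta> (v, vb) =
     sqrt (\<tau> * (cell_norm \<T> v)\<^sup>2 + \<nu> * (norm_v1 \<T> \<eta> (v, vb))\<^sup>2)"

fun norm_q0 :: "(real^'d) set set \<Rightarrow> real \<Rightarrow> 'd sfun \<times> 'd sfun \<Rightarrow> real" where
  "norm_q0 \<T> \<eta> (q, qb) = sqrt (
     (cell_norm \<T> q)\<^sup>2
     + inverse \<eta> * (bdry_norm \<T> (\<lambda>K F x. (diameter K powr (1/2)) *\<^sub>R qb x))\<^sup>2)"

fun norm_q1 :: "(real^'d) set set \<Rightarrow> real \<Rightarrow> 'd sfun \<times> 'd sfun \<Rightarrow> real" where
  "norm_q1 \<T> \<eta> (q, qb) = sqrt (
     (cell_norm \<T> (grad q))\<^sup>2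
     + \<eta> * (bdry_norm \<T> (\<lambda>K F x. (diameter K powr (-1/2)) *\<^sub>R (cell_trace K q x - qb x)))\<^sup>2)"

definition norm_q ::
  "(real^'d) set \<Rightarrow> nat \<Rightarrow> (real^'d) set set \<Rightarrow> real \<Rightarrow> real \<Rightarrow> real \<Rightarrow>
    'd sfun \<times> 'd sfun \<Rightarrow> real" where
  "norm_q \<Omega> k \<T> \<nu> \<tau> \<eta> q = sqrt (Inf
     {inverse \<nu> * (norm_q0 \<T> \<eta> q1)\<^sup>2 + inverse \<tau> * (norm_q1 \<T> \<eta> q2)\<^sup>2 | q1 q2.
        q1 \<in> Q_space \<Omega> k \<T> \<and> q2 \<in> Q_space \<Omega> k \<T> \<and>
        q = (\<lambda>x. fst q1 x + fst q2 x, \<lambda>x. snd q1 x + snd q2 x)})"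

fun norm_X ::
  "(real^'d) set \<Rightarrow> nat \<Rightarrow> (real^'d) set set \<Rightarrow> real \<Rightarrow> real \<Rightarrow> real \<Rightarrow>
    ('d vfun \<times> 'd vfun) \<times> ('d sfun \<times> 'd sfun) \<Rightarrow> real" where
  "norm_X \<Omega> k \<T> \<nu> \<tau> \<eta> (v, q) =
     sqrt ((norm_v \<T> \<nu> \<tau> \<eta> v)\<^sup>2 + (norm_q \<Omega> k \<T> \<nu> \<tau> \<eta> q)\<^sup>2)"

end

theory Submission
  imports Defs
begin

text \<open>
  Cauchy--Schwarz reduces the claim to the consistency terms of \<open>d\<^sub>h\<close> and to \<open>b\<^sub>h\<close>. The former need
  the discrete trace inequality. For \<open>b\<^sub>h\<close>, split the pressure as in the infimum defining \<open>\<parallel>\<cdot>\<parallel>\<^sub>q\<close>. Against the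
  \<open>(q, 0)\<close>-part one may replace \<open>v\<close> by \<open>v - vb\<close> on cell boundaries, because the normal flux of the
  single-valued \<open>vb\<close> cancels over the mesh. Against the \<open>(q, 1)\<close>-part one integrates by parts and applies
  the trace inequality to \<open>v\<close>.

  Both the trace inequality and the divergence theorem on a simplex rest on one formula: for a facet
  \<open>F\<close> with opposite vertex \<open>a\<close> at distance \<open>h\<close>, the integral of \<open>h * f\<close> over \<open>F\<close> is the integral of
  \<open>d * f + (x - a) \<bullet> \<nabla>f\<close> over \<open>K\<close>, which is Fubini in cone coordinates \<open>x = a + r (y - a)\<close>.
\<close>

section \<open>Surface measure and cone coordinates\<close>

text \<open>The obstacle is uniformity: the constant has to be fixed before the mesh and before
  \<nu> and \<tau>. The mesh enters the estimates only through the constant of the trace inequality,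
  and that constant is made from the dimension, the degree and the shape regularity by comparing a
  cell with a ball inside it. Polynomials of bounded degree are invariant under translation and
  dilation, so every such ball scales to the unit ball. The parameters disappear because in each
  term of the form the weights of the two paired norms multiply to the coefficient of that term;
  \<eta> meets its inverse in the same way, and \<eta> > 1 lets an unweighted jump be bounded by the
  penalised one. The infimum in the pressure norm may fail to be attained, so the bound is shown for
  every splitting with one constant and then passed to the infimum.

  \<open>face_lborel\<close> is the image of a product measure under an arbitrarily chosen
  orthonormal basis, with no built-in relation to the measure on the whole space. The link is that
  every orthonormal basis, in particular one of the facet directions completed by the normal,
  produces \<open>lborel\<close>.\<close>

abbreviation lborel_PiM :: "'i set \<Rightarrow> ('i \<Rightarrow> real) measure" where
  "lborel_PiM B \<equiv> Pi\<^sub>M B (\<lambda>_. lborel)"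

text \<open>One coordinate at a time, the one-dimensional substitution contributes one factor
  \<open>r\<close>. With \<open>r = 1\<close> this is translation invariance of the product measure;
  with general \<open>r\<close> it produces the power of \<open>r\<close> in cone coordinates. The
  restriction to \<open>B\<close> is there because points of the product space are extensional
  functions.\<close>

lemma nn_integral_PiM_lborel_affine:
  fixes f :: "('i \<Rightarrow> real) \<Rightarrow> ennreal"
  assumes "finite B" "r > 0" and "f \<in> borel_measurable (lborel_PiM B)"
  shows "(\<integral>\<^sup>+t. f t \<partial>lborel_PiM B) =
    ennreal (r ^ card B) * (\<integral>\<^sup>+t. f (\<lambda>b\<in>B. w b + r * t b) \<partial>lborel_PiM B)"
  using assms(1,3)
proof (induction B arbitrary: f rule: finite_induct)
  case empty
  interpret product_sigma_finite "\<lambda>_. lborel :: real measure" by standard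
  show ?case by (simp add: nn_integral_empty restrict_def PiM_empty nn_integral_count_space_finite)
next
  case (insert i B)
  interpret product_sigma_finite "\<lambda>_. lborel :: real measure" by standard
  note insert.prems[measurable]
  have 1: "(\<lambda>b\<in>insert i B. w b + r * (t(i := y)) b) = (\<lambda>b\<in>B. w b + r * t b)(i := w i + r * y)" for t y
    using insert.hyps by (auto simp: fun_eq_iff)
  have [measurable]: "(\<lambda>t. \<lambda>b\<in>B. w b + r * t b) \<in> lborel_PiM B \<rightarrow>\<^sub>M lborel_PiM B"
    by measurable
  have [measurable]: "(\<lambda>t. \<lambda>b\<in>insert i B. w b + r * t b) \<in> lborel_PiM (insert i B) \<rightarrow>\<^sub>M lborel_PiM (insert i B)"
    by measurable
  have m: "(\<lambda>y. f (x(i := y))) \<in> borel_measurable borel" if "x \<in> space (lborel_PiM B)" for x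
  proof -
    have "(\<lambda>y. x(i := y)) \<in> borel \<rightarrow>\<^sub>M lborel_PiM (insert i B)"
      using that by (intro measurable_PiM_single') (auto simp: space_PiM PiE_iff extensional_def)
    from measurable_comp[OF this insert.prems] show ?thesis by (simp add: o_def)
  qed
  define g where "g = (\<lambda>x. \<integral>\<^sup>+y. f (x(i := w i + r * y)) \<partial>lborel)"
  have [measurable]: "g \<in> borel_measurable (lborel_PiM B)"
    unfolding g_def by measurable
  have "(\<integral>\<^sup>+t. f t \<partial>lborel_PiM (insert i B)) = (\<integral>\<^sup>+x. \<integral>\<^sup>+y. f (x(i := y)) \<partial>lborel \<partial>lborel_PiM B)"
    using insert by (subst product_nn_integral_insert) auto
  also have "\<dots> = (\<integral>\<^sup>+x. ennreal r * g x \<partial>lborel_PiM B)"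
    unfolding g_def using assms(2) m by (intro nn_integral_cong, subst nn_integral_real_affine[where c=r and t="w i"]) auto
  also have "\<dots> = ennreal r * (\<integral>\<^sup>+x. g x \<partial>lborel_PiM B)"
    by (rule nn_integral_cmult) measurable
  also have "(\<integral>\<^sup>+x. g x \<partial>lborel_PiM B) = ennreal (r ^ card B) * (\<integral>\<^sup>+t. g (\<lambda>b\<in>B. w b + r * t b) \<partial>lborel_PiM B)"
    by (rule insert.IH) measurable
  also have "(\<integral>\<^sup>+t. g (\<lambda>b\<in>B. w b + r * t b) \<partial>lborel_PiM B) =
     (\<integral>\<^sup>+t. f (\<lambda>b\<in>insert i B. w b + r * t b) \<partial>lborel_PiM (insert i B))"
  proof -
    have "(\<integral>\<^sup>+t. f (\<lambda>b\<in>insert i B. w b + r * t b) \<partial>lborel_PiM (insert i B)) =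
      (\<integral>\<^sup>+t. \<integral>\<^sup>+y. f (\<lambda>b\<in>insert i B. w b + r * (t(i := y)) b) \<partial>lborel \<partial>lborel_PiM B)"
      using insert.hyps by (subst product_nn_integral_insert) auto
    then show ?thesis unfolding g_def 1 by simp
  qed
  finally show ?case
    using insert.hyps assms(2) by (simp add: ennreal_mult' mult.assoc del: restrict_apply fun_upd_apply)
qed

lemma orthonormal_inner:
  assumes "pairwise orthogonal C" "\<And>b. b \<in> C \<Longrightarrow> norm b = 1" "b \<in> C" "c \<in> C"
  shows "b \<bullet> c = (if b = c then 1 else 0)"
  using assms by (auto simp: pairwise_def orthogonal_def norm_eq_1)

lemma orthonormal_expansion:
  fixes C :: "'a::euclidean_space set"
  assumes C: "pairwise orthogonal C" "\<And>b. b \<in> C \<Longrightarrow> norm b = 1" and card: "card C = DIM('a)"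
  shows "(\<Sum>b\<in>C. (x \<bullet> b) *\<^sub>R b) = x"
proof -
  have fin: "finite C" using card by (metis DIM_positive card.infinite less_irrefl)
  have "0 \<notin> C" using C(2) by force
  then have ind: "independent C" using C(1) pairwise_orthogonal_independent by blast
  then have span: "span C = UNIV"
    by (metis card dim_eq_card_independent dim_eq_full)
  obtain u where u: "x = (\<Sum>b\<in>C. u b *\<^sub>R b)"
    using span_finite[OF fin] span by blast
  have "x \<bullet> b = u b" if "b \<in> C" for b
  proof -
    have "x \<bullet> b = (\<Sum>c\<in>C. u c * (c \<bullet> b))" by (simp add: u inner_sum_left)
    also have "\<dots> = (\<Sum>c\<in>C. if c = b then u c else 0)"
      using that by (intro sum.cong) (auto simp: orthonormal_inner[OF C])
    finally show ?thesis using that fin by simp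
  qed
  then show ?thesis using u by auto
qed

lemma nn_integral_lborel_translate:
  fixes v :: "'a::euclidean_space"
  assumes [measurable]: "f \<in> borel_measurable borel"
  shows "(\<integral>\<^sup>+x. f (v + x) \<partial>lborel) = (\<integral>\<^sup>+x. f x \<partial>lborel)"
  by (subst (2) lborel_distr_plus[of v, symmetric]) (simp add: nn_integral_distr)

text \<open>Both measures are translation invariant, hence proportional by Fubini, and they agree on the
  unit ball.\<close>

lemma lborel_eq_orthonormal_PiM:
  fixes C :: "'a::euclidean_space set"
  assumes C: "pairwise orthogonal C" "\<And>b. b \<in> C \<Longrightarrow> norm b = 1" and card: "card C = DIM('a)"
  shows "(lborel :: 'a measure) = distr (lborel_PiM C) borel (\<lambda>t. \<Sum>b\<in>C. t b *\<^sub>R b)"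
proof -
  define S where "S t = (\<Sum>b\<in>C. t b *\<^sub>R b)" for t :: "'a \<Rightarrow> real"
  define \<mu> where "\<mu> = distr (lborel_PiM C) borel S"
  have fin: "finite C" using card by (metis DIM_positive card.infinite less_irrefl)
  interpret product_sigma_finite "\<lambda>_. lborel :: real measure" by standard
  have [measurable]: "S \<in> (lborel_PiM C) \<rightarrow>\<^sub>M borel"
    unfolding S_def by measurable
  have sets[measurable_cong]: "sets \<mu> = sets borel" and space: "space \<mu> = UNIV"
    by (simp_all add: \<mu>_def)
  note inner_C = orthonormal_inner[OF C]
  note coord = orthonormal_expansion[OF C card]
  have norm_S: "norm (S t) = sqrt (\<Sum>b\<in>C. (t b)\<^sup>2)" for t
  proof -
    have "S t \<bullet> S t = (\<Sum>c\<in>C. \<Sum>b\<in>C. t c * (t b * (b \<bullet> c)))"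
      by (simp add: S_def inner_sum_left inner_sum_right sum_distrib_left)
    also have "\<dots> = (\<Sum>c\<in>C. \<Sum>b\<in>C. if b = c then t b * t b else 0)"
      by (intro sum.cong refl) (auto simp: inner_C)
    finally show ?thesis using fin by (simp add: norm_eq_sqrt_inner power2_eq_square)
  qed
  have trans: "(\<integral>\<^sup>+x. f (v + x) \<partial>\<mu>) = (\<integral>\<^sup>+x. f x \<partial>\<mu>)" if [measurable]: "f \<in> borel_measurable borel" for f v
  proof -
    have "(\<integral>\<^sup>+x. f x \<partial>\<mu>) = (\<integral>\<^sup>+t. f (S t) \<partial>lborel_PiM C)"
      by (simp add: \<mu>_def nn_integral_distr)
    also have "\<dots> = (\<integral>\<^sup>+t. f (S (\<lambda>b\<in>C. v \<bullet> b + 1 * t b)) \<partial>lborel_PiM C)"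
      by (subst nn_integral_PiM_lborel_affine[OF fin, of 1 _ "\<lambda>b. v \<bullet> b"]) auto
    also have "\<dots> = (\<integral>\<^sup>+t. f (v + S t) \<partial>lborel_PiM C)"
      by (intro nn_integral_cong) (simp add: S_def algebra_simps sum.distrib coord)
    also have "\<dots> = (\<integral>\<^sup>+x. f (v + x) \<partial>\<mu>)"
      by (simp add: \<mu>_def nn_integral_distr)
    finally show ?thesis by simp
  qed
  define D where "D = cball (0::'a) 1"
  have [measurable]: "D \<in> sets borel" by (simp add: D_def)
  \<comment> \<open>In orthonormal coordinates the norm is the Euclidean norm of the coefficients,
    so both measures of a ball come from the same volume formula. Radius 1 fixes the proportionality
    factor, and all radii together give \<sigma>-finiteness, which Fubini needs.\<close>
  have cball: "emeasure \<mu> (cball 0 r) = emeasure lborel (cball (0::'a) r)" if "r > 0" for r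
  proof -
    have "emeasure \<mu> (cball 0 r) = emeasure (lborel_PiM C) ({f. sqrt (\<Sum>i\<in>C. (f i)\<^sup>2) \<le> r} \<inter> space (lborel_PiM C))"
      unfolding \<mu>_def by (subst emeasure_distr) (auto simp: norm_S intro!: arg_cong2[where f=emeasure])
    also have "\<dots> = ennreal (unit_ball_vol (real (card C)) * r ^ card C)"
      by (rule emeasure_cball_aux) (use fin that in auto)
    finally show ?thesis using that by (simp add: card emeasure_cball)
  qed
  have D_eq: "emeasure \<mu> D = emeasure lborel D" unfolding D_def by (rule cball) simp
  interpret \<mu>: sigma_finite_measure \<mu>
  proof
    show "\<exists>A. countable A \<and> A \<subseteq> sets \<mu> \<and> \<Union> A = space \<mu> \<and> (\<forall>a\<in>A. emeasure \<mu> a \<noteq> \<infinity>)"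
    proof (intro exI[of _ "range (\<lambda>n::nat. cball 0 (Suc n))"] conjI ballI)
      show "\<Union> (range (\<lambda>n::nat. cball (0::'a) (real (Suc n)))) = space \<mu>"
      proof -
        have "\<exists>n. norm x \<le> real (Suc n)" for x :: 'a
          using real_arch_simple[of "norm x"] by (meson le_Suc_eq of_nat_le_iff order_refl order_trans)
        then show ?thesis unfolding space by auto
      qed
      fix a assume "a \<in> range (\<lambda>n::nat. cball (0::'a) (real (Suc n)))"
      then obtain n :: nat where "a = cball 0 (real (Suc n))" by auto
      then show "emeasure \<mu> a \<noteq> \<infinity>"
        using cball[of "real (Suc n)"] less_imp_neq[OF emeasure_compact_finite[OF compact_cball, of 0 "real (Suc n)"]] by simp
    qed (auto simp: sets)
  qed
  interpret P: pair_sigma_finite \<mu> "lborel :: 'a measure" ..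
  \<comment> \<open>The double integral of \<open>indicator A (y + x) * indicator D y\<close> is
    evaluated in both orders. Integrating over \<open>x\<close> first, invariance of \<mu> yields
    the left side; substituting \<open>y - x\<close> for \<open>y\<close>, as invariance of
    \<open>lborel\<close> permits, yields the right side.\<close>
  have eq: "emeasure \<mu> A * emeasure lborel D = emeasure lborel A * emeasure \<mu> D" if A[measurable]: "A \<in> sets borel" for A
  proof -
    have "emeasure \<mu> A * emeasure lborel D = (\<integral>\<^sup>+y. (\<integral>\<^sup>+x. indicator A x \<partial>\<mu>) * indicator D y \<partial>lborel)"
      by (simp add: nn_integral_cmult sets)
    also have "\<dots> = (\<integral>\<^sup>+y. (\<integral>\<^sup>+x. indicator A (y + x) * indicator D y \<partial>\<mu>) \<partial>lborel)"
    proof (rule nn_integral_cong)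
      fix y :: 'a
      have "(\<integral>\<^sup>+x. indicator A (y + x) * indicator D y \<partial>\<mu>) = (\<integral>\<^sup>+x. indicator A (y + x) \<partial>\<mu>) * indicator D y"
        by (rule nn_integral_multc) measurable
      also have "(\<integral>\<^sup>+x. indicator A (y + x) \<partial>\<mu>) = (\<integral>\<^sup>+x. indicator A x \<partial>\<mu>)"
        by (rule trans) measurable
      finally show "(\<integral>\<^sup>+x. indicator A x \<partial>\<mu>) * indicator D y = (\<integral>\<^sup>+x. indicator A (y + x) * indicator D y \<partial>\<mu>)" ..
    qed
    also have "\<dots> = (\<integral>\<^sup>+x. (\<integral>\<^sup>+y. indicator A (y + x) * indicator D y \<partial>lborel) \<partial>\<mu>)"
      by (rule P.Fubini') measurable
    also have "\<dots> = (\<integral>\<^sup>+x. (\<integral>\<^sup>+y. indicator A y * indicator D (y - x) \<partial>lborel) \<partial>\<mu>)"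
    proof (rule nn_integral_cong)
      fix x :: 'a
      have "(\<integral>\<^sup>+y. indicator A (x + y) * indicator D (x + y - x) \<partial>lborel) = (\<integral>\<^sup>+y. indicator A y * indicator D (y - x) \<partial>lborel)"
        by (rule nn_integral_lborel_translate[of "\<lambda>y. indicator A y * indicator D (y - x)"]) measurable
      then show "(\<integral>\<^sup>+y. indicator A (y + x) * indicator D y \<partial>lborel) = (\<integral>\<^sup>+y. indicator A y * indicator D (y - x) \<partial>lborel)"
        by (simp add: add.commute)
    qed
    also have "\<dots> = (\<integral>\<^sup>+y. (\<integral>\<^sup>+x. indicator A y * indicator D (y - x) \<partial>\<mu>) \<partial>lborel)"
      by (rule P.Fubini'[symmetric]) measurable
    also have "\<dots> = (\<integral>\<^sup>+y. indicator A y * emeasure \<mu> D \<partial>lborel)"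
    proof (rule nn_integral_cong)
      fix y :: 'a
      have "(\<integral>\<^sup>+x. indicator A y * indicator D (y - x) \<partial>\<mu>) = indicator A y * (\<integral>\<^sup>+x. indicator D (y - x) \<partial>\<mu>)"
        by (rule nn_integral_cmult) measurable
      \<comment> \<open>The ball is symmetric about 0, which turns the reflected indicator into a
        translated one, to which invariance of \<mu> applies.\<close>
      also have "(\<integral>\<^sup>+x. indicator D (y - x) \<partial>\<mu>) = (\<integral>\<^sup>+x. indicator D (- y + x) \<partial>\<mu>)"
        by (intro nn_integral_cong) (auto simp: D_def indicator_def norm_minus_commute)
      also have "\<dots> = (\<integral>\<^sup>+x. indicator D x \<partial>\<mu>)"
        by (rule trans) measurable
      finally show "(\<integral>\<^sup>+x. indicator A y * indicator D (y - x) \<partial>\<mu>) = indicator A y * emeasure \<mu> D"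
        by (simp add: sets)
    qed
    also have "\<dots> = emeasure lborel A * emeasure \<mu> D"
      by (simp add: nn_integral_multc)
    finally show ?thesis .
  qed
  have "lborel = \<mu>"
  proof (rule measure_eqI)
    fix A :: "'a set" assume "A \<in> sets lborel"
    then have "emeasure \<mu> A * emeasure lborel D = emeasure lborel A * emeasure lborel D"
      using eq D_eq by simp
    moreover have "emeasure lborel D \<noteq> 0" "emeasure lborel D \<noteq> top"
      by (auto simp: D_def emeasure_cball less_imp_neq[OF unit_ball_vol_pos, symmetric])
    ultimately show "emeasure lborel A = emeasure \<mu> A"
      by (metis ennreal_mult_divide_eq)
  qed (simp add: sets)
  then show ?thesis by (simp add: \<mu>_def S_def[abs_def])
qed

lemma sets_face_lborel [simp, measurable_cong]: "sets (face_lborel F) = sets borel"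
  and space_face_lborel [simp]: "space (face_lborel F) = UNIV"
  by (simp_all add: face_lborel_def)

text \<open>The map from \<open>(r, y)\<close> to \<open>a + r *\<^sub>R (y - a)\<close>, with
  \<open>y\<close> in the hyperplane of \<open>F\<close>, has Jacobian
  \<open>h * r ^ card B\<close>: a factor \<open>h\<close> from the normal coordinate and one
  \<open>r\<close> from each tangential one. \<open>U\<close> and \<open>R\<close> are kept
  abstract, related only by \<open>U_iff\<close>, so that nothing about simplices is needed
  here.\<close>

lemma nn_integral_cone:
  fixes F R U :: "'a::euclidean_space set" and g :: "'a \<Rightarrow> ennreal"
  defines "B \<equiv> orthonormal_directions F"
  assumes ne: "F \<noteq> {}" and fin: "finite B"
    and orth: "pairwise orthogonal (insert n B)" "\<And>b. b \<in> insert n B \<Longrightarrow> norm b = 1"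
    and n: "n \<notin> B" and card: "Suc (card B) = DIM('a)"
    and h: "h > 0" and height: "\<And>y. y \<in> F \<Longrightarrow> n \<bullet> (y - a) = h"
    and U_pos: "\<And>x. x \<in> U \<Longrightarrow> 0 < n \<bullet> (x - a)"
    and U_iff: "\<And>y r. r > 0 \<Longrightarrow> n \<bullet> (y - a) = h \<Longrightarrow> a + r *\<^sub>R (y - a) \<in> U \<longleftrightarrow> r < 1 \<and> y \<in> R"
    and [measurable]: "U \<in> sets borel" "R \<in> sets borel" "g \<in> borel_measurable borel"
  shows "(\<integral>\<^sup>+x. g x * indicator U x \<partial>lborel) =
    (\<integral>\<^sup>+y. (\<integral>\<^sup>+r. ennreal (h * r ^ card B) * indicator {0<..<1} r * g (a + r *\<^sub>R (y - a)) \<partial>lborel)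
      * indicator R y \<partial>face_lborel F)"
proof -
  interpret product_sigma_finite "\<lambda>_. lborel :: real measure" by standard
  define g1 where "g1 x = g x * indicator U x" for x
  have [measurable]: "g1 \<in> borel_measurable borel" unfolding g1_def by measurable
  define S where "S t = (\<Sum>b\<in>B. t b *\<^sub>R b)" for t :: "'a \<Rightarrow> real"
  have [measurable]: "S \<in> (lborel_PiM B) \<rightarrow>\<^sub>M borel"
    unfolding S_def by measurable
  \<comment> \<open>The base point is the very one chosen inside \<open>face_lborel\<close>, so
    \<open>face\<close> holds by unfolding.\<close>
  define p where "p = (SOME a. a \<in> F)"
  have p: "p \<in> F" unfolding p_def using ne by (simp add: some_in_eq)
  have face: "face_lborel F = distr (lborel_PiM B) borel (\<lambda>t. p + S t)"
    by (simp add: face_lborel_def p_def B_def S_def[abs_def])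
  interpret PB: sigma_finite_measure "lborel_PiM B"
    using fin by (rule sigma_finite)
  interpret PL: pair_sigma_finite "lborel_PiM B" "lborel :: real measure" ..
  let ?w = "\<lambda>r. ennreal (h * r ^ card B) * indicator {0<..<1} r" and ?g = "\<lambda>r t. g (a + r *\<^sub>R (p + S t - a))"
  define q where "q b = (p - a) \<bullet> b" for b
  have nS: "n \<bullet> S t = 0" for t
    using orthonormal_inner[OF orth] n by (auto simp: S_def inner_sum_right intro!: sum.neutral)
  have card': "card (insert n B) = DIM('a)" using n fin card by simp
  have q: "S q = p - a - h *\<^sub>R n"
  proof -
    have "p - a = (\<Sum>b\<in>insert n B. ((p - a) \<bullet> b) *\<^sub>R b)"
      using orthonormal_expansion[OF orth card'] by simp
    also have "\<dots> = h *\<^sub>R n + S q"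
      using n fin height[OF p] by (simp add: S_def q_def inner_commute)
    finally show ?thesis by simp
  qed
  define G where "G s = (\<integral>\<^sup>+t. g1 (a + s *\<^sub>R n + S t) \<partial>lborel_PiM B)" for s :: real
  have [measurable]: "G \<in> borel_measurable borel" unfolding G_def by measurable
  have "(\<integral>\<^sup>+x. g1 x \<partial>lborel) = (\<integral>\<^sup>+x. g1 (a + x) \<partial>lborel)"
    by (rule nn_integral_lborel_translate[symmetric]) measurable
  also have "\<dots> = (\<integral>\<^sup>+t. g1 (a + (\<Sum>b\<in>insert n B. t b *\<^sub>R b)) \<partial>(lborel_PiM (insert n B)))"
    by (subst lborel_eq_orthonormal_PiM[OF orth card']) (simp_all add: nn_integral_distr)
  also have "\<dots> = (\<integral>\<^sup>+s. G s \<partial>lborel)"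
  proof -
    have "(\<Sum>b\<in>insert n B. (t(n := s)) b *\<^sub>R b) = s *\<^sub>R n + S t" for t s
      using n fin by (auto simp: S_def intro!: sum.cong)
    then show ?thesis
      using n fin by (subst product_nn_integral_insert_rev) (simp_all add: G_def[abs_def] add.assoc del: fun_upd_apply sum.insert)
  qed
  \<comment> \<open>The substitution \<open>s = h * r\<close> measures the distance from the apex
    relative to the height of \<open>F\<close>, so that \<open>r\<close> becomes the cone
    parameter.\<close>
  also have "\<dots> = (\<integral>\<^sup>+r. h * G (h * r) \<partial>lborel)"
    using h by (subst nn_integral_real_affine[where c=h and t=0]) (auto simp: nn_integral_cmult)
  also have "\<dots> = (\<integral>\<^sup>+r. ?w r *
      (\<integral>\<^sup>+y. g (a + r *\<^sub>R (y - a)) * indicator R y \<partial>face_lborel F) \<partial>lborel)"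
  proof (rule nn_integral_cong)
    fix r :: real
    show "ennreal h * G (h * r) = ?w r *
      (\<integral>\<^sup>+y. g (a + r *\<^sub>R (y - a)) * indicator R y \<partial>face_lborel F)"
    proof (cases "r > 0")
      case False
      have "g1 (a + (h * r) *\<^sub>R n + S t) = 0" for t
      proof -
        have "n \<bullet> (a + (h * r) *\<^sub>R n + S t - a) = h * r"
          using nS orth(2)[of n] by (simp add: inner_simps norm_eq_1)
        then have "a + (h * r) *\<^sub>R n + S t \<notin> U"
          using U_pos False h by (metis linorder_not_less mult_le_0_iff order_less_imp_le)
        then show ?thesis by (simp add: g1_def)
      qed
      then show ?thesis using False by (simp add: G_def)
    next
      case True
      \<comment> \<open>The slice at relative height \<open>r\<close> is the hyperplane of
        \<open>F\<close> dilated by \<open>r\<close> about \<open>a\<close>. Here \<open>q\<close>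
        holds the tangential coordinates of \<open>p - a\<close>, so shifting by
        \<open>r * q\<close> centres the slice at the image of \<open>p\<close> and leaves the
        coordinates of \<open>F\<close> itself as integration variables.\<close>
      have "G (h * r) = ennreal (r ^ card B) *
         (\<integral>\<^sup>+t. g1 (a + (h * r) *\<^sub>R n + S (\<lambda>b\<in>B. r * q b + r * t b)) \<partial>lborel_PiM B)"
        unfolding G_def by (rule nn_integral_PiM_lborel_affine[OF fin True]) measurable
      also have "(\<integral>\<^sup>+t. g1 (a + (h * r) *\<^sub>R n + S (\<lambda>b\<in>B. r * q b + r * t b)) \<partial>lborel_PiM B)
        = (\<integral>\<^sup>+t. ?g r t * indicator {0<..<1} r * indicator R (p + S t) \<partial>lborel_PiM B)"
      proof (rule nn_integral_cong)
        fix t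
        have "S (\<lambda>b\<in>B. r * q b + r * t b) = r *\<^sub>R S q + r *\<^sub>R S t"
          by (simp add: S_def scaleR_add_left sum.distrib scaleR_sum_right)
        then have eq: "a + (h * r) *\<^sub>R n + S (\<lambda>b\<in>B. r * q b + r * t b) = a + r *\<^sub>R (p + S t - a)"
          by (simp add: q algebra_simps)
        have "n \<bullet> (p + S t - a) = h" using height[OF p] nS by (simp add: inner_simps)
        from U_iff[OF True this] have "a + r *\<^sub>R (p + S t - a) \<in> U \<longleftrightarrow> r < 1 \<and> p + S t \<in> R" .
        then show "g1 (a + (h * r) *\<^sub>R n + S (\<lambda>b\<in>B. r * q b + r * t b)) =
          ?g r t * indicator {0<..<1} r * indicator R (p + S t)"
          unfolding eq g1_def using True by (auto simp: indicator_def)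
      qed
      also have "\<dots> = indicator {0<..<1} r * (\<integral>\<^sup>+t. ?g r t * indicator R (p + S t) \<partial>lborel_PiM B)"
        by (subst nn_integral_cmult[symmetric]) (auto simp: mult_ac)
      also have "(\<integral>\<^sup>+t. ?g r t * indicator R (p + S t) \<partial>lborel_PiM B) =
         (\<integral>\<^sup>+y. g (a + r *\<^sub>R (y - a)) * indicator R y \<partial>face_lborel F)"
        by (simp add: face nn_integral_distr)
      finally show ?thesis using h True by (simp add: ennreal_mult mult_ac)
    qed
  qed
  also have "\<dots> = (\<integral>\<^sup>+r. (\<integral>\<^sup>+t. ?w r *
      (?g r t * indicator R (p + S t)) \<partial>lborel_PiM B) \<partial>lborel)"
    by (simp add: face nn_integral_distr nn_integral_cmult)
  also have "\<dots> = (\<integral>\<^sup>+t. (\<integral>\<^sup>+r. ?w r *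
      (?g r t * indicator R (p + S t)) \<partial>lborel) \<partial>lborel_PiM B)"
    by (rule PL.Fubini') measurable
  also have "\<dots> = (\<integral>\<^sup>+t. (\<integral>\<^sup>+r. ?w r *
      ?g r t \<partial>lborel) * indicator R (p + S t) \<partial>lborel_PiM B)"
    by (simp add: nn_integral_multc mult.assoc[symmetric])
  also have "\<dots> = (\<integral>\<^sup>+y. (\<integral>\<^sup>+r. ?w r *
      g (a + r *\<^sub>R (y - a)) \<partial>lborel) * indicator R y \<partial>face_lborel F)"
    by (simp add: face nn_integral_distr)
  finally show ?thesis by (simp add: g1_def)
qed

section \<open>Geometry of a simplex\<close>

text \<open>Keeping the vertex set as a parameter allows facets to be indexed by the opposite vertex
  and points to be handled through barycentric coordinates.\<close>

locale simplex_cell =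
  fixes C K :: "'a::euclidean_space set"
  assumes indep: "\<not> affine_dependent C" and card_C: "card C = Suc DIM('a)" and K_eq: "K = convex hull C"
begin

lemma finite_C: "finite C"
  using card_C card.infinite by fastforce

lemma ne_C: "C - {a} \<noteq> {}"
proof
  assume "C - {a} = {}"
  then have "card C \<le> card {a}" by (intro card_mono) auto
  then show False using card_C DIM_positive[where 'a='a] by simp
qed

lemma affine_hull_C: "affine hull C = UNIV"
proof -
  have "aff_dim C = int DIM('a)" using aff_dim_affine_independent[OF indep] card_C by simp
  then show ?thesis using aff_dim_eq_full by blast
qed

lemma compact_K: "compact K" "convex K"
  using finite_C by (auto simp: K_eq finite_imp_compact_convex_hull)

lemma barycentric_exists:
  obtains u where "sum u C = 1" "(\<Sum>c\<in>C. u c *\<^sub>R c) = x"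
  using affine_hull_C affine_hull_finite[OF finite_C] by blast

lemma barycentric_unique:
  assumes "sum u C = sum v C" "(\<Sum>c\<in>C. u c *\<^sub>R c) = (\<Sum>c\<in>C. v c *\<^sub>R c)" "c \<in> C"
  shows "u c = v c"
proof (rule ccontr)
  assume "u c \<noteq> v c"
  then have "affine_dependent C"
    unfolding affine_dependent_explicit_finite[OF finite_C] using assms
    by (intro exI[of _ "\<lambda>c. u c - v c"]) (auto simp: sum_subtractf scaleR_diff_left)
  then show False using indep by simp
qed

text \<open>Full dimension identifies the interior with the relative interior, which consists of the
  combinations with positive weights; uniqueness of barycentric coordinates identifies those weights
  with \<open>u\<close>.\<close>

lemma interior_K_iff:
  assumes "sum u C = 1" "(\<Sum>c\<in>C. u c *\<^sub>R c) = x"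
  shows "x \<in> interior K \<longleftrightarrow> (\<forall>c\<in>C. 0 < u c)"
proof -
  have "interior K = rel_interior K"
    by (metis affine_hull_C affine_hull_convex_hull K_eq rel_interior_interior)
  then have "x \<in> interior K \<longleftrightarrow> (\<exists>v. (\<forall>c\<in>C. 0 < v c) \<and> sum v C = 1 \<and> (\<Sum>c\<in>C. v c *\<^sub>R c) = x)"
    by (simp add: K_eq rel_interior_convex_hull_explicit[OF indep])
  then show ?thesis using assms barycentric_unique[of u] by metis
qed

lemma interior_nonempty: "interior K \<noteq> {}"
proof -
  have "(\<Sum>c\<in>C. 1 / real (card C)) = 1" using card_C by simp
  from interior_K_iff[OF this refl] card_C show ?thesis by auto
qed

lemma closure_interior_K: "closure (interior K) = K"
  using convex_closure_interior[OF compact_K(2) interior_nonempty] compact_K(1) by (simp add: compact_imp_closed closure_closed)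

lemma facet_iff: "F facet_of K \<longleftrightarrow> (\<exists>a\<in>C. F = convex hull (C - {a}))"
  unfolding K_eq facet_of_convex_hull_affine_independent[OF indep] using ne_C by auto

abbreviation opp :: "'a \<Rightarrow> 'a set" where
  "opp a \<equiv> convex hull (C - {a})"

lemma dim_facet_directions:
  assumes "a \<in> C" "F = opp a"
  shows "Suc (dim {x - y | x y. x \<in> F \<and> y \<in> F}) = DIM('a)"
proof -
  obtain p where p: "p \<in> C - {a}" using ne_C by blast
  then have pF: "p \<in> F" using assms(2) hull_inc by metis
  have ind: "\<not> affine_dependent (C - {a})" using indep affine_independent_Diff by blast
  have 1: "aff_dim F = int DIM('a) - 1"
    using aff_dim_affine_independent[OF ind] card_C finite_C assms by (simp add: aff_dim_convex_hull)
  have 2: "aff_dim F = int (dim ((\<lambda>x. - p + x) ` F))"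
    using pF by (intro aff_dim_eq_dim) (simp add: hull_inc)
  have 3: "span {x - y | x y. x \<in> F \<and> y \<in> F} = span ((\<lambda>x. - p + x) ` F)"
  proof (rule span_eq[THEN iffD2, OF conjI])
    show "{x - y | x y. x \<in> F \<and> y \<in> F} \<subseteq> span ((\<lambda>x. - p + x) ` F)"
    proof clarify
      fix x y assume "x \<in> F" "y \<in> F"
      then have "(- p + x) - (- p + y) \<in> span ((\<lambda>x. - p + x) ` F)"
        by (intro span_diff span_base) auto
      then show "x - y \<in> span ((\<lambda>x. - p + x) ` F)" by simp
    qed
    show "(\<lambda>x. - p + x) ` F \<subseteq> span {x - y | x y. x \<in> F \<and> y \<in> F}"
    proof clarify
      fix x assume "x \<in> F"
      then have "x - p \<in> span {x - y | x y. x \<in> F \<and> y \<in> F}"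
        using pF by (intro span_base) blast
      then show "- p + x \<in> span {x - y | x y. x \<in> F \<and> y \<in> F}" by simp
    qed
  qed
  then have "dim {x - y | x y. x \<in> F \<and> y \<in> F} = dim ((\<lambda>x. - p + x) ` F)"
    by (rule span_eq_dim)
  then show ?thesis using 1 2 by linarith
qed

lemma orthonormal_directions_facet:
  assumes "a \<in> C" "F = opp a"
  defines "B \<equiv> orthonormal_directions F"
  shows "pairwise orthogonal B" "\<And>b. b \<in> B \<Longrightarrow> norm b = 1"
    "span B = span {x - y | x y. x \<in> F \<and> y \<in> F}" "finite B" "Suc (card B) = DIM('a)"
proof -
  let ?D = "{x - y | x y. x \<in> F \<and> y \<in> F}"
  let ?P = "\<lambda>B. pairwise orthogonal B \<and> (\<forall>b\<in>B. norm b = 1) \<and> span B = span ?D"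
  have "\<exists>B. ?P B"
  proof -
    obtain B where "pairwise orthogonal B" "\<And>b. b \<in> B \<Longrightarrow> norm b = 1" "span B = span ?D"
      by (rule orthonormal_basis_subspace[OF subspace_span[of ?D]]) blast
    then show ?thesis by blast
  qed
  then have P: "?P B" unfolding B_def orthonormal_directions_def by (rule someI_ex)
  then show "pairwise orthogonal B" "\<And>b. b \<in> B \<Longrightarrow> norm b = 1" "span B = span ?D" by auto
  have "0 \<notin> B" using P by force
  then have ind: "independent B" using P pairwise_orthogonal_independent by blast
  then show "finite B" using independent_imp_finite by blast
  have "card B = dim (span B)" using ind by (simp add: dim_eq_card_independent)
  also have "\<dots> = dim ?D" using P by (simp only: dim_span)
  finally have "card B = dim ?D" .
  then show "Suc (card B) = DIM('a)" using dim_facet_directions[OF assms(1,2)] by simp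
qed

text \<open>A vector that is constant on \<open>F\<close> is orthogonal to the facet directions,
  hence a multiple of one fixed unit normal \<open>m\<close>, and the side on which \<open>a\<close>
  lies decides the sign. So the description in \<open>outward_normal\<close> has exactly one
  solution. Uniqueness up to sign is recorded separately in order to compare the normals of two
  cells sharing a facet.\<close>

lemma facet_normal:
  assumes a: "a \<in> C" and F: "F = opp a"
  defines "n \<equiv> outward_normal K F" and "B \<equiv> orthonormal_directions F"
  shows "norm n = 1" "pairwise orthogonal (insert n B)" "n \<notin> B"
    "\<exists>h>0. \<forall>y\<in>F. n \<bullet> (y - a) = h" "\<And>x y. x \<in> K \<Longrightarrow> y \<in> F \<Longrightarrow> n \<bullet> x \<le> n \<bullet> y"
    "\<And>l. norm l = 1 \<Longrightarrow> (\<And>x y. x \<in> F \<Longrightarrow> y \<in> F \<Longrightarrow> l \<bullet> x = l \<bullet> y) \<Longrightarrow> l = n \<or> l = - n"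
proof -
  let ?D = "{x - y | x y. x \<in> F \<and> y \<in> F}"
  note B = orthonormal_directions_facet[OF a F, folded B_def]
  have "dim ?D < DIM('a)" using dim_facet_directions[OF a F] by simp
  then obtain m0 where m0: "m0 \<noteq> 0" "\<And>y. y \<in> span ?D \<Longrightarrow> orthogonal m0 y"
    using orthogonal_to_subspace_exists[of ?D] by blast
  obtain p where p: "p \<in> C - {a}" using ne_C by blast
  then have pF: "p \<in> F" unfolding F using hull_inc by metis
  have const0: "m0 \<bullet> y = m0 \<bullet> p" if "y \<in> F" for y
  proof -
    have "y - p \<in> span ?D" using that pF by (intro span_base) blast
    from m0(2)[OF this] show ?thesis by (simp add: orthogonal_def inner_diff_right)
  qed
  \<comment> \<open>Otherwise all vertices would lie in one hyperplane, although their affine hull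
    is the whole space.\<close>
  have ne0: "m0 \<bullet> (p - a) \<noteq> 0"
  proof
    assume 0: "m0 \<bullet> (p - a) = 0"
    have "C \<subseteq> {x. m0 \<bullet> x = m0 \<bullet> a}"
    proof
      fix c assume "c \<in> C"
      then show "c \<in> {x. m0 \<bullet> x = m0 \<bullet> a}"
        using 0 const0[of c] hull_inc[of c "C - {a}"] by (cases "c = a") (auto simp: F inner_diff_right)
    qed
    then have "affine hull C \<subseteq> {x. m0 \<bullet> x = m0 \<bullet> a}"
      by (intro hull_minimal) (auto simp: affine_hyperplane)
    then have "m0 \<bullet> (a + m0) = m0 \<bullet> a" using affine_hull_C by blast
    then show False using m0(1) by (simp add: inner_add_right)
  qed
  \<comment> \<open>The sign is chosen so that \<open>m\<close> points away from the opposite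
    vertex, which makes \<open>h\<close> positive.\<close>
  define m where "m = (sgn (m0 \<bullet> (p - a)) / norm m0) *\<^sub>R m0"
  define h where "h = m \<bullet> (p - a)"
  have m1: "norm m = 1" using m0(1) ne0 by (auto simp: m_def sgn_if)
  have h0: "h > 0" using m0(1) ne0 by (auto simp: h_def m_def sgn_if zero_less_divide_iff divide_neg_pos)
  have mD: "y \<in> span ?D \<Longrightarrow> m \<bullet> y = 0" for y using m0(2)[of y] by (simp add: m_def orthogonal_def)
  have mh: "m \<bullet> (y - a) = h" if "y \<in> F" for y
    using const0[OF that] by (simp add: m_def h_def inner_diff_right)
  have mB: "b \<in> B \<Longrightarrow> m \<bullet> b = 0" for b using mD B(3) span_base by blast
  have mnB: "m \<notin> B" using mB[of m] m1 by (auto simp: norm_eq_1)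
  have orth: "pairwise orthogonal (insert m B)"
    using B(1) mB by (auto simp: pairwise_insert orthogonal_def inner_commute)
  have norm1: "b \<in> insert m B \<Longrightarrow> norm b = 1" for b using m1 B(2) by auto
  have card: "card (insert m B) = DIM('a)" using mnB B(4,5) by simp
  have ub: "m \<bullet> x \<le> m \<bullet> p" if "x \<in> K" for x
  proof -
    have "K \<subseteq> {x. m \<bullet> x \<le> m \<bullet> p}"
      unfolding K_eq
    proof (rule hull_minimal)
      show "C \<subseteq> {x. m \<bullet> x \<le> m \<bullet> p}"
      proof
        fix c assume "c \<in> C"
        then show "c \<in> {x. m \<bullet> x \<le> m \<bullet> p}"
          using h0 mh[of c] mh[OF pF] hull_inc[of c "C - {a}"] by (cases "c = a") (auto simp: F inner_diff_right)
      qed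
    qed (rule convex_halfspace_le)
    then show ?thesis using that by blast
  qed
  have par: "l = (l \<bullet> m) *\<^sub>R m" if lc: "\<And>x y. x \<in> F \<Longrightarrow> y \<in> F \<Longrightarrow> l \<bullet> x = l \<bullet> y" for l
  proof -
    have "?D \<subseteq> {x. l \<bullet> x = 0}"
    proof clarify
      fix x y assume "x \<in> F" "y \<in> F"
      from lc[OF this] show "l \<bullet> (x - y) = 0" by (simp add: inner_diff_right)
    qed
    then have "span ?D \<subseteq> {x. l \<bullet> x = 0}" by (intro span_minimal) (auto simp: subspace_hyperplane)
    then have lB: "b \<in> B \<Longrightarrow> l \<bullet> b = 0" for b using B(3) span_base by blast
    have "l = (\<Sum>b\<in>insert m B. (l \<bullet> b) *\<^sub>R b)"
      using orthonormal_expansion[OF orth norm1 card] by simp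
    also have "\<dots> = (l \<bullet> m) *\<^sub>R m" using mnB B(4) lB by simp
    finally show ?thesis .
  qed
  have abs1: "\<bar>l \<bullet> m\<bar> = 1" if l: "norm l = 1" "l = (l \<bullet> m) *\<^sub>R m" for l
  proof -
    have "norm l = \<bar>l \<bullet> m\<bar> * norm m" by (subst l(2)) (rule norm_scaleR)
    then show ?thesis using l m1 by simp
  qed
  have m_le: "m \<bullet> x \<le> m \<bullet> y" if "x \<in> K" "y \<in> F" for x y
    using ub[OF that(1)] mh[OF that(2)] mh[OF pF] by (simp add: inner_diff_right)
  have "n = m"
    unfolding n_def outward_normal_def
  proof (rule the_equality)
    show "norm m = 1 \<and> (\<forall>x\<in>K. \<forall>y\<in>F. m \<bullet> x \<le> m \<bullet> y)"
      using m1 m_le by blast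
  next
    fix l assume l: "norm l = 1 \<and> (\<forall>x\<in>K. \<forall>y\<in>F. l \<bullet> x \<le> l \<bullet> y)"
    have FK: "F \<subseteq> K" unfolding F K_eq by (rule hull_mono) auto
    \<comment> \<open>Points of \<open>F\<close> also belong to \<open>K\<close>, so the supporting
      inequality holds in both directions.\<close>
    have "l \<bullet> x = l \<bullet> y" if "x \<in> F" "y \<in> F" for x y using l that FK by (meson antisym subsetD)
    then have eq: "l = (l \<bullet> m) *\<^sub>R m" by (rule par)
    have "a \<in> K" using a K_eq hull_inc by metis
    then have "l \<bullet> a \<le> l \<bullet> p" using l pF by blast
    moreover have "l \<bullet> (p - a) = (l \<bullet> m) * h" unfolding h_def by (subst eq) simp
    ultimately have "0 \<le> (l \<bullet> m) * h" by (simp add: inner_diff_right)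
    then have "l \<bullet> m \<ge> 0" using h0 by (simp add: zero_le_mult_iff)
    then show "l = m" using eq abs1[OF _ eq] l by simp
  qed
  then show "norm n = 1" "pairwise orthogonal (insert n B)" "n \<notin> B" "\<exists>h>0. \<forall>y\<in>F. n \<bullet> (y - a) = h"
    "\<And>x y. x \<in> K \<Longrightarrow> y \<in> F \<Longrightarrow> n \<bullet> x \<le> n \<bullet> y"
    using m1 orth mnB h0 mh m_le by auto
  fix l assume l: "norm l = 1" "\<And>x y. x \<in> F \<Longrightarrow> y \<in> F \<Longrightarrow> l \<bullet> x = l \<bullet> y"
  from par[of l] l(2) have eq: "l = (l \<bullet> m) *\<^sub>R m" by blast
  from abs1[OF l(1) eq] consider "l \<bullet> m = 1" | "l \<bullet> m = -1" by linarith
  then show "l = n \<or> l = - n"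
  proof cases
    case 1
    then show ?thesis using eq \<open>n = m\<close> by simp
  next
    case 2
    then have "l = (-1) *\<^sub>R m" using eq by simp
    then show ?thesis using \<open>n = m\<close> by simp
  qed
qed

definition height where
  "height a = (THE h. \<forall>y\<in>opp a. outward_normal K (opp a) \<bullet> (y - a) = h)"

lemma height:
  assumes a: "a \<in> C" and F: "F = opp a"
  shows "height a > 0" "\<And>y. y \<in> F \<Longrightarrow> outward_normal K F \<bullet> (y - a) = height a"
proof -
  let ?n = "outward_normal K F"
  obtain h where h: "h > 0" "\<And>y. y \<in> F \<Longrightarrow> ?n \<bullet> (y - a) = h"
    using facet_normal(4)[OF a F] by blast
  obtain p where p: "p \<in> C - {a}" using ne_C by blast
  then have pF: "p \<in> F" unfolding F using hull_inc by metis
  have "height a = h" unfolding height_def F[symmetric]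
    by (rule the_equality) (use h pF in auto)
  then show "height a > 0" "\<And>y. y \<in> F \<Longrightarrow> ?n \<bullet> (y - a) = height a" using h by auto
qed

abbreviation nrm :: "'a \<Rightarrow> 'a" where
  "nrm a \<equiv> outward_normal K (opp a)"

text \<open>All vertices except \<open>a\<close> have the same height over \<open>a\<close>, so the
  height of a point depends on \<open>u a\<close> alone. Through this identity, the position of a
  point relative to a facet becomes a condition on one barycentric coordinate.\<close>

lemma height_barycentric:
  assumes a: "a \<in> C" and u: "sum u C = 1"
  shows "nrm a \<bullet> ((\<Sum>c\<in>C. u c *\<^sub>R c) - a) = (1 - u a) * height a"
proof -
  let ?n = "nrm a"
  have "(\<Sum>c\<in>C. u c *\<^sub>R c) - a = (\<Sum>c\<in>C. u c *\<^sub>R (c - a))"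
    by (simp add: scaleR_diff_right sum_subtractf scaleR_sum_left[symmetric] u)
  then have "?n \<bullet> ((\<Sum>c\<in>C. u c *\<^sub>R c) - a) = (\<Sum>c\<in>C. u c * (?n \<bullet> (c - a)))"
    by (simp add: inner_sum_right)
  also have "\<dots> = (\<Sum>c\<in>C - {a}. u c * (?n \<bullet> (c - a)))"
    using finite_C a by (simp add: sum.remove)
  also have "\<dots> = (\<Sum>c\<in>C - {a}. u c * height a)"
    using height(2)[OF a refl] hull_inc[of _ "C - {a}"] by (intro sum.cong) auto
  also have "\<dots> = (1 - u a) * height a"
    using u finite_C a by (simp add: sum_distrib_right[symmetric] sum_diff1)
  finally show ?thesis .
qed

lemma interior_height_pos:
  assumes a: "a \<in> C" and x: "x \<in> interior K"
  shows "0 < nrm a \<bullet> (x - a)"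
proof -
  obtain u where u: "sum u C = 1" "(\<Sum>c\<in>C. u c *\<^sub>R c) = x" by (rule barycentric_exists)
  have pos: "\<forall>c\<in>C. 0 < u c" using interior_K_iff[OF u] x by simp
  have "0 < sum u (C - {a})" using finite_C ne_C pos by (intro sum_pos) auto
  then have "u a < 1" using u(1) a finite_C by (simp add: sum_diff1)
  then show ?thesis using height_barycentric[OF a u(1)] height(1)[OF a refl] u(2) by simp
qed

lemma rel_interior_opp_iff:
  assumes a: "a \<in> C" and u: "sum u C = 1" "(\<Sum>c\<in>C. u c *\<^sub>R c) = x"
  shows "x \<in> rel_interior (opp a) \<longleftrightarrow> u a = 0 \<and> (\<forall>c\<in>C - {a}. 0 < u c)"
proof -
  have ind: "\<not> affine_dependent (C - {a})" using indep affine_independent_Diff by blast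
  note explicit = rel_interior_convex_hull_explicit[OF ind]
  show ?thesis
  proof
    assume "x \<in> rel_interior (opp a)"
    then obtain w where w: "\<forall>c\<in>C - {a}. 0 < w c" "sum w (C - {a}) = 1" "(\<Sum>c\<in>C - {a}. w c *\<^sub>R c) = x"
      unfolding explicit by blast
    define w' where "w' = w(a := 0)"
    have "(\<Sum>c\<in>C - {a}. w' c) = (\<Sum>c\<in>C - {a}. w c)" "(\<Sum>c\<in>C - {a}. w' c *\<^sub>R c) = (\<Sum>c\<in>C - {a}. w c *\<^sub>R c)"
      by (auto simp: w'_def intro!: sum.cong)
    then have "sum w' C = sum u C" "(\<Sum>c\<in>C. w' c *\<^sub>R c) = (\<Sum>c\<in>C. u c *\<^sub>R c)"
      using w u a finite_C by (simp_all add: sum.remove w'_def)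
    from barycentric_unique[OF this] have eq: "w' c = u c" if "c \<in> C" for c using that .
    have "u a = 0" using eq[OF a] by (simp add: w'_def)
    moreover have "0 < u c" if "c \<in> C - {a}" for c using eq[of c] w(1)[rule_format, of c] that by (auto simp: w'_def)
    ultimately show "u a = 0 \<and> (\<forall>c\<in>C - {a}. 0 < u c)" by blast
  next
    assume "u a = 0 \<and> (\<forall>c\<in>C - {a}. 0 < u c)"
    then show "x \<in> rel_interior (opp a)"
      unfolding explicit using u a finite_C by (intro CollectI exI[of _ u]) (simp add: sum.remove)
  qed
qed

text \<open>If \<open>y\<close> lies in the hyperplane of \<open>F\<close> and has coordinates
  \<open>u\<close>, then \<open>u a = 0\<close>, and the point on the ray has coordinate
  \<open>1 - r\<close> at \<open>a\<close> and \<open>r * u c\<close> at the other vertices;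
  positivity can be read off. This supplies the hypothesis \<open>U_iff\<close> of the cone
  formula.\<close>

lemma cone_interior_iff:
  assumes a: "a \<in> C" and F: "F = opp a" and r: "r > 0"
    and y: "outward_normal K F \<bullet> (y - a) = height a"
  shows "a + r *\<^sub>R (y - a) \<in> interior K \<longleftrightarrow> r < 1 \<and> y \<in> rel_interior F"
proof -
  obtain u where u: "sum u C = 1" "(\<Sum>c\<in>C. u c *\<^sub>R c) = y" by (rule barycentric_exists)
  have ua: "u a = 0" using height_barycentric[OF a u(1)] height(1)[OF a F] y u(2) F by simp
  let ?v = "\<lambda>c. if c = a then 1 - r else r * u c"
  have uC: "sum u (C - {a}) = 1" "(\<Sum>c\<in>C - {a}. u c *\<^sub>R c) = y"
    using u ua a finite_C by (auto simp: sum.remove)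
  have v1: "sum ?v C = 1"
    using a finite_C uC by (simp add: sum.remove sum_distrib_left[symmetric])
  have v2: "(\<Sum>c\<in>C. ?v c *\<^sub>R c) = a + r *\<^sub>R (y - a)"
    using a finite_C by (simp add: sum.remove uC(2)[symmetric] scaleR_sum_right algebra_simps)
  show ?thesis
    unfolding interior_K_iff[OF v1 v2] F rel_interior_opp_iff[OF a u] using a r ua by (auto simp: zero_less_mult_iff)
qed

end

lemma rel_interior_borel: "rel_interior S \<in> sets borel" for S :: "'a::euclidean_space set"
proof -
  have "openin (top_of_set (affine hull S)) (rel_interior S)" by (rule openin_rel_interior)
  then obtain T where "open T" "rel_interior S = affine hull S \<inter> T" by (auto simp: openin_open)
  then show ?thesis by (simp add: closed_affine_hull borel_open borel_closed sets.Int)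
qed

section \<open>The divergence theorem on a simplex\<close>

lemma set_integrable_finite_bounded:
  fixes f :: "'a \<Rightarrow> 'b::{banach, second_countable_topology}"
  assumes "A \<in> sets M" "f \<in> borel_measurable M" "emeasure M A < \<infinity>" "\<And>x. x \<in> A \<Longrightarrow> norm (f x) \<le> B"
  shows "set_integrable M A f"
  unfolding set_integrable_def
  by (rule integrableI_bounded_set_indicator[of A M f B]) (use assms in auto)

context simplex_cell
begin

lemma emeasure_interior: "emeasure lborel (interior K) < \<infinity>"
proof -
  have "emeasure lborel (interior K) \<le> emeasure lborel K"
    using compact_K(1) by (intro emeasure_mono interior_subset) (auto simp: borel_compact)
  also have "\<dots> < \<infinity>" using compact_K(1) emeasure_compact_finite by auto
  finally show ?thesis .
qed

lemma bounded_on_K: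
  fixes f :: "'a \<Rightarrow> 'b::real_normed_vector"
  assumes "continuous_on UNIV f"
  shows "\<exists>M. \<forall>x\<in>K. norm (f x) \<le> M"
proof -
  have "bounded (f ` K)"
    using assms compact_K(1) by (meson compact_continuous_image compact_imp_bounded continuous_on_subset subset_UNIV)
  then show ?thesis unfolding bounded_iff by blast
qed

lemma set_integrable_interior:
  fixes f :: "'a \<Rightarrow> 'b::{banach, second_countable_topology}"
  assumes "continuous_on UNIV f"
  shows "set_integrable lborel (interior K) f"
proof -
  obtain M where "\<forall>x\<in>K. norm (f x) \<le> M" using bounded_on_K[OF assms] by blast
  then show ?thesis
    using interior_subset[of K] emeasure_interior borel_measurable_continuous_onI[OF assms]
    by (intro set_integrable_finite_bounded[where B=M]) auto
qed

lemma facet_subset: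
  assumes "F = opp a"
  shows "rel_interior F \<subseteq> K" "F \<subseteq> K"
  using hull_mono[of "C - {a}" C convex] rel_interior_subset[of F] by (auto simp: assms K_eq)

text \<open>The integrand of the cone coordinates is the radial derivative of
  \<open>r \<mapsto> r ^ d * f (a + r (y - a))\<close>.\<close>

lemma cone_nn_integral:
  fixes f :: "'a \<Rightarrow> real" and f' :: "'a \<Rightarrow> 'a"
  assumes a: "a \<in> C" and F: "F = opp a"
    and der: "\<And>x. (f has_derivative (\<lambda>v. f' x \<bullet> v)) (at x)" and cont: "continuous_on UNIV f'"
  defines "g \<equiv> \<lambda>x. real DIM('a) * f x + f' x \<bullet> (x - a)"
  assumes pos: "\<And>x. x \<in> K \<Longrightarrow> f x \<ge> 0" "\<And>x. x \<in> K \<Longrightarrow> g x \<ge> 0"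
  shows "(\<integral>\<^sup>+x. ennreal (g x) * indicator (interior K) x \<partial>lborel) =
     (\<integral>\<^sup>+y. ennreal (height a * f y) * indicator (rel_interior F) y \<partial>face_lborel F)"
proof -
  let ?B = "orthonormal_directions F" and ?n = "outward_normal K F"
  note B = orthonormal_directions_facet[OF a F] and n = facet_normal[OF a F] and h = height[OF a F]
  have f_cont: "continuous_on UNIV f"
    using der by (meson continuous_at_imp_continuous_on has_derivative_continuous)
  have g_cont: "continuous_on UNIV g" unfolding g_def
    by (intro continuous_intros f_cont cont)
  have [measurable]: "g \<in> borel_measurable borel" "f \<in> borel_measurable borel"
    using f_cont g_cont by (auto intro: borel_measurable_continuous_onI)
  have aK: "a \<in> K" using a K_eq hull_inc by metis
  have Fne: "F \<noteq> {}" using ne_C[of a] F by simp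
  let ?k = "\<lambda>y r. ennreal (height a * r ^ card ?B) * indicator {0<..<1} r * ennreal (g (a + r *\<^sub>R (y - a)))"
  have "(\<integral>\<^sup>+x. ennreal (g x) * indicator (interior K) x \<partial>lborel) =
    (\<integral>\<^sup>+y. (\<integral>\<^sup>+r. ?k y r \<partial>lborel)
      * indicator (rel_interior F) y \<partial>face_lborel F)"
  proof (rule nn_integral_cone[where n="?n"])
    show "pairwise orthogonal (insert ?n ?B)" "?n \<notin> ?B" using n by auto
    show "\<And>b. b \<in> insert ?n ?B \<Longrightarrow> norm b = 1" using n B by auto
    show "\<And>x. x \<in> interior K \<Longrightarrow> 0 < ?n \<bullet> (x - a)" using interior_height_pos[OF a] F by simp
    show "\<And>y r. 0 < r \<Longrightarrow> ?n \<bullet> (y - a) = height a \<Longrightarrow> (a + r *\<^sub>R (y - a) \<in> interior K) = (r < 1 \<and> y \<in> rel_interior F)"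
      using cone_interior_iff[OF a F] by blast
  qed (use Fne B h in \<open>auto simp: rel_interior_borel\<close>)
  also have "\<dots> = (\<integral>\<^sup>+y. ennreal (height a * f y) * indicator (rel_interior F) y \<partial>face_lborel F)"
  proof (rule nn_integral_cong)
    fix y
    show "(\<integral>\<^sup>+r. ?k y r \<partial>lborel)
      * indicator (rel_interior F) y = ennreal (height a * f y) * indicator (rel_interior F) y"
    proof (cases "y \<in> rel_interior F")
      case True
      then have yK: "y \<in> K" using facet_subset[OF F] by auto
      have inK: "a + r *\<^sub>R (y - a) \<in> K" if "0 \<le> r" "r \<le> 1" for r
      proof -
        have "(1 - r) *\<^sub>R a + r *\<^sub>R y \<in> K"
          using compact_K(2) aK yK that by (intro convexD) auto
        then show ?thesis by (simp add: algebra_simps)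
      qed
      let ?\<phi> = "\<lambda>r. height a * r ^ card ?B * g (a + r *\<^sub>R (y - a))"
      let ?\<Phi> = "\<lambda>r. height a * r ^ DIM('a) * f (a + r *\<^sub>R (y - a))"
      let ?D = "\<lambda>r. f' (a + r *\<^sub>R (y - a)) \<bullet> (y - a)"
      have "(\<integral>\<^sup>+r. ?k y r \<partial>lborel)
        = (\<integral>\<^sup>+r. ennreal (?\<phi> r) * indicator {0..1} r \<partial>lborel)"
      \<comment> \<open>The endpoints are a null set, so the open interval of the cone coordinates
        may be closed for the fundamental theorem of calculus.\<close>
      proof (rule nn_integral_cong_AE)
        have "AE r in lborel. r \<notin> {0, 1::real}"
          by (intro AE_not_in countable_imp_null_set_lborel) auto
        then show "AE r in lborel. ?k y r
           = ennreal (?\<phi> r) * indicator {0..1} r"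
        proof eventually_elim
          case (elim r)
          show ?case
          proof (cases "0 < r \<and> r < 1")
            case True
            then have "0 \<le> g (a + r *\<^sub>R (y - a))" using pos(2)[OF inK] by simp
            then show ?thesis using True h(1) by (simp add: ennreal_mult)
          qed (use elim in \<open>auto simp: indicator_def\<close>)
        qed
      qed
      \<comment> \<open>At 0 the factor \<open>r ^ DIM('a)\<close> vanishes because the dimension is
        positive, and at 1 the value is \<open>height a * f y\<close>.\<close>
      also have "\<dots> = ennreal (?\<Phi> 1 - ?\<Phi> 0)"
      proof (rule nn_integral_FTC_Icc)
        fix r :: real assume r: "r \<in> {0..1}"
        show "0 \<le> ?\<phi> r" using pos(2)[OF inK, of r] r h(1) by simp
        have *: "((\<lambda>r. f (a + r *\<^sub>R (y - a))) has_derivative (\<lambda>s. f' (a + r *\<^sub>R (y - a)) \<bullet> (s *\<^sub>R (y - a)))) (at r)"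
          by (rule has_derivative_compose[OF _ der]) (auto intro!: derivative_eq_intros)
        then have "((\<lambda>r. f (a + r *\<^sub>R (y - a))) has_real_derivative ?D r) (at r)"
          by (simp add: has_field_derivative_def mult.commute[of _ "_ \<bullet> _"] inner_commute) 
        moreover have "((\<lambda>r. height a * r ^ DIM('a)) has_real_derivative height a * (real DIM('a) * r ^ card ?B)) (at r)"
          using DERIV_cmult[OF DERIV_pow[of "DIM('a)" r UNIV], of "height a"] by (simp flip: B(5))
        ultimately have "(?\<Phi> has_real_derivative height a * (real DIM('a) * r ^ card ?B) * f (a + r *\<^sub>R (y - a))
           + (?D r) * (height a * r ^ DIM('a))) (at r)"
          by (rule DERIV_mult[rotated])
        moreover have "height a * (real DIM('a) * r ^ card ?B) * f (a + r *\<^sub>R (y - a))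
           + (?D r) * (height a * r ^ DIM('a)) = ?\<phi> r"
          by (simp add: g_def algebra_simps flip: B(5))
        ultimately show "(?\<Phi> has_real_derivative ?\<phi> r) (at r)" by simp
      qed auto
      also have "?\<Phi> 1 - ?\<Phi> 0 = height a * f y" by simp
      finally show ?thesis by simp
    qed simp
  qed
  finally show ?thesis .
qed

text \<open>The cone formula for \<open>f = 1\<close> expresses the area of the facet by the volume
  of the cell, which is finite. Only after this are continuous functions known to be integrable over
  facets.\<close>

lemma emeasure_rel_interior:
  assumes a: "a \<in> C" and F: "F = opp a"
  shows "emeasure (face_lborel F) (rel_interior F) < \<infinity>"
proof -
  have "(\<integral>\<^sup>+x. ennreal (real DIM('a) * 1 + 0 \<bullet> (x - a)) * indicator (interior K) x \<partial>lborel) =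
     (\<integral>\<^sup>+y. ennreal (height a * 1) * indicator (rel_interior F) y \<partial>face_lborel F)"
    by (rule cone_nn_integral[OF a F]) auto
  then have "ennreal (real DIM('a)) * emeasure lborel (interior K) = ennreal (height a) * emeasure (face_lborel F) (rel_interior F)"
    by (simp add: nn_integral_cmult_indicator rel_interior_borel)
  moreover have "ennreal (real DIM('a)) * emeasure lborel (interior K) < \<infinity>"
    using emeasure_interior by (simp add: ennreal_mult_less_top)
  ultimately have "ennreal (height a) * emeasure (face_lborel F) (rel_interior F) < \<infinity>" by simp
  then show ?thesis using height(1)[OF a F] by (auto simp: ennreal_mult_less_top)
qed

lemma set_integrable_facet:
  fixes f :: "'a \<Rightarrow> 'b::{banach, second_countable_topology}"
  assumes "continuous_on UNIV f" "F facet_of K"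
  shows "set_integrable (face_lborel F) (rel_interior F) f"
proof -
  obtain a where a: "a \<in> C" and F: "F = opp a" using assms(2) facet_iff by auto
  obtain M where "\<forall>x\<in>K. norm (f x) \<le> M" using bounded_on_K[OF assms(1)] by blast
  then show ?thesis
    using facet_subset[OF F] emeasure_rel_interior[OF a F] borel_measurable_continuous_onI[OF assms(1)]
    by (intro set_integrable_finite_bounded[where B=M])
       (auto simp: rel_interior_borel measurable_cong_sets[OF sets_face_lborel refl])
qed

lemma cone_integral_nonneg:
  fixes f :: "'a \<Rightarrow> real" and f' :: "'a \<Rightarrow> 'a"
  assumes a: "a \<in> C" and F: "F = opp a"
    and der: "\<And>x. (f has_derivative (\<lambda>v. f' x \<bullet> v)) (at x)" and cont: "continuous_on UNIV f'"
  defines "g \<equiv> \<lambda>x. real DIM('a) * f x + f' x \<bullet> (x - a)"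
  assumes pos: "\<And>x. x \<in> K \<Longrightarrow> f x \<ge> 0" "\<And>x. x \<in> K \<Longrightarrow> g x \<ge> 0"
  shows "height a * (LINT y:rel_interior F|face_lborel F. f y) = (LINT x:interior K|lborel. g x)"
proof -
  have f_cont: "continuous_on UNIV f"
    using der by (meson continuous_at_imp_continuous_on has_derivative_continuous)
  have "continuous_on UNIV g" unfolding g_def by (intro continuous_intros f_cont cont)
  then have [measurable]: "g \<in> borel_measurable borel" "f \<in> borel_measurable borel"
    using f_cont by (auto intro: borel_measurable_continuous_onI)
  note rel_interior_borel[measurable]
  have "(LINT y:rel_interior F|face_lborel F. height a * f y) =
    enn2real (\<integral>\<^sup>+y. ennreal (height a * f y) * indicator (rel_interior F) y \<partial>face_lborel F)"
    unfolding set_lebesgue_integral_def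
    by (subst integral_eq_nn_integral, measurable)
      (use pos facet_subset[OF F] height(1)[OF a F] in
        \<open>auto simp: indicator_def intro!: AE_I2 arg_cong[where f=enn2real] nn_integral_cong\<close>)
  also have "\<dots> = enn2real (\<integral>\<^sup>+x. ennreal (g x) * indicator (interior K) x \<partial>lborel)"
    using cone_nn_integral[OF a F der cont] pos by (simp add: g_def)
  also have "\<dots> = (LINT x:interior K|lborel. g x)"
    unfolding set_lebesgue_integral_def
    by (subst integral_eq_nn_integral, measurable)
      (use pos interior_subset[of K] in
        \<open>auto simp: indicator_def intro!: AE_I2 arg_cong[where f=enn2real] nn_integral_cong\<close>)
  finally show ?thesis by simp
qed

text \<open>Adding a large constant to \<open>f\<close> makes both integrands nonnegative.\<close>

lemma cone_integral:
  fixes f :: "'a \<Rightarrow> real" and f' :: "'a \<Rightarrow> 'a"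
  assumes a: "a \<in> C" and F: "F = opp a"
    and der: "\<And>x. (f has_derivative (\<lambda>v. f' x \<bullet> v)) (at x)" and cont: "continuous_on UNIV f'"
  shows "height a * (LINT y:rel_interior F|face_lborel F. f y) =
     (LINT x:interior K|lborel. real DIM('a) * f x + f' x \<bullet> (x - a))"
proof -
  define d where "d = real DIM('a)"
  have d1: "d \<ge> 1" using DIM_positive[where 'a='a] unfolding d_def by linarith
  have facet: "F facet_of K" using a F facet_iff by auto
  have f_cont: "continuous_on UNIV f"
    using der by (meson continuous_at_imp_continuous_on has_derivative_continuous)
  define g where "g x = d * f x + f' x \<bullet> (x - a)" for x
  have g_cont: "continuous_on UNIV g" unfolding g_def
    by (intro continuous_intros f_cont cont)
  obtain M1 where M1: "\<forall>x\<in>K. norm (f x) \<le> M1" using bounded_on_K[OF f_cont] by blast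
  obtain M2 where M2: "\<forall>x\<in>K. norm (g x) \<le> M2" using bounded_on_K[OF g_cont] by blast
  define M where "M = \<bar>M1\<bar> + \<bar>M2\<bar>"
  have M: "0 \<le> f x + M" "0 \<le> g x + d * M" if "x \<in> K" for x
  proof -
    have "\<bar>f x\<bar> \<le> M1" "\<bar>g x\<bar> \<le> M2" using M1 M2 that by auto
    moreover have "1 * M \<le> d * M" using d1 by (intro mult_right_mono) (auto simp: M_def)
    moreover have "M1 \<le> M" "M2 \<le> M" by (auto simp: M_def)
    ultimately show "0 \<le> f x + M" "0 \<le> g x + d * M" by linarith+
  qed
  have int: "set_integrable (face_lborel F) (rel_interior F) k" "set_integrable lborel (interior K) k"
    if "continuous_on UNIV k" for k :: "'a \<Rightarrow> real"
    using set_integrable_facet[OF that facet] set_integrable_interior[OF that] by auto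
  have g': "real DIM('a) * (f x + M) + f' x \<bullet> (x - a) = g x + d * M" for x
    by (simp add: g_def d_def algebra_simps)
  \<comment> \<open>The shift by \<open>M\<close> contributes equally to both sides, since its
    derivative vanishes; subtracting this contribution leaves the formula for
    \<open>f\<close>.\<close>
  have one: "height a * (LINT y:rel_interior F|face_lborel F. M) = (LINT x:interior K|lborel. d * M)"
    using cone_integral_nonneg[OF a F, of "\<lambda>x. M" "\<lambda>x. 0"] by (simp add: M_def d_def)
  have "height a * (LINT y:rel_interior F|face_lborel F. f y) + height a * (LINT y:rel_interior F|face_lborel F. M)
    = height a * (LINT y:rel_interior F|face_lborel F. f y + M)"
    using f_cont int by (subst set_integral_add(2)) (auto simp: algebra_simps)
  also have "\<dots> = (LINT x:interior K|lborel. g x + d * M)"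
    using cone_integral_nonneg[OF a F, of "\<lambda>x. f x + M" f'] der cont M
    by (simp add: g' has_derivative_add_const)
  also have "\<dots> = (LINT x:interior K|lborel. g x) + (LINT x:interior K|lborel. d * M)"
    using g_cont int by (subst set_integral_add(2)) auto
  finally show ?thesis using one by (simp add: g_def d_def)
qed

text \<open>By \<open>height_barycentric\<close>, the functional given by \<open>nrm a\<close> over
  \<open>height a\<close> is, up to an additive constant, minus the barycentric coordinate of
  \<open>a\<close>. On an edge it is therefore a difference of Kronecker deltas.\<close>

lemma normal_vertex_diff:
  assumes "a \<in> C" "b \<in> C" "c \<in> C"
  shows "nrm a \<bullet> (b - c) / height a =
    (if a = c then 1 else 0) - (if a = b then 1 else 0)"
proof -
  let ?n = "nrm a"
  have n: "?n \<bullet> (x - a) = (if a = x then 0 else height a)" if "x \<in> C" for x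
    using that height(2)[OF assms(1) refl, of x] hull_inc[of x "C - {a}"] by auto
  have "?n \<bullet> (b - c) = ?n \<bullet> (b - a) - ?n \<bullet> (c - a)" by (simp add: inner_diff_right)
  then show ?thesis using n[OF assms(2)] n[OF assms(3)] height(1)[OF assms(1) refl] by auto
qed

text \<open>Both identities are linear in \<open>e\<close> and hold for the edges, which span the space.\<close>

lemma normal_height_sums:
  defines "w \<equiv> \<lambda>e a. nrm a \<bullet> e / height a"
  shows "(\<Sum>a\<in>C. w e a) = 0" "(\<Sum>a\<in>C. w e a *\<^sub>R a) = - e"
proof -
  obtain b where b: "b \<in> C" using ne_C by blast
  let ?V = "{e. (\<Sum>a\<in>C. w e a) = 0 \<and> (\<Sum>a\<in>C. w e a *\<^sub>R a) = - e}"
  have sub: "subspace ?V"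
    by (auto simp: subspace_def w_def inner_add_right add_divide_distrib sum.distrib scaleR_add_left
        sum_distrib_left[symmetric] scaleR_sum_right[symmetric] scaleR_scaleR[symmetric] mult.assoc[symmetric]
        simp flip: times_divide_eq_right simp del: scaleR_scaleR)
  have edges: "c - b \<in> ?V" if c: "c \<in> C" for c
  proof -
    have w: "w (c - b) a = (if a = b then 1 else 0) - (if a = c then 1 else 0)" if "a \<in> C" for a
      unfolding w_def using that c b by (rule normal_vertex_diff)
    have "(\<Sum>a\<in>C. w (c - b) a) = 0"
      using finite_C b c by (simp add: w sum_subtractf)
    moreover have "(\<Sum>a\<in>C. w (c - b) a *\<^sub>R a) = (\<Sum>a\<in>C. (if a = b then a else 0) - (if a = c then a else 0))"
      by (intro sum.cong refl) (auto simp: w)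
    then have "(\<Sum>a\<in>C. w (c - b) a *\<^sub>R a) = - (c - b)"
      using finite_C b c by (simp add: sum_subtractf)
    ultimately show ?thesis by simp
  qed
  have "e \<in> ?V"
  proof -
    \<comment> \<open>Since the weights sum to 1, the coordinates of \<open>b + e\<close> are also
      coefficients of \<open>e\<close> in terms of the edges issuing from \<open>b\<close>.\<close>
    obtain u where u: "sum u C = 1" "(\<Sum>c\<in>C. u c *\<^sub>R c) = b + e" by (rule barycentric_exists)
    have "e = (\<Sum>c\<in>C. u c *\<^sub>R (c - b))"
      by (simp add: scaleR_diff_right sum_subtractf u scaleR_sum_left[symmetric])
    also have "\<dots> \<in> ?V" using edges by (intro subspace_sum[OF sub] subspace_scale[OF sub]) auto
    finally show ?thesis .
  qed
  then show "(\<Sum>a\<in>C. w e a) = 0" "(\<Sum>a\<in>C. w e a *\<^sub>R a) = - e" by auto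
qed

lemma facets_eq: "{F. F facet_of K} = (\<lambda>a. opp a) ` C"
  using facet_iff by auto

lemma finite_facets: "finite {F. F facet_of K}"
  using facets_eq finite_C by simp

lemma inj_on_opposite_facet: "inj_on (\<lambda>a. opp a) C"
proof (rule inj_onI, rule ccontr)
  fix a b assume a: "a \<in> C" "b \<in> C" "opp a = opp b" "a \<noteq> b"
  then have "a \<in> opp a" using hull_inc[of a "C - {b}"] by simp
  then show False using height[OF a(1) refl] by fastforce
qed

text \<open>The cone formulas of all facets, weighted by \<open>n\<^sub>a \<bullet> e / height a\<close>: by
  \<open>normal_height_sums\<close> the terms with \<open>f\<close> cancel and the radial derivatives add up to \<open>\<partial>\<^sub>e f\<close>.\<close>

lemma integral_directional_derivative:
  fixes f :: "'a \<Rightarrow> real" and f' :: "'a \<Rightarrow> 'a"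
  assumes der: "\<And>x. (f has_derivative (\<lambda>v. f' x \<bullet> v)) (at x)" and cont: "continuous_on UNIV f'"
  shows "(LINT x:interior K|lborel. f' x \<bullet> e) =
    (\<Sum>F | F facet_of K. (outward_normal K F \<bullet> e) * (LINT y:rel_interior F|face_lborel F. f y))"
proof -
  have f_cont: "continuous_on UNIV f"
    using der by (meson continuous_at_imp_continuous_on has_derivative_continuous)
  define w where "w a = nrm a \<bullet> e / height a" for a
  have w: "(\<Sum>a\<in>C. w a) = 0" "(\<Sum>a\<in>C. w a *\<^sub>R a) = - e"
    unfolding w_def by (rule normal_height_sums)+
  have "(\<Sum>F | F facet_of K. (outward_normal K F \<bullet> e) * (LINT y:rel_interior F|face_lborel F. f y)) =
    (\<Sum>a\<in>C. (nrm a \<bullet> e) *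
       (LINT y:rel_interior (opp a)|face_lborel (opp a). f y))"
    unfolding facets_eq by (subst sum.reindex[OF inj_on_opposite_facet]) simp
  also have "\<dots> = (\<Sum>a\<in>C. w a * (LINT x:interior K|lborel. real DIM('a) * f x + f' x \<bullet> (x - a)))"
  proof (rule sum.cong)
    fix a assume a: "a \<in> C"
    show "(nrm a \<bullet> e) *
       (LINT y:rel_interior (opp a)|face_lborel (opp a). f y) =
       w a * (LINT x:interior K|lborel. real DIM('a) * f x + f' x \<bullet> (x - a))"
      using cone_integral[OF a refl der cont] height(1)[OF a refl] by (simp add: w_def flip: cone_integral[OF a refl der cont])
  qed simp
  also have "\<dots> = (LINT x:interior K|lborel. (\<Sum>a\<in>C. w a * (real DIM('a) * f x + f' x \<bullet> (x - a))))"
  proof -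
    have "(LINT x:interior K|lborel. (\<Sum>a\<in>C. w a * (real DIM('a) * f x + f' x \<bullet> (x - a))))
      = (\<Sum>a\<in>C. LINT x:interior K|lborel. w a * (real DIM('a) * f x + f' x \<bullet> (x - a)))"
      unfolding set_lebesgue_integral_def scaleR_sum_right
      by (rule Bochner_Integration.integral_sum)
        (intro set_integrable_interior[unfolded set_integrable_def] continuous_intros f_cont cont)
    then show ?thesis by simp
  qed
  also have "\<dots> = (LINT x:interior K|lborel. f' x \<bullet> e)"
  proof (rule arg_cong[where f="\<lambda>h. set_lebesgue_integral lborel (interior K) h"], rule ext)
    fix x
    have "(\<Sum>a\<in>C. w a * (real DIM('a) * f x + f' x \<bullet> (x - a))) =
      (\<Sum>a\<in>C. w a * (real DIM('a) * f x + f' x \<bullet> x) - f' x \<bullet> (w a *\<^sub>R a))"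
      by (intro sum.cong refl) (simp add: algebra_simps)
    also have "\<dots> = (\<Sum>a\<in>C. w a) * (real DIM('a) * f x + f' x \<bullet> x) - f' x \<bullet> (\<Sum>a\<in>C. w a *\<^sub>R a)"
      by (simp only: sum_subtractf sum_distrib_right inner_sum_right)
    finally show "(\<Sum>a\<in>C. w a * (real DIM('a) * f x + f' x \<bullet> (x - a))) = f' x \<bullet> e" by (simp add: w)
  qed
  finally show ?thesis ..
qed

end

section \<open>Polynomials on balls\<close>

text \<open>The unit ball is the reference domain to which every ball inside a cell is
  scaled.\<close>

definition ball_ip :: "('a::euclidean_space \<Rightarrow> real) \<Rightarrow> ('a \<Rightarrow> real) \<Rightarrow> real" where
  "ball_ip f g = (LINT x:ball 0 1|lborel. f x * g x)"

lemma set_integrable_ball: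
  fixes f :: "'a::euclidean_space \<Rightarrow> real"
  assumes "continuous_on UNIV f"
  shows "set_integrable lborel (ball c r) f"
proof -
  have "set_integrable lborel (cball c r) f"
    unfolding set_integrable_def
    by (rule borel_integrable_compact) (auto intro: continuous_on_subset[OF assms])
  then show ?thesis by (rule set_integrable_subset) auto
qed

lemma continuous_on_real_polynomial_function:
  "real_polynomial_function f \<Longrightarrow> continuous_on S f"
  using continuous_real_polymonial_function continuous_at_imp_continuous_on by blast

lemma ball_ip_commute: "ball_ip f g = ball_ip g f"
  by (simp add: ball_ip_def mult.commute)

lemma ball_ip_sum_left:
  assumes "finite I" "\<And>i. i \<in> I \<Longrightarrow> real_polynomial_function (f i)" "real_polynomial_function g"
  shows "ball_ip (\<lambda>x. \<Sum>i\<in>I. c i * f i x) g = (\<Sum>i\<in>I. c i * ball_ip (f i) g)"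
proof -
  have int: "integrable lborel (\<lambda>x. indicat_real (ball 0 1) x *\<^sub>R (c i * (f i x * g x)))" if "i \<in> I" for i
  proof -
    have "continuous_on UNIV (\<lambda>x. c i * (f i x * g x))"
      using assms that by (intro continuous_intros continuous_on_real_polynomial_function) auto
    from set_integrable_ball[OF this] show ?thesis by (simp add: set_integrable_def)
  qed
  have "ball_ip (\<lambda>x. \<Sum>i\<in>I. c i * f i x) g = (LINT x|lborel. (\<Sum>i\<in>I. indicat_real (ball 0 1) x *\<^sub>R (c i * (f i x * g x))))"
    by (simp add: ball_ip_def set_lebesgue_integral_def sum_distrib_right sum_distrib_left mult_ac)
  also have "\<dots> = (\<Sum>i\<in>I. (LINT x:ball 0 1|lborel. c i * (f i x * g x)))"
    unfolding set_lebesgue_integral_def by (rule Bochner_Integration.integral_sum) (rule int)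
  finally show ?thesis by (simp add: ball_ip_def)
qed

text \<open>The set in the ball where \<open>f\<close> differs from 0 is open and negligible, hence
  empty. On the line through 0 and an arbitrary \<open>x\<close>, \<open>f\<close> is then a
  polynomial in one variable with infinitely many roots, so it vanishes at \<open>x\<close> as
  well.\<close>

lemma ball_ip_definite:
  fixes f :: "'a::euclidean_space \<Rightarrow> real"
  assumes f: "real_polynomial_function f" and 0: "ball_ip f f = 0"
  shows "f x = 0"
proof -
  have c: "continuous_on UNIV f" using f by (rule continuous_on_real_polynomial_function)
  have int: "integrable lborel (\<lambda>x. indicat_real (ball 0 1) x *\<^sub>R (f x * f x))"
    using set_integrable_ball[of "\<lambda>x. f x * f x" 0 1] c
    by (auto simp: set_integrable_def intro!: continuous_intros)
  have ae: "AE x in lborel. indicat_real (ball 0 1) x *\<^sub>R (f x * f x) = 0"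
    using 0 int by (subst integral_nonneg_eq_0_iff_AE[symmetric]) (auto simp: ball_ip_def set_lebesgue_integral_def)
  define N where "N = ball 0 1 \<inter> {x. f x \<noteq> 0}"
  have "open N" unfolding N_def
    using c by (intro open_Int open_Collect_neq) auto
  moreover have "negligible N"
  proof -
    have "N \<in> null_sets lborel"
      using ae \<open>open N\<close> unfolding N_def by (subst AE_iff_null_sets) (auto elim!: eventually_mono simp: indicator_def)
    then show ?thesis using negligible_iff_null_sets null_sets_completionI by blast
  qed
  ultimately have "N = {}" using open_not_negligible by blast
  then have ball: "f y = 0" if "norm y < 1" for y using that by (auto simp: N_def)
  have lin: "polynomial_function (\<lambda>s::real. s *\<^sub>R x)"
    by (intro polynomial_function_bounded_linear bounded_linear_intros)
  have "real_polynomial_function (f \<circ> (\<lambda>s::real. s *\<^sub>R x))"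
    using lin f by (rule real_polynomial_function_compose)
  then obtain a n where a: "\<And>s. f (s *\<^sub>R x) = (\<Sum>i\<le>n. a i * s ^ i)"
    unfolding real_polynomial_function_iff_sum by (auto simp: fun_eq_iff)
  have "{0<..<1 / (1 + norm x)} \<subseteq> {s. (\<Sum>i\<le>n. a i * s ^ i) = 0}"
  proof clarify
    fix s assume s: "s \<in> {0<..<1 / (1 + norm x)}"
    then have "s * (1 + norm x) < 1" by (simp add: field_simps add_pos_nonneg)
    then have "norm (s *\<^sub>R x) < 1" using s by (simp add: algebra_simps)
    then show "(\<Sum>i\<le>n. a i * s ^ i) = 0" using ball a by metis
  qed
  moreover have "infinite {0<..<1 / (1 + norm x)}"
    by (simp add: infinite_Ioo add_pos_nonneg)
  ultimately have "infinite {s. (\<Sum>i\<le>n. a i * s ^ i) = 0}" using finite_subset by blast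
  then have "\<forall>i\<le>n. a i = 0" using polyfun_finite_roots by blast
  then have "f (1 *\<^sub>R x) = 0" unfolding a by simp
  then show ?thesis by simp
qed

lemma ball_ip_nonneg: "ball_ip f f \<ge> 0"
  unfolding ball_ip_def set_lebesgue_integral_def by (intro integral_nonneg_AE) auto

definition ball_expands :: "('a::euclidean_space \<Rightarrow> real) set \<Rightarrow> ('a \<Rightarrow> real) \<Rightarrow> bool" where
  "ball_expands E f \<longleftrightarrow> (\<forall>x. f x = (\<Sum>e\<in>E. ball_ip f e * e x))"

definition ball_orthonormal :: "('a::euclidean_space \<Rightarrow> real) set \<Rightarrow> bool" where
  "ball_orthonormal E \<longleftrightarrow> finite E \<and> (\<forall>e\<in>E. real_polynomial_function e) \<and>
    (\<forall>e\<in>E. \<forall>e'\<in>E. ball_ip e e' = (if e = e' then 1 else 0))"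

lemma ball_orthonormalD:
  assumes "ball_orthonormal E"
  shows "finite E" "\<And>e. e \<in> E \<Longrightarrow> real_polynomial_function e"
    "\<And>e e'. e \<in> E \<Longrightarrow> e' \<in> E \<Longrightarrow> ball_ip e e' = (if e = e' then 1 else 0)"
  using assms unfolding ball_orthonormal_def by blast+

text \<open>Gram-Schmidt, with one function added at a time. The functions may be linearly
  dependent: a remainder of norm 0 vanishes identically by \<open>ball_ip_definite\<close>, and then
  the old system already expands the new function.\<close>

lemma ball_orthonormalization:
  fixes S :: "('a::euclidean_space \<Rightarrow> real) set"
  assumes "finite S" "\<And>f. f \<in> S \<Longrightarrow> real_polynomial_function f"
  shows "\<exists>E. ball_orthonormal E \<and> (\<forall>f\<in>S. ball_expands E f)"
  using assms
proof (induction S rule: finite_induct)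
  case empty
  show ?case by (intro exI[of _ "{}"]) (auto simp: ball_orthonormal_def)
next
  case (insert \<phi> S)
  then obtain E where E0: "ball_orthonormal E \<and> (\<forall>f\<in>S. ball_expands E f)"
    using insert.IH insert.prems by auto
  then have "ball_orthonormal E" by blast
  note E = ball_orthonormalD[OF this]
  from E0 have exp_S: "ball_expands E f" if "f \<in> S" for f
    using that by blast
  have \<phi>: "real_polynomial_function \<phi>" using insert by simp
  define \<psi> where "\<psi> x = \<phi> x - (\<Sum>e\<in>E. ball_ip \<phi> e * e x)" for x
  have \<psi>: "real_polynomial_function \<psi>"
    unfolding \<psi>_def using \<phi> E by (auto intro!: real_polynomial_function_diff real_polynomial_function_sum)
  have ip\<psi>: "ball_ip \<psi> g = ball_ip \<phi> g - (\<Sum>e\<in>E. ball_ip \<phi> e * ball_ip e g)" if "real_polynomial_function g" for g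
  proof -
    \<comment> \<open>The difference is written as a sum over two indices with coefficients 1 and
      -1, so that \<open>ball_ip_sum_left\<close> covers it.\<close>
    have "ball_ip (\<lambda>x. \<Sum>i\<in>{True, False}. (if i then 1 else -1) * (if i then \<phi> else (\<lambda>x. \<Sum>e\<in>E. ball_ip \<phi> e * e x)) x) g
      = (\<Sum>i\<in>{True, False}. (if i then 1 else -1) * ball_ip (if i then \<phi> else (\<lambda>x. \<Sum>e\<in>E. ball_ip \<phi> e * e x)) g)"
      using that \<phi> E by (intro ball_ip_sum_left) (auto intro!: real_polynomial_function_sum)
    then show ?thesis using that E by (simp add: \<psi>_def[abs_def] ball_ip_sum_left)
  qed
  have orth: "ball_ip \<psi> e = 0" if e: "e \<in> E" for e
  proof -
    have "(\<Sum>e'\<in>E. ball_ip \<phi> e' * ball_ip e' e) = (\<Sum>e'\<in>E. if e' = e then ball_ip \<phi> e' else 0)"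
      using e E by (intro sum.cong) auto
    then show ?thesis using ip\<psi>[OF E(2)[OF e]] e E(1) by simp
  qed
  show ?case
  proof (cases "ball_ip \<psi> \<psi> = 0")
    case True
    then have "\<psi> x = 0" for x using ball_ip_definite[OF \<psi>] by simp
    then have "ball_expands E \<phi>" by (simp add: \<psi>_def ball_expands_def)
    then have "\<forall>f\<in>insert \<phi> S. ball_expands E f" using exp_S by blast
    then show ?thesis using E0 by blast
  next
    case False
    define N where "N = sqrt (ball_ip \<psi> \<psi>)"
    have N: "N > 0" "N * N = ball_ip \<psi> \<psi>" using False ball_ip_nonneg[of \<psi>] by (auto simp: N_def)
    define e0 where "e0 x = \<psi> x / N" for x
    have e0: "real_polynomial_function e0" unfolding e0_def using \<psi> by (rule real_polynomial_function_divide)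
    have ip_e0: "ball_ip e0 g = ball_ip \<psi> g / N" "ball_ip g e0 = ball_ip g \<psi> / N" for g
      by (simp_all add: ball_ip_def e0_def)
    have e0E: "ball_ip e0 e = 0" "ball_ip e e0 = 0" if "e \<in> E" for e
      using orth[OF that] by (simp_all add: ip_e0 ball_ip_commute[of e])
    have e00: "ball_ip e0 e0 = 1" using N by (simp add: ip_e0 N(2)[symmetric])
    have notin: "e0 \<notin> E" using e0E e00 by force
    have \<phi>e0: "ball_ip \<phi> e0 = N"
    proof -
      have "ball_ip \<psi> e0 = ball_ip \<phi> e0" using ip\<psi>[OF e0] e0E by simp
      moreover have "ball_ip \<psi> e0 = N" using N by (simp add: ip_e0 N(2)[symmetric])
      ultimately show ?thesis by simp
    qed
    \<comment> \<open>Functions already expanded in \<open>E\<close> are orthogonal to the new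
      member, so their expansions persist with a zero coefficient.\<close>
    have S: "ball_ip f e0 = 0" if "f \<in> S" for f
    proof -
      have "f = (\<lambda>x. \<Sum>e\<in>E. ball_ip f e * e x)" using exp_S[OF that] unfolding ball_expands_def by (intro ext) (erule spec)
      then have "ball_ip f e0 = ball_ip (\<lambda>x. \<Sum>e\<in>E. ball_ip f e * e x) e0" by simp
      also have "\<dots> = (\<Sum>e\<in>E. ball_ip f e * ball_ip e e0)"
        using E e0 by (intro ball_ip_sum_left) auto
      finally show ?thesis using e0E by simp
    qed
    have exp_\<phi>: "\<phi> x = N * e0 x + (\<Sum>e\<in>E. ball_ip \<phi> e * e x)" for x
      using N(1) by (simp add: e0_def \<psi>_def)
    have "\<forall>f\<in>insert \<phi> S. ball_expands (insert e0 E) f"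
      unfolding ball_expands_def
    proof (intro ballI allI)
      fix f x assume "f \<in> insert \<phi> S"
      then consider "f = \<phi>" | "f \<in> S" by blast
      then show "f x = (\<Sum>e\<in>insert e0 E. ball_ip f e * e x)"
      proof cases
        case 1
        show ?thesis unfolding 1 sum.insert[OF E(1) notin] \<phi>e0 by (rule exp_\<phi>)
      next
        case 2
        show ?thesis unfolding sum.insert[OF E(1) notin] S[OF 2] using exp_S[OF 2, unfolded ball_expands_def, THEN spec, of x] by simp
      qed
    qed
    moreover have "ball_orthonormal (insert e0 E)"
      using E e0 e0E e00 notin by (auto simp: ball_orthonormal_def)
    ultimately show ?thesis by blast
  qed
qed

text \<open>Expanding in an orthonormal basis of the span bounds point evaluations without a
  compactness argument in the space of coefficients.\<close>

lemma polynomial_sup_le_ball_L2: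
  fixes \<phi> :: "'i \<Rightarrow> 'a::euclidean_space \<Rightarrow> real"
  assumes "finite I" "\<And>i. i \<in> I \<Longrightarrow> real_polynomial_function (\<phi> i)"
  obtains M where "M \<ge> 0" "\<And>c x. norm x \<le> R \<Longrightarrow>
     (\<Sum>i\<in>I. c i * \<phi> i x)\<^sup>2 \<le> M * (LINT y:ball 0 1|lborel. (\<Sum>i\<in>I. c i * \<phi> i y)\<^sup>2)"
proof -
  have "\<exists>E. ball_orthonormal E \<and> (\<forall>f\<in>\<phi> ` I. ball_expands E f)"
    by (rule ball_orthonormalization) (use assms in auto)
  then obtain E where E0: "ball_orthonormal E \<and> (\<forall>f\<in>\<phi> ` I. ball_expands E f)"
    by blast
  then have "ball_orthonormal E" by blast
  note E = ball_orthonormalD[OF this]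
  from E0 have exp_S: "ball_expands E f" if "f \<in> \<phi> ` I" for f
    using that by blast
  \<comment> \<open>This sum of squares is the diagonal of the reproducing kernel of the span; its
    bound over the ball of radius \<open>R\<close> is the required constant. For negative
    \<open>R\<close> that ball is empty and the bound carries no sign information, hence the
    absolute value below.\<close>
  have "continuous_on (cball 0 R) (\<lambda>x. \<Sum>e\<in>E. (e x)\<^sup>2)"
    by (intro continuous_intros continuous_on_real_polynomial_function E(2))
  then have "bounded ((\<lambda>x. \<Sum>e\<in>E. (e x)\<^sup>2) ` cball 0 R)"
    by (intro compact_imp_bounded compact_continuous_image) auto
  then obtain M where "\<forall>y\<in>(\<lambda>x. \<Sum>e\<in>E. (e x)\<^sup>2) ` cball 0 R. norm y \<le> M"
    unfolding bounded_iff by blast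
  then have M: "\<bar>\<Sum>e\<in>E. (e x)\<^sup>2\<bar> \<le> M" if "norm x \<le> R" for x
    using that by auto
  show thesis
  proof (rule that[of "\<bar>M\<bar>"])
    fix c and x :: 'a assume x: "norm x \<le> R"
    define p where "p = (\<lambda>y. \<Sum>i\<in>I. c i * \<phi> i y)"
    have p: "real_polynomial_function p" unfolding p_def using assms by (auto intro!: real_polynomial_function_sum)
    have exp: "p = (\<lambda>y. \<Sum>e\<in>E. ball_ip p e * e y)"
    proof
      fix y
      have "p y = (\<Sum>i\<in>I. \<Sum>e\<in>E. c i * ball_ip (\<phi> i) e * e y)"
        unfolding p_def by (intro sum.cong refl) (subst exp_S[unfolded ball_expands_def, THEN spec], simp_all add: sum_distrib_left mult_ac)
      also have "\<dots> = (\<Sum>e\<in>E. (\<Sum>i\<in>I. c i * ball_ip (\<phi> i) e) * e y)"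
        by (subst sum.swap) (simp add: sum_distrib_right)
      also have "\<dots> = (\<Sum>e\<in>E. ball_ip p e * e y)"
        using assms E by (intro sum.cong refl) (simp add: p_def ball_ip_sum_left)
      finally show "p y = (\<Sum>e\<in>E. ball_ip p e * e y)" .
    qed
    have "ball_ip p p = ball_ip (\<lambda>y. \<Sum>e\<in>E. ball_ip p e * e y) p" using exp by simp
    also have "\<dots> = (\<Sum>e\<in>E. (ball_ip p e)\<^sup>2)"
      using E p by (subst ball_ip_sum_left) (simp_all add: ball_ip_commute[of _ p] power2_eq_square)
    finally have ip: "ball_ip p p = (\<Sum>e\<in>E. (ball_ip p e)\<^sup>2)" .
    have "(p x)\<^sup>2 = (\<Sum>e\<in>E. ball_ip p e * e x)\<^sup>2" by (subst exp) simp
    also have "\<dots> \<le> (\<Sum>e\<in>E. (ball_ip p e)\<^sup>2) * (\<Sum>e\<in>E. (e x)\<^sup>2)"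
      by (rule Cauchy_Schwarz_ineq_sum)
    also have "\<dots> \<le> (\<Sum>e\<in>E. (ball_ip p e)\<^sup>2) * \<bar>M\<bar>"
      using M[OF x] by (intro mult_left_mono) (auto intro: sum_nonneg)
    also have "\<dots> = \<bar>M\<bar> * (LINT y:ball 0 1|lborel. (p y)\<^sup>2)"
      unfolding ip[symmetric] by (simp add: ball_ip_def power2_eq_square)
    finally show "(\<Sum>i\<in>I. c i * \<phi> i x)\<^sup>2 \<le> \<bar>M\<bar> * (LINT y:ball 0 1|lborel. (\<Sum>i\<in>I. c i * \<phi> i y)\<^sup>2)"
      by (simp add: p_def)
  qed simp
qed

section \<open>The polynomial spaces: closure properties, gradients and scaling\<close>

definition monomial :: "('d::finite \<Rightarrow> nat) \<Rightarrow> real^'d \<Rightarrow> real" where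
  "monomial \<alpha> x = (\<Prod>i\<in>UNIV. (x $ i) ^ \<alpha> i)"

abbreviation multi_indices :: "nat \<Rightarrow> ('d::finite \<Rightarrow> nat) set" where
  "multi_indices m \<equiv> {\<alpha>. (\<Sum>i\<in>UNIV. \<alpha> i) \<le> m}"

lemma polys_iff: "p \<in> polys m \<longleftrightarrow> (\<exists>c. p = (\<lambda>x. \<Sum>\<alpha>\<in>multi_indices m. c \<alpha> * monomial \<alpha> x))"
  by (simp add: polys_def monomial_def)

lemma finite_multi_indices: "finite {\<alpha> :: 'd::finite \<Rightarrow> nat. (\<Sum>i\<in>UNIV. \<alpha> i) \<le> m}"
proof (rule finite_subset)
  show "{\<alpha> :: 'd \<Rightarrow> nat. (\<Sum>i\<in>UNIV. \<alpha> i) \<le> m} \<subseteq> (\<Pi>\<^sub>E i\<in>UNIV. {..m})"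
  proof (intro subsetI PiE_I)
    fix \<alpha> :: "'d \<Rightarrow> nat" and x assume "\<alpha> \<in> multi_indices m"
    moreover have "\<alpha> x \<le> (\<Sum>i\<in>UNIV. \<alpha> i)" by (rule member_le_sum) auto
    ultimately show "\<alpha> x \<in> {..m}" by simp
  qed auto
  show "finite (\<Pi>\<^sub>E i\<in>(UNIV :: 'd set). {..m})" by (rule finite_PiE) auto
qed

lemma monomial_in_polys:
  assumes "(\<Sum>i\<in>UNIV. \<alpha> i) \<le> m"
  shows "monomial \<alpha> \<in> polys m"
proof -
  have "(\<Sum>\<beta>\<in>multi_indices m. (if \<beta> = \<alpha> then 1 else 0) * monomial \<beta> x) = monomial \<alpha> x" for x
  proof -
    have "(\<Sum>\<beta>\<in>multi_indices m. (if \<beta> = \<alpha> then 1 else 0) * monomial \<beta> x) =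
      (\<Sum>\<beta>\<in>multi_indices m. if \<beta> = \<alpha> then monomial \<beta> x else 0)"
      by (rule sum.cong) auto
    then show ?thesis using assms by (subst (asm) sum.delta[OF finite_multi_indices]) simp
  qed
  then show ?thesis unfolding polys_iff by (intro exI[of _ "\<lambda>\<beta>. if \<beta> = \<alpha> then 1 else 0"] ext) (rule sym)
qed

lemma polys_add:
  assumes "p \<in> polys m" "q \<in> polys m"
  shows "(\<lambda>x. p x + q x) \<in> polys m"
proof -
  obtain c d where "p = (\<lambda>x. \<Sum>\<alpha>\<in>multi_indices m. c \<alpha> * monomial \<alpha> x)"
    "q = (\<lambda>x. \<Sum>\<alpha>\<in>multi_indices m. d \<alpha> * monomial \<alpha> x)" using assms by (auto simp: polys_iff)
  then show ?thesis unfolding polys_iff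
    by (intro exI[of _ "\<lambda>\<alpha>. c \<alpha> + d \<alpha>"]) (simp add: distrib_right sum.distrib)
qed

lemma polys_cmult:
  assumes "p \<in> polys m"
  shows "(\<lambda>x. a * p x) \<in> polys m"
proof -
  obtain c where "p = (\<lambda>x. \<Sum>\<alpha>\<in>multi_indices m. c \<alpha> * monomial \<alpha> x)" using assms by (auto simp: polys_iff)
  then show ?thesis unfolding polys_iff
    by (intro exI[of _ "\<lambda>\<alpha>. a * c \<alpha>"]) (simp add: sum_distrib_left mult.assoc)
qed

lemma polys_const: "(\<lambda>x. a) \<in> polys m"
  using polys_cmult[OF monomial_in_polys[of "\<lambda>_. 0"], of m a] by (simp add: monomial_def)

lemma polys_sum:
  assumes "finite I" "\<And>i. i \<in> I \<Longrightarrow> p i \<in> polys m"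
  shows "(\<lambda>x. \<Sum>i\<in>I. p i x) \<in> polys m"
  using assms by (induction I rule: finite_induct) (auto intro: polys_add polys_const)

lemma polys_mono:
  assumes "m \<le> n" "p \<in> polys m"
  shows "p \<in> polys n"
proof -
  obtain c where p: "p = (\<lambda>x. \<Sum>\<alpha>\<in>multi_indices m. c \<alpha> * monomial \<alpha> x)" using assms by (auto simp: polys_iff)
  show ?thesis unfolding p using assms(1)
    by (intro polys_sum polys_cmult monomial_in_polys finite_multi_indices) auto
qed

lemma polys_mult:
  assumes "p \<in> polys m" "q \<in> polys n"
  shows "(\<lambda>x. p x * q x) \<in> polys (m + n)"
proof -
  obtain c d where pq: "p = (\<lambda>x. \<Sum>\<alpha>\<in>multi_indices m. c \<alpha> * monomial \<alpha> x)"
    "q = (\<lambda>x. \<Sum>\<beta>\<in>multi_indices n. d \<beta> * monomial \<beta> x)" using assms by (auto simp: polys_iff)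
  have mm: "monomial \<alpha> x * monomial \<beta> x = monomial (\<lambda>i. \<alpha> i + \<beta> i) x" for \<alpha> \<beta> x
    by (simp add: monomial_def power_add prod.distrib)
  have "(\<lambda>x. p x * q x) = (\<lambda>x. \<Sum>\<alpha>\<in>multi_indices m. \<Sum>\<beta>\<in>multi_indices n.
      (c \<alpha> * d \<beta>) * monomial (\<lambda>i. \<alpha> i + \<beta> i) x)"
    unfolding pq by (simp add: sum_product mm[symmetric] mult_ac)
  also have "\<dots> \<in> polys (m + n)"
    by (intro polys_sum polys_cmult monomial_in_polys finite_multi_indices) (auto simp: sum.distrib add_mono)
  finally show ?thesis .
qed

lemma polys_coord: "(\<lambda>x. x $ i) \<in> polys 1"
proof -
  have "(\<lambda>x::real^'a. x $ i) = monomial (\<lambda>j. if j = i then 1 else 0)"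
    by (auto simp: monomial_def fun_eq_iff if_distrib[of "\<lambda>k. _ ^ k"] cong: if_cong)
  then show ?thesis using monomial_in_polys[of "\<lambda>j. if j = i then 1 else 0" 1] by simp
qed

text \<open>The degree is an index of the predicate and adds up under products, so a property needs
  checking only on constants and coordinates. The monotonicity rule is required because the
  monomials of an element of \<open>polys m\<close> may have lower degree than
  \<open>m\<close>.\<close>

lemma polys_induct [consumes 1, case_names const coord add mult mono]:
  assumes p: "p \<in> polys m"
    and const: "\<And>a. P 0 (\<lambda>x. a)"
    and coord: "\<And>i. P 1 (\<lambda>x. x $ i)"
    and add: "\<And>m p q. P m p \<Longrightarrow> P m q \<Longrightarrow> P m (\<lambda>x. p x + q x)"
    and mult: "\<And>m n p q. P m p \<Longrightarrow> P n q \<Longrightarrow> P (m + n) (\<lambda>x. p x * q x)"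
    and mono: "\<And>m n p. P m p \<Longrightarrow> m \<le> n \<Longrightarrow> P n p"
  shows "P m p"
proof -
  have pow: "P k (\<lambda>x. (x $ i) ^ k)" for i k
  proof (induction k)
    case (Suc k)
    show ?case using mult[OF coord[of i] Suc] by simp
  qed (simp add: const)
  have mon: "P (\<Sum>i\<in>UNIV. \<alpha> i) (monomial \<alpha>)" for \<alpha>
  proof -
    have "P (\<Sum>i\<in>I. \<alpha> i) (\<lambda>x. \<Prod>i\<in>I. (x $ i) ^ \<alpha> i)" for I
    proof (induction I rule: infinite_finite_induct)
      case (insert i I)
      then show ?case using mult[OF pow[of "\<alpha> i" i] insert.IH] by simp
    qed (auto simp: const)
    then show ?thesis by (simp add: monomial_def[abs_def])
  qed
  obtain c where p: "p = (\<lambda>x. \<Sum>\<alpha>\<in>multi_indices m. c \<alpha> * monomial \<alpha> x)" using assms by (auto simp: polys_iff)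
  have "P m (\<lambda>x. \<Sum>\<alpha>\<in>A. c \<alpha> * monomial \<alpha> x)" if "finite A" "A \<subseteq> multi_indices m" for A
    using that
  proof (induction A rule: finite_induct)
    case empty
    show ?case using mono[OF const] by simp
  next
    case (insert \<alpha> A)
    have "P m (\<lambda>x. c \<alpha> * monomial \<alpha> x)"
      using mono[OF mult[OF const[of "c \<alpha>"] mon[of \<alpha>]], of m] insert by simp
    then have "P m (\<lambda>x. c \<alpha> * monomial \<alpha> x + (\<Sum>\<alpha>\<in>A. c \<alpha> * monomial \<alpha> x))"
      using insert by (intro add) auto
    then show ?case using insert by simp
  qed
  then show ?thesis unfolding p using finite_multi_indices by blast
qed

lemma polys_affine: "p \<in> polys m \<Longrightarrow> (\<lambda>x. p (c + r *\<^sub>R x)) \<in> polys m"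
proof (induction rule: polys_induct)
  case (coord i)
  show ?case using polys_add[OF polys_const polys_cmult[OF polys_coord]] by simp
qed (auto intro: polys_const polys_add polys_mult polys_mono)

lemma polys_real_polynomial_function: "p \<in> polys m \<Longrightarrow> real_polynomial_function p"
proof (induction rule: polys_induct)
  case (coord i)
  show ?case by (intro real_polynomial_function.intros(1) bounded_linear_vec_nth)
qed auto

text \<open>The degree bound is kept rather than lowered: it is enough that the components of the
  gradient stay in \<open>polys m\<close>, because then one trace inequality serves a function and
  its gradient alike.\<close>

lemma polys_gradient:
  fixes p :: "real^'d \<Rightarrow> real"
  assumes "p \<in> polys m"
  shows "\<exists>p'. (\<forall>i. (\<lambda>x. p' x $ i) \<in> polys m) \<and> (\<forall>x. (p has_derivative (\<lambda>v. p' x \<bullet> v)) (at x))"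
proof -
  \<comment> \<open>Membership is carried through the induction because the product rule multiplies
    each gradient by the other factor itself.\<close>
  have "p \<in> polys m \<and> (\<exists>p'. (\<forall>i. (\<lambda>x. p' x $ i) \<in> polys m) \<and> (\<forall>x. (p has_derivative (\<lambda>v. p' x \<bullet> v)) (at x)))"
    using assms
  proof (induction rule: polys_induct)
    case (const a)
    show ?case by (intro conjI polys_const exI[of _ "\<lambda>x. 0"]) (auto intro: polys_const)
  next
    case (coord i)
    have "((\<lambda>x. x $ i) has_derivative (\<lambda>v. axis i 1 \<bullet> v)) (at x)" for x :: "real^'d"
      using bounded_linear_imp_has_derivative[OF bounded_linear_vec_nth[of i]] by (simp add: inner_axis' )
    then show ?case by (intro conjI polys_coord exI[of _ "\<lambda>x. axis i 1"]) (auto intro: polys_const)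
  next
    case (add m p q)
    then obtain p' q' where "\<forall>i. (\<lambda>x. p' x $ i) \<in> polys m" "\<forall>x. (p has_derivative (\<lambda>v. p' x \<bullet> v)) (at x)"
      "\<forall>i. (\<lambda>x. q' x $ i) \<in> polys m" "\<forall>x. (q has_derivative (\<lambda>v. q' x \<bullet> v)) (at x)" by blast
    then show ?case using add
      by (intro conjI polys_add exI[of _ "\<lambda>x. p' x + q' x"]) (auto simp: inner_add_left intro!: polys_add has_derivative_add)
  next
    case (mult m n p q)
    then obtain p' q' where 1: "\<forall>i. (\<lambda>x. p' x $ i) \<in> polys m" "\<forall>x. (p has_derivative (\<lambda>v. p' x \<bullet> v)) (at x)"
      "\<forall>i. (\<lambda>x. q' x $ i) \<in> polys n" "\<forall>x. (q has_derivative (\<lambda>v. q' x \<bullet> v)) (at x)" by blast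
    have "((\<lambda>x. p x * q x) has_derivative (\<lambda>v. (p x *\<^sub>R q' x + q x *\<^sub>R p' x) \<bullet> v)) (at x)" for x
      using has_derivative_mult[of p _ x UNIV q, OF 1(2)[rule_format] 1(4)[rule_format]]
      by (simp add: inner_add_left mult_ac)
    moreover have "(\<lambda>x. (p x *\<^sub>R q' x + q x *\<^sub>R p' x) $ i) \<in> polys (m + n)" for i
    proof -
      have "(\<lambda>x. p x * q' x $ i) \<in> polys (m + n)" "(\<lambda>x. p' x $ i * q x) \<in> polys (m + n)"
        using mult 1 by (auto intro: polys_mult)
      from polys_add[OF this] show ?thesis by (simp add: mult_ac)
    qed
    ultimately show ?case using mult by (intro conjI polys_mult exI[of _ "\<lambda>x. p x *\<^sub>R q' x + q x *\<^sub>R p' x"]) auto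
  next
    case (mono m n p)
    then show ?case using polys_mono by blast
  qed
  then show ?thesis by blast
qed

lemma set_lebesgue_integral_ball_affine:
  fixes c :: "'a::euclidean_space" and f :: "'a \<Rightarrow> real"
  assumes r: "r > 0" and [measurable]: "f \<in> borel_measurable borel"
  shows "(LINT y:ball c r|lborel. f y) = r ^ DIM('a) * (LINT y:ball 0 1|lborel. f (c + r *\<^sub>R y))"
proof -
  have "c + r *\<^sub>R y \<in> ball c r \<longleftrightarrow> y \<in> ball 0 1" for y
    using r by (simp add: dist_norm)
  then have ind: "indicat_real (ball c r) (c + r *\<^sub>R y) = indicat_real (ball 0 1) y" for y
    by (simp add: indicator_def)
  have m: "(\<lambda>y. indicat_real (ball c r) y *\<^sub>R f y) \<in> borel_measurable borel"
    by (intro borel_measurable_scaleR borel_measurable_indicator assms) simp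
  have "(LINT y:ball c r|lborel. f y) = (\<integral>y. indicator (ball c r) y *\<^sub>R f y \<partial>density (distr lborel borel (\<lambda>x. c + r *\<^sub>R x)) (\<lambda>_. \<bar>r\<bar> ^ DIM('a)))"
    unfolding set_lebesgue_integral_def using r by (subst lborel_affine[of r c]) auto
  also have "\<dots> = r ^ DIM('a) * (LINT y:ball 0 1|lborel. f (c + r *\<^sub>R y))"
  proof (subst integral_density)
    show "(\<lambda>y. indicat_real (ball c r) y *\<^sub>R f y) \<in> borel_measurable (distr lborel borel (\<lambda>x. c + r *\<^sub>R x))"
      using m by simp
    show "(\<integral>y. \<bar>r\<bar> ^ DIM('a) *\<^sub>R indicat_real (ball c r) y *\<^sub>R f y \<partial>distr lborel borel (\<lambda>x. c + r *\<^sub>R x)) =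
      r ^ DIM('a) * (LINT y:ball 0 1|lborel. f (c + r *\<^sub>R y))"
      using r m by (subst integral_distr) (simp_all add: ind set_lebesgue_integral_def)
  qed (use r in auto)
  finally show ?thesis .
qed

text \<open>The map from \<open>y\<close> to \<open>c + r *\<^sub>R y\<close> preserves
  \<open>polys m\<close> and takes the unit ball to \<open>ball c r\<close>, so the unit-ball
  constant works for all balls; the power of \<open>r\<close> is the Jacobian.\<close>

lemma polys_sup_le_L2:
  obtains M where "M \<ge> 0" "\<And>p (c::real^'d) r x. p \<in> polys m \<Longrightarrow> r > 0 \<Longrightarrow> norm (x - c) \<le> R * r \<Longrightarrow>
    (p x)\<^sup>2 * r ^ CARD('d) \<le> M * (LINT y:ball c r|lborel. (p y)\<^sup>2)"
proof -
  have rp: "real_polynomial_function (monomial \<alpha>)" for \<alpha> :: "'d \<Rightarrow> nat"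
    using monomial_in_polys[OF order_refl] by (rule polys_real_polynomial_function)
  show thesis
  proof (rule polynomial_sup_le_ball_L2[where \<phi>=monomial and R=R, OF finite_multi_indices[of m] rp])
    fix M :: real assume M: "M \<ge> 0" "\<And>c x. norm x \<le> R \<Longrightarrow>
       (\<Sum>\<alpha>\<in>multi_indices m. c \<alpha> * monomial \<alpha> x)\<^sup>2 \<le>
        M * (LINT y:ball 0 1|lborel. (\<Sum>\<alpha>\<in>multi_indices m. c \<alpha> * monomial \<alpha> (y::real^'d))\<^sup>2)"
    show thesis
    proof (rule that[OF M(1)])
      fix p :: "real^'d \<Rightarrow> real" and c x :: "real^'d" and r :: real
      assume p: "p \<in> polys m" and r: "r > 0" and x: "norm (x - c) \<le> R * r"
      define q where "q = (\<lambda>y. p (c + r *\<^sub>R y))"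
      have "q \<in> polys m" unfolding q_def using p by (rule polys_affine)
      then obtain d where q: "q = (\<lambda>x. \<Sum>\<alpha>\<in>multi_indices m. d \<alpha> * monomial \<alpha> x)" by (auto simp: polys_iff)
      have [measurable]: "p \<in> borel_measurable borel"
        using p by (intro borel_measurable_continuous_onI continuous_on_real_polynomial_function polys_real_polynomial_function)
      have "norm ((1 / r) *\<^sub>R (x - c)) = norm (x - c) / r" using r by simp
      also have "\<dots> \<le> R" using x r by (simp add: divide_le_eq)
      finally have "norm ((1 / r) *\<^sub>R (x - c)) \<le> R" .
      from M(2)[OF this, of d] have "(q ((1 / r) *\<^sub>R (x - c)))\<^sup>2 \<le> M * (LINT y:ball 0 1|lborel. (q y)\<^sup>2)"
        unfolding q .
      also have "q ((1 / r) *\<^sub>R (x - c)) = p x" using r by (simp add: q_def)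
      finally have "(p x)\<^sup>2 * r ^ CARD('d) \<le> (M * (LINT y:ball 0 1|lborel. (q y)\<^sup>2)) * r ^ CARD('d)"
        using r by (intro mult_right_mono) auto
      also have "\<dots> = M * (LINT y:ball c r|lborel. (p y)\<^sup>2)"
        using r by (subst set_lebesgue_integral_ball_affine) (simp_all add: q_def mult_ac)
      finally show "(p x)\<^sup>2 * r ^ CARD('d) \<le> M * (LINT y:ball c r|lborel. (p y)\<^sup>2)" .
    qed
  qed
qed

section \<open>The discrete trace inequality\<close>

text \<open>Moving from the centre against the normal by any \<open>s < r\<close> stays in the
  interior, where heights over \<open>a\<close> are positive. So the centre has height at least
  \<open>r\<close>, while no interior point reaches the height of the facet.\<close>

lemma (in simplex_cell) ball_radius_le_height:
  assumes a: "a \<in> C" and ball: "ball c r \<subseteq> K" and r: "r > 0"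
  shows "r \<le> height a"
proof -
  let ?F = "opp a"
  let ?n = "outward_normal K ?F"
  have int: "ball c r \<subseteq> interior K" using ball by (simp add: interior_maximal)
  have n1: "norm ?n = 1" by (rule facet_normal(1)[OF a refl])
  have low: "s \<le> ?n \<bullet> (c - a)" if s: "0 < s" "s < r" for s
  proof -
    have "c - s *\<^sub>R ?n \<in> ball c r" using s n1 by (simp add: dist_norm)
    then have "0 < ?n \<bullet> (c - s *\<^sub>R ?n - a)" using interior_height_pos[OF a] int by blast
    then show ?thesis using n1 by (simp add: inner_diff_right norm_eq_1)
  qed
  have "r \<le> ?n \<bullet> (c - a)"
    by (rule dense_le_bounded[OF r]) (use low in auto)
  also have "\<dots> \<le> height a"
  proof -
    obtain u where u: "sum u C = 1" "(\<Sum>c\<in>C. u c *\<^sub>R c) = c" by (rule barycentric_exists)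
    have "c \<in> interior K" using int r by auto
    then have "0 < u a" using interior_K_iff[OF u] a by blast
    then have "0 < u a * height a" using height(1)[OF a refl] by simp
    then show ?thesis using height_barycentric[OF a u(1)] u(2) by (simp add: left_diff_distrib)
  qed
  finally show ?thesis .
qed

text \<open>This is the cone formula for \<open>f = 1\<close>: volume equals height times base area
  divided by the dimension.\<close>

lemma (in simplex_cell) facet_measure:
  assumes a: "a \<in> C" and F: "F = opp a"
  shows "height a * measure (face_lborel F) (rel_interior F) = real DIM('a) * measure lborel (interior K)"
proof -
  have "height a * (LINT y:rel_interior F|face_lborel F. 1) = (LINT x:interior K|lborel. real DIM('a) * 1 + 0 \<bullet> (x - a))"
    by (rule cone_integral[OF a F]) auto
  then show ?thesis by (simp add: set_lebesgue_integral_def rel_interior_borel mult.commute)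
qed

lemma (in simplex_cell) measure_interior_le:
  assumes "c \<in> K"
  shows "measure lborel (interior K) \<le> unit_ball_vol (real DIM('a)) * diameter K ^ DIM('a)"
proof -
  have "K \<subseteq> cball c (diameter K)"
    using diameter_bounded_bound[OF compact_imp_bounded[OF compact_K(1)] assms] by auto
  then have "interior K \<subseteq> cball c (diameter K)" using interior_subset by blast
  then have "measure lborel (interior K) \<le> measure lborel (cball c (diameter K))"
    by (intro measure_mono_fmeasurable) (use emeasure_compact_finite[OF compact_cball] in \<open>auto simp: fmeasurable_def\<close>)
  also have "\<dots> = unit_ball_vol (real DIM('a)) * diameter K ^ DIM('a)"
    using diameter_ge_0[OF compact_imp_bounded[OF compact_K(1)]] by (simp add: content_cball)
  finally show ?thesis .
qed

text \<open>The supremum of \<open>p\<^sup>2\<close> over \<open>K\<close> is controlled by its mean over an inscribed ball, and the cone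
  formula controls the area of \<open>F\<close>.\<close>

lemma discrete_trace_inequality:
  obtains M where "M \<ge> 0" "\<And>C K F c r p. simplex_cell C (K :: (real^'d) set) \<Longrightarrow> F facet_of K \<Longrightarrow>
    ball c r \<subseteq> K \<Longrightarrow> r > 0 \<Longrightarrow> diameter K \<le> \<kappa> * r \<Longrightarrow> p \<in> polys m \<Longrightarrow>
    diameter K * (LINT y:rel_interior F|face_lborel F. (p y)\<^sup>2) \<le> M * (LINT x:interior K|lborel. (p x)\<^sup>2)"
proof (rule polys_sup_le_L2[where m=m and R=\<kappa> and 'd='d])
  fix M :: real assume M: "M \<ge> 0" "\<And>p (c::real^'d) r x. p \<in> polys m \<Longrightarrow> r > 0 \<Longrightarrow> norm (x - c) \<le> \<kappa> * r \<Longrightarrow>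
    (p x)\<^sup>2 * r ^ CARD('d) \<le> M * (LINT y:ball c r|lborel. (p y)\<^sup>2)"
  define \<omega> where "\<omega> = unit_ball_vol (real CARD('d))"
  have \<omega>: "\<omega> \<ge> 0" by (simp add: \<omega>_def)
  show thesis
  \<comment> \<open>With \<open>d\<close> the dimension, \<open>h\<close> the diameter and
    \<open>I\<close> the integral of the square of \<open>p\<close> over the cell, the square of
    \<open>p\<close> is at most \<open>M * I / r ^ d\<close> on the cell, and the area of the facet
    is at most \<open>d * \<omega> * h ^ d / r\<close>. The extra factor \<open>h\<close> makes
    \<open>h ^ Suc d\<close>, which is traded for powers of
    \<open>\<bar>\<kappa>\<bar> * r\<close>.\<close>
  proof (rule that[of "M * (real CARD('d) * \<omega> * \<bar>\<kappa>\<bar> ^ Suc CARD('d))"])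
    show "0 \<le> M * (real CARD('d) * \<omega> * \<bar>\<kappa>\<bar> ^ Suc CARD('d))" using M \<omega> by simp
    fix C K F and c :: "real^'d" and r :: real and p :: "real^'d \<Rightarrow> real"
    assume "simplex_cell C (K :: (real^'d) set)" and facet: "F facet_of K" and ball: "ball c r \<subseteq> K" and r: "r > 0"
      and h: "diameter K \<le> \<kappa> * r" and p: "p \<in> polys m"
    interpret simplex_cell C K by fact
    obtain a where a: "a \<in> C" and F: "F = opp a" using facet facet_iff by auto
    define h where "h = diameter K"
    have h0: "h \<ge> 0" unfolding h_def using diameter_ge_0[OF compact_imp_bounded[OF compact_K(1)]] .
    have cK: "c \<in> K" using ball r by auto
    have cont: "continuous_on UNIV (\<lambda>x. (p x)\<^sup>2)"
      using p by (intro continuous_intros continuous_on_real_polynomial_function polys_real_polynomial_function)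
    define I where "I = (LINT x:interior K|lborel. (p x)\<^sup>2)"
    have I: "(LINT y:ball c r|lborel. (p y)\<^sup>2) \<le> I"
    proof -
      have "ball c r \<subseteq> interior K" using ball by (simp add: interior_maximal)
      then show ?thesis
        unfolding I_def set_lebesgue_integral_def
        using set_integrable_interior[OF cont] set_integrable_ball[OF cont]
        by (intro integral_mono) (auto simp: set_integrable_def indicator_def)
    qed
    have I0: "I \<ge> 0" unfolding I_def set_lebesgue_integral_def by (intro integral_nonneg_AE) auto
    have pt: "(p y)\<^sup>2 * r ^ CARD('d) \<le> M * I" if "y \<in> K" for y
    proof -
      have "norm (y - c) \<le> \<kappa> * r"
        using diameter_bounded_bound[OF compact_imp_bounded[OF compact_K(1)] that cK] h by (simp add: dist_norm)
      from M(2)[OF p r this] show ?thesis using mult_left_mono[OF I M(1)] by linarith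
    qed
    define A where "A = measure (face_lborel F) (rel_interior F)"
    have A0: "A \<ge> 0" by (simp add: A_def)
    have fin: "emeasure (face_lborel F) (rel_interior F) \<noteq> \<infinity>" using emeasure_rel_interior[OF a F] by simp
    have J: "(LINT y:rel_interior F|face_lborel F. (p y)\<^sup>2) * r ^ CARD('d) \<le> M * I * A"
    proof -
      have "(LINT y:rel_interior F|face_lborel F. (p y)\<^sup>2) * r ^ CARD('d) =
        (LINT y:rel_interior F|face_lborel F. (p y)\<^sup>2 * r ^ CARD('d))" by simp
      also have "\<dots> \<le> (LINT y:rel_interior F|face_lborel F. M * I)"
        using facet_subset[OF F] pt cont facet
        by (intro set_integral_mono set_integrable_facet continuous_on_mult continuous_on_const) auto
      also have "\<dots> = M * I * A"
        using fin by (simp add: A_def set_lebesgue_integral_def rel_interior_borel)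
      finally show ?thesis .
    qed
    have "r * A \<le> height a * A" using ball_radius_le_height[OF a ball r] A0 by (rule mult_right_mono)
    also have "\<dots> \<le> real CARD('d) * (\<omega> * h ^ CARD('d))"
      unfolding A_def facet_measure[OF a F] h_def \<omega>_def using measure_interior_le[OF cK] by simp
    finally have rA: "r * A \<le> real CARD('d) * (\<omega> * h ^ CARD('d))" .
    let ?J = "LINT y:rel_interior F|face_lborel F. (p y)\<^sup>2"
    \<comment> \<open>Both sides are multiplied by this power of \<open>r\<close> to avoid
      quotients; it is cancelled at the end.\<close>
    have "h * ?J * r ^ Suc CARD('d) = h * r * (?J * r ^ CARD('d))" by (simp add: mult_ac)
    also have "\<dots> \<le> h * r * (M * I * A)" using J h0 r by (intro mult_left_mono) auto
    also have "\<dots> = h * M * I * (r * A)" by (simp add: mult_ac)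
    also have "\<dots> \<le> h * M * I * (real CARD('d) * (\<omega> * h ^ CARD('d)))"
      using rA h0 M(1) I0 by (intro mult_left_mono) auto
    also have "\<dots> = M * I * real CARD('d) * \<omega> * h ^ Suc CARD('d)" by (simp add: mult_ac)
    also have "\<dots> \<le> M * I * real CARD('d) * \<omega> * (\<bar>\<kappa>\<bar> * r) ^ Suc CARD('d)"
    proof -
      have "h \<le> \<bar>\<kappa>\<bar> * r" using h r unfolding h_def by (smt (verit) mult_right_mono)
      then show ?thesis using h0 M(1) I0 \<omega> by (intro mult_left_mono power_mono) auto
    qed
    also have "\<dots> = (M * (real CARD('d) * \<omega> * \<bar>\<kappa>\<bar> ^ Suc CARD('d)) * I) * r ^ Suc CARD('d)"
      by (simp only: power_mult_distrib mult_ac)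
    finally show "diameter K * ?J \<le> M * (real CARD('d) * \<omega> * \<bar>\<kappa>\<bar> ^ Suc CARD('d)) * (LINT x:interior K|lborel. (p x)\<^sup>2)"
      unfolding h_def[symmetric] I_def[symmetric] using r by (subst (asm) mult_le_cancel_right) auto
  qed
qed

section \<open>Facets of a conforming mesh\<close>

text \<open>Near a relative interior point of \<open>F\<close> the coordinates of the vertices of
  \<open>F\<close> stay positive by continuity, and the coordinate of \<open>a\<close> is positive
  on the inner side of \<open>F\<close>.\<close>

lemma (in simplex_cell) half_ball_subset_interior:
  assumes a: "a \<in> C" and F: "F = opp a" and x: "x \<in> rel_interior F"
  shows "\<exists>e>0. \<forall>z\<in>ball x e. outward_normal K F \<bullet> (z - x) < 0 \<longrightarrow> z \<in> interior K"
proof -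
  let ?n = "\<lambda>c. nrm c"
  obtain w' where w': "sum w' C = 1" "(\<Sum>c\<in>C. w' c *\<^sub>R c) = x" by (rule barycentric_exists)
  have w: "w' a = 0" "\<forall>c\<in>C - {a}. 0 < w' c" using rel_interior_opp_iff[OF a w'] x F by auto
  have hx: "?n c \<bullet> (x - c) = (1 - w' c) * height c" if "c \<in> C" for c
    using height_barycentric[OF that w'(1)] w'(2) by simp
  define V where "V = (\<Inter>c\<in>C - {a}. {z. ?n c \<bullet> (z - c) < height c})"
  have "open V" unfolding V_def using finite_C
    by (intro open_INT) (auto intro!: open_Collect_less continuous_intros)
  moreover have "x \<in> V"
    using hx w(2) height(1) by (auto simp: V_def left_diff_distrib)
  ultimately obtain e where e: "e > 0" "ball x e \<subseteq> V" by (meson open_contains_ball)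
  have "z \<in> interior K" if z: "z \<in> ball x e" "outward_normal K F \<bullet> (z - x) < 0" for z
  proof -
    obtain u where u: "sum u C = 1" "(\<Sum>c\<in>C. u c *\<^sub>R c) = z" by (rule barycentric_exists)
    have hz: "?n c \<bullet> (z - c) = (1 - u c) * height c" if "c \<in> C" for c
      using height_barycentric[OF that u(1)] u(2) by simp
    have "0 < u c" if c: "c \<in> C" for c
    proof (cases "c = a")
      case True
      have "?n a \<bullet> (z - a) < ?n a \<bullet> (x - a)" using z(2) F by (simp add: inner_diff_right)
      then have "(1 - u a) * height a < height a" using hz[OF a] hx[OF a] w(1) by simp
      then show ?thesis using height(1)[OF a refl] True by simp
    next
      case False
      then have "?n c \<bullet> (z - c) < height c" using e(2) z(1) c by (auto simp: V_def)
      then have "(1 - u c) * height c < height c" using hz[OF c] by simp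
      then show ?thesis using height(1)[OF c refl] by simp
    qed
    then show ?thesis using interior_K_iff[OF u] by blast
  qed
  then show ?thesis using e(1) by blast
qed

lemma conforming_mesh_simplex_cell:
  fixes K :: "'a::euclidean_space set"
  assumes "conforming_mesh \<Omega> \<T>" "K \<in> \<T>"
  obtains C where "simplex_cell C K"
proof -
  have "int DIM('a) simplex K" using assms by (auto simp: conforming_mesh_def)
  then obtain C where "\<not> affine_dependent C" "int (card C) = int DIM('a) + 1" "K = convex hull C"
    by (auto simp: simplex)
  then have "simplex_cell C K" by unfold_locales auto
  then show thesis by (rule that)
qed

locale mesh =
  fixes \<Omega> :: "'a::euclidean_space set" and \<T> :: "'a set set"
  assumes mesh: "conforming_mesh \<Omega> \<T>"
begin

lemma finite_cells: "finite \<T>"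
  using mesh by (auto simp: conforming_mesh_def triangulation_def)

lemma cell_simplex:
  assumes "K \<in> \<T>" obtains C where "simplex_cell C K"
  using conforming_mesh_simplex_cell[OF mesh assms] .

lemma finite_facets:
  assumes "K \<in> \<T>" shows "finite {F. F facet_of K}"
proof -
  obtain C where "simplex_cell C K" using cell_simplex[OF assms] .
  then show ?thesis by (rule simplex_cell.finite_facets)
qed

text \<open>The common face contains a relative interior point of \<open>K\<close>, so it is all of
  \<open>K\<close>; by symmetry it is also all of \<open>L\<close>.\<close>

lemma interiors_disjoint:
  assumes "K \<in> \<T>" "L \<in> \<T>" "z \<in> interior K" "z \<in> interior L"
  shows "K = L"
proof -
  have sub: "K \<subseteq> L" if "K \<in> \<T>" "L \<in> \<T>" "z \<in> interior K" "z \<in> interior L" for K L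
  proof -
    have "(K \<inter> L) face_of K" using mesh that by (auto simp: conforming_mesh_def triangulation_def)
    moreover have "z \<in> rel_interior K" using that(3) by (metis empty_iff interior_rel_interior_gen rel_interior_subset)
    moreover have "z \<in> K \<inter> L" using that interior_subset by blast
    ultimately have "K \<inter> L \<inter> rel_interior K \<noteq> {}" "(K \<inter> L) face_of K" by blast+
    then have "K \<subseteq> K \<inter> L" using subset_of_face_of[OF _ order_refl] by blast
    then show ?thesis by blast
  qed
  show ?thesis by (rule equalityI) (rule sub[OF assms], rule sub[OF assms(2,1,4,3)])
qed

text \<open>Both normals are unit vectors constant on \<open>F\<close>, so they agree up to sign.
  Equal normals would place a half ball at a point of \<open>F\<close> inside both cells, against
  the disjointness of their interiors.\<close>

lemma opposite_normals:
  assumes K: "K \<in> \<T>" "F facet_of K" and L: "L \<in> \<T>" "F facet_of L"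
    and ne: "K \<noteq> L"
  shows "outward_normal L F = - outward_normal K F"
proof -
  obtain C where "simplex_cell C K" using cell_simplex[OF K(1)] .
  then interpret K: simplex_cell C K .
  obtain D where "simplex_cell D L" using cell_simplex[OF L(1)] .
  then interpret L: simplex_cell D L .
  let ?n = "outward_normal K F" and ?m = "outward_normal L F"
  obtain a where a: "a \<in> C" "F = convex hull (C - {a})" using K.facet_iff K(2) by blast
  obtain b where b: "b \<in> D" "F = convex hull (D - {b})" using L.facet_iff L(2) by blast
  have FL: "F \<subseteq> L" using b(2) L.facet_subset(2) by blast
  have const: "?m \<bullet> x = ?m \<bullet> y" if "x \<in> F" "y \<in> F" for x y
    using L.facet_normal(5)[OF b] that FL by (meson antisym subsetD)
  have "?m = ?n \<or> ?m = - ?n"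
    using K.facet_normal(6)[OF a L.facet_normal(1)[OF b]] const by blast
  moreover have "?m \<noteq> ?n"
  proof
    assume eq: "?m = ?n"
    have "convex F" "F \<noteq> {}" using a(2) K.ne_C[of a] by auto
    then obtain x where x: "x \<in> rel_interior F" using rel_interior_eq_empty by blast
    obtain e1 where e1: "e1 > 0" "\<forall>z\<in>ball x e1. ?n \<bullet> (z - x) < 0 \<longrightarrow> z \<in> interior K"
      using K.half_ball_subset_interior[OF a x] by blast
    obtain e2 where e2: "e2 > 0" "\<forall>z\<in>ball x e2. ?n \<bullet> (z - x) < 0 \<longrightarrow> z \<in> interior L"
      using L.half_ball_subset_interior[OF b x] eq by auto
    define s where "s = min e1 e2 / 2"
    have s: "s > 0" "s < e1" "s < e2" using e1(1) e2(1) by (auto simp: s_def)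
    have n1: "norm ?n = 1" using K.facet_normal(1)[OF a] .
    then have nn: "?n \<bullet> ?n = 1" by (simp add: norm_eq_1)
    have "?n \<bullet> ((x - s *\<^sub>R ?n) - x) < 0" using s nn by simp
    moreover have "x - s *\<^sub>R ?n \<in> ball x e1" "x - s *\<^sub>R ?n \<in> ball x e2" using s n1 by (auto simp: dist_norm)
    ultimately have "x - s *\<^sub>R ?n \<in> interior K" "x - s *\<^sub>R ?n \<in> interior L" using e1(2) e2(2) by blast+
    then show False using interiors_disjoint[OF K(1) L(1)] ne by blast
  qed
  ultimately show ?thesis by blast
qed

text \<open>A second cell containing \<open>x\<close> would meet \<open>K\<close> in a face that
  contains \<open>F\<close> and is proper, hence equals \<open>F\<close> by dimension, so
  \<open>F\<close> would be shared. If moreover \<open>x\<close> were in the open domain, a small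
  ball around it would be covered by \<open>K\<close> alone, although \<open>K\<close> lies on one
  side of \<open>F\<close>.\<close>

lemma boundary_facet:
  assumes dom: "open \<Omega>" "interior (closure \<Omega>) = \<Omega>"
    and K: "K \<in> \<T>" "F facet_of K"
    and only: "\<And>L. L \<in> \<T> \<Longrightarrow> F facet_of L \<Longrightarrow> L = K" and x: "x \<in> rel_interior F"
  shows "x \<in> frontier \<Omega>"
proof -
  obtain C where "simplex_cell C K" using cell_simplex[OF K(1)] .
  then interpret K: simplex_cell C K .
  obtain a where a: "a \<in> C" "F = convex hull (C - {a})" using K.facet_iff K(2) by blast
  let ?n = "outward_normal K F"
  have un: "\<Union>\<T> = closure \<Omega>" and fin: "finite \<T>"
    using mesh by (auto simp: conforming_mesh_def triangulation_def)
  have xF: "x \<in> F" using x rel_interior_subset by blast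
  have FK: "F \<subseteq> K" using K.facet_subset[OF a(2)] by blast
  have dimK: "aff_dim K = int DIM('a)"
    using K.affine_hull_C K.K_eq aff_dim_affine_hull[of K] by (simp add: affine_hull_convex_hull)
  have notin: "x \<notin> L" if L: "L \<in> \<T>" "L \<noteq> K" for L
  proof
    assume xL: "x \<in> L"
    have face: "(K \<inter> L) face_of K" "(L \<inter> K) face_of L"
      using mesh K L by (auto simp: conforming_mesh_def triangulation_def)
    have sub: "F \<subseteq> K \<inter> L"
      by (rule subset_of_face_of[OF face(1) FK]) (use x xF FK xL in blast)
    have neK: "K \<inter> L \<noteq> K"
    proof
      assume "K \<inter> L = K"
      then have "interior K \<subseteq> interior L" by (intro interior_mono) blast
      then show False using K.interior_nonempty interiors_disjoint[OF K(1) L(1)] L(2) by blast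
    qed
    have conv: "convex (K \<inter> L)" using face(1) face_of_imp_convex by blast
    have lt: "aff_dim (K \<inter> L) < aff_dim K" using face_of_aff_dim_lt[OF K.compact_K(2) face(1) neK] .
    have dimF: "aff_dim F = aff_dim K - 1" using K(2) by (simp add: facet_of_def)
    have "F face_of (K \<inter> L)" using K(2) sub by (auto simp: facet_of_def intro: face_of_subset)
    moreover have "\<not> aff_dim F < aff_dim (K \<inter> L)" using lt dimF by linarith
    ultimately have FKL: "F = K \<inter> L" using face_of_aff_dim_lt[OF conv] by blast
    obtain D where "simplex_cell D L" using cell_simplex[OF L(1)] .
    then interpret L: simplex_cell D L .
    have "aff_dim L = int DIM('a)"
      using L.affine_hull_C L.K_eq aff_dim_affine_hull[of L] by (simp add: affine_hull_convex_hull)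
    then have "F facet_of L" using FKL face(2) dimF dimK xF by (auto simp: facet_of_def Int_commute)
    then show False using only L by blast
  qed
  have "x \<notin> \<Omega>"
  proof
    assume "x \<in> \<Omega>"
    then have "x \<in> \<Omega> - \<Union>(\<T> - {K})" using notin by blast
    moreover have "closed (\<Union>(\<T> - {K}))"
    proof (rule closed_Union)
      show "finite (\<T> - {K})" using fin by simp
      show "\<forall>L\<in>\<T> - {K}. closed L"
      proof
        fix L assume "L \<in> \<T> - {K}"
        then obtain D where "simplex_cell D L" using cell_simplex by blast
        then interpret L: simplex_cell D L .
        show "closed L" using L.compact_K(1) by (rule compact_imp_closed)
      qed
    qed
    ultimately obtain e where e: "e > 0" "ball x e \<subseteq> \<Omega> - \<Union>(\<T> - {K})"
      using open_contains_ball dom(1) by (metis open_Diff)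
    then have sub: "ball x e \<subseteq> K" using un closure_subset[of \<Omega>] by blast
    have n1: "norm ?n = 1" using K.facet_normal(1)[OF a] .
    then have nn: "?n \<bullet> ?n = 1" by (simp add: norm_eq_1)
    have "x + (e / 2) *\<^sub>R ?n \<in> K" using sub e(1) n1 by (auto simp: dist_norm)
    then have "?n \<bullet> (x + (e / 2) *\<^sub>R ?n) \<le> ?n \<bullet> x" using K.facet_normal(5)[OF a _ xF] by blast
    then show False using e(1) nn by (simp add: inner_add_right)
  qed
  moreover have "x \<in> closure \<Omega>" using un K(1) FK xF by blast
  ultimately show ?thesis using dom(1) by (simp add: frontier_def interior_open)
qed

text \<open>Either exactly two cells share \<open>F\<close>, with opposite normals, or \<open>F\<close> lies on the boundary, where
  \<open>v\<close> vanishes.\<close>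

lemma sum_normal_flux_facet:
  fixes q :: "'a \<Rightarrow> real"
  assumes dom: "open \<Omega>" "interior (closure \<Omega>) = \<Omega>"
    and v: "\<And>x. x \<in> frontier \<Omega> \<Longrightarrow> v x = 0"
  shows "(\<Sum>K | K \<in> \<T> \<and> F facet_of K. LINT x:rel_interior F|face_lborel F. q x * (v x \<bullet> outward_normal K F)) = 0"
proof (cases "\<exists>K L. K \<in> \<T> \<and> F facet_of K \<and> L \<in> \<T> \<and> F facet_of L \<and> K \<noteq> L")
  case True
  then obtain K L where KL: "K \<in> \<T>" "F facet_of K" "L \<in> \<T>" "F facet_of L" "K \<noteq> L" by blast
  have L: "outward_normal M F = - outward_normal K F" if "M \<in> \<T>" "F facet_of M" "M \<noteq> K" for M
    using opposite_normals[OF KL(1,2) that(1,2)] that(3) by blast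
  \<comment> \<open>Three cells at one facet would have pairwise opposite normals, which is
    impossible for unit vectors.\<close>
  have "M = L" if "M \<in> \<T>" "F facet_of M" "M \<noteq> K" for M
  proof (rule ccontr)
    assume "M \<noteq> L"
    then have "outward_normal M F = - outward_normal L F"
      using opposite_normals[OF KL(3,4) that(1,2)] by blast
    then have "outward_normal L F = - outward_normal L F" using L[OF that] L[OF KL(3,4)] KL(5) by simp
    then have "outward_normal L F \<bullet> outward_normal L F = - (outward_normal L F \<bullet> outward_normal L F)"
      by (metis inner_minus_right)
    moreover obtain D where "simplex_cell D L" using cell_simplex[OF KL(3)] .
    then interpret L: simplex_cell D L .
    obtain b where b: "b \<in> D" "F = convex hull (D - {b})" using L.facet_iff KL(4) by blast
    have "outward_normal L F \<bullet> outward_normal L F = 1" using L.facet_normal(1)[OF b] by (simp add: norm_eq_1)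
    ultimately show False by simp
  qed
  then have "{K. K \<in> \<T> \<and> F facet_of K} = {K, L}" using KL by blast
  then show ?thesis using KL(5) L[OF KL(3,4)] by (simp add: set_lebesgue_integral_def)
next
  case False
  have "(LINT x:rel_interior F|face_lborel F. q x * (v x \<bullet> outward_normal K F)) = 0"
    if K: "K \<in> \<T>" "F facet_of K" for K
  proof -
    have "v x = 0" if "x \<in> rel_interior F" for x
      using v boundary_facet[OF dom K _ that] False K by blast
    then have "indicat_real (rel_interior F) x *\<^sub>R (q x * (v x \<bullet> outward_normal K F)) = 0" for x
      by (simp add: indicator_def)
    then show ?thesis by (simp only: set_lebesgue_integral_def integral_zero)
  qed
  then show ?thesis by simp
qed

end

section \<open>Inner products on cells and cell boundaries\<close>

text \<open>The discriminant of a nonnegative quadratic polynomial in \<open>t\<close>; in the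
  degenerate case \<open>c = 0\<close> the linear coefficient has to vanish. It gives Cauchy-Schwarz
  for a sum of integrals directly, without forming quotient spaces.\<close>

lemma quadratic_nonneg_imp:
  fixes a b c :: real
  assumes "\<And>t. 0 \<le> a + 2 * t * b + t\<^sup>2 * c" "c \<ge> 0"
  shows "\<bar>b\<bar> \<le> sqrt a * sqrt c"
proof -
  have a: "a \<ge> 0" using assms(1)[of 0] by simp
  have "b\<^sup>2 \<le> a * c"
  proof (cases "c = 0")
    case True
    have "b = 0"
    proof (rule ccontr)
      assume "b \<noteq> 0"
      \<comment> \<open>At this \<open>t\<close> the affine function would take the value
        -1.\<close>
      then have "a + 2 * (- (a + 1) / (2 * b)) * b = - 1" by (simp add: field_simps)
      then show False using assms(1)[of "- (a + 1) / (2 * b)"] True by simp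
    qed
    then show ?thesis using True by simp
  next
    case False
    then have c: "c > 0" using assms(2) by simp
    have "a + 2 * (- b / c) * b + (- b / c)\<^sup>2 * c = a - b\<^sup>2 / c"
      using c by (simp add: field_simps power2_eq_square)
    then have "0 \<le> a - b\<^sup>2 / c" using assms(1)[of "- b / c"] by simp
    then show ?thesis using c by (simp add: field_simps)
  qed
  then have "sqrt (b\<^sup>2) \<le> sqrt (a * c)" by (rule real_sqrt_le_mono)
  then show ?thesis by (simp add: real_sqrt_mult)
qed

text \<open>The quadratic polynomial is the sum of the integrals of the squared norm of
  \<open>f + t g\<close>. Measures and domains depend on the index, so cells and pairs of a cell
  with a facet are handled by the same statement.\<close>

lemma sum_integral_Cauchy_Schwarz:
  fixes f g :: "'i \<Rightarrow> 'a \<Rightarrow> 'b::real_inner"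
  assumes int: "\<And>i. i \<in> I \<Longrightarrow> set_integrable (M i) (A i) (\<lambda>x. f i x \<bullet> f i x)"
    "\<And>i. i \<in> I \<Longrightarrow> set_integrable (M i) (A i) (\<lambda>x. f i x \<bullet> g i x)"
    "\<And>i. i \<in> I \<Longrightarrow> set_integrable (M i) (A i) (\<lambda>x. g i x \<bullet> g i x)"
  shows "\<bar>\<Sum>i\<in>I. (LINT x:A i|M i. f i x \<bullet> g i x)\<bar> \<le>
    sqrt (\<Sum>i\<in>I. (LINT x:A i|M i. f i x \<bullet> f i x)) * sqrt (\<Sum>i\<in>I. (LINT x:A i|M i. g i x \<bullet> g i x))"
proof (rule quadratic_nonneg_imp)
  let ?ip = "\<lambda>f g i. LINT x:A i|M i. f i x \<bullet> g i x"
  show "0 \<le> (\<Sum>i\<in>I. ?ip g g i)"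
    unfolding set_lebesgue_integral_def by (intro sum_nonneg integral_nonneg_AE) auto
  fix t :: real
  have eq: "?ip f f i + 2 * t * ?ip f g i + t\<^sup>2 * ?ip g g i
    = (LINT x:A i|M i. (f i x + t *\<^sub>R g i x) \<bullet> (f i x + t *\<^sub>R g i x))" if i: "i \<in> I" for i
  proof -
    have "(LINT x:A i|M i. (f i x + t *\<^sub>R g i x) \<bullet> (f i x + t *\<^sub>R g i x)) =
      (LINT x:A i|M i. f i x \<bullet> f i x + (2 * t * (f i x \<bullet> g i x) + t\<^sup>2 * (g i x \<bullet> g i x)))"
      by (intro arg_cong[where f="set_lebesgue_integral (M i) (A i)"] ext)
        (simp add: inner_simps inner_commute power2_eq_square algebra_simps)
    also have "\<dots> = ?ip f f i + (2 * t * ?ip f g i + t\<^sup>2 * ?ip g g i)"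
      using int[OF i] by (simp add: set_integral_add)
    finally show ?thesis by simp
  qed
  have "0 \<le> (\<Sum>i\<in>I. (LINT x:A i|M i. (f i x + t *\<^sub>R g i x) \<bullet> (f i x + t *\<^sub>R g i x)))"
    unfolding set_lebesgue_integral_def by (intro sum_nonneg integral_nonneg_AE) auto
  also have "\<dots> = (\<Sum>i\<in>I. ?ip f f i + 2 * t * ?ip f g i + t\<^sup>2 * ?ip g g i)"
    using eq by simp
  finally show "0 \<le> (\<Sum>i\<in>I. ?ip f f i) + 2 * t * (\<Sum>i\<in>I. ?ip f g i)
     + t\<^sup>2 * (\<Sum>i\<in>I. ?ip g g i)"
    by (simp add: sum.distrib sum_distrib_left)
qed

text \<open>Members of the discrete spaces are arbitrary off the open cells and faces, so regularity
  can only mean agreement with a continuous function there. Together with compactness of the cells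
  this is what integrability rests on.\<close>

definition cell_cts :: "'a::euclidean_space set set \<Rightarrow> ('a \<Rightarrow> 'b::topological_space) \<Rightarrow> bool" where
  "cell_cts \<T> f \<longleftrightarrow> (\<forall>K\<in>\<T>. \<exists>P. continuous_on UNIV P \<and> (\<forall>x\<in>interior K. f x = P x))"

definition bdry_cts ::
  "'a::euclidean_space set set \<Rightarrow> ('a set \<Rightarrow> 'a set \<Rightarrow> 'a \<Rightarrow> 'b::topological_space) \<Rightarrow> bool" where
  "bdry_cts \<T> f \<longleftrightarrow>
    (\<forall>K\<in>\<T>. \<forall>F. F facet_of K \<longrightarrow> (\<exists>P. continuous_on UNIV P \<and> (\<forall>x\<in>rel_interior F. f K F x = P x)))"

lemma bdry_ctsE:
  assumes "bdry_cts \<T> f" "K \<in> \<T>" "F facet_of K"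
  obtains P where "continuous_on UNIV P" "\<And>x. x \<in> rel_interior F \<Longrightarrow> f K F x = P x"
  using assms unfolding bdry_cts_def by blast

lemma cell_ctsE:
  assumes "cell_cts \<T> f" "K \<in> \<T>"
  obtains P where "continuous_on UNIV P" "\<And>x. x \<in> interior K \<Longrightarrow> f x = P x"
  using assms unfolding cell_cts_def by blast

lemma bdry_cts_compose:
  assumes "bdry_cts \<T> f" "\<And>K F. continuous_on UNIV (\<phi> K F)"
  shows "bdry_cts \<T> (\<lambda>K F x. \<phi> K F (f K F x))"
  unfolding bdry_cts_def
proof (intro ballI allI impI)
  fix K F assume K: "K \<in> \<T>" "F facet_of K"
  from assms(1) K obtain P where P: "continuous_on UNIV P" "\<And>x. x \<in> rel_interior F \<Longrightarrow> f K F x = P x"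
    by (rule bdry_ctsE) blast
  then show "\<exists>P. continuous_on UNIV P \<and> (\<forall>x\<in>rel_interior F. \<phi> K F (f K F x) = P x)"
    by (intro exI[of _ "\<lambda>x. \<phi> K F (P x)"]) (auto intro: continuous_on_compose2[OF assms(2)])
qed

lemma bdry_cts_scaleR:
  fixes f :: "'a::euclidean_space set \<Rightarrow> 'a set \<Rightarrow> 'a \<Rightarrow> 'b::real_normed_vector"
  shows "bdry_cts \<T> f \<Longrightarrow> bdry_cts \<T> (\<lambda>K F x. c K *\<^sub>R f K F x)"
  by (rule bdry_cts_compose[where \<phi>="\<lambda>K F z. c K *\<^sub>R z"]) (auto intro: continuous_intros)

lemma bdry_cts_inner:
  fixes f :: "'a::euclidean_space set \<Rightarrow> 'a set \<Rightarrow> 'a \<Rightarrow> 'b::real_inner"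
  shows "bdry_cts \<T> f \<Longrightarrow> bdry_cts \<T> (\<lambda>K F x. f K F x \<bullet> n K F)"
  by (rule bdry_cts_compose[where \<phi>="\<lambda>K F z. z \<bullet> n K F"]) (auto intro: continuous_intros)

lemma bdry_cts_diff:
  fixes f g :: "'a::euclidean_space set \<Rightarrow> 'a set \<Rightarrow> 'a \<Rightarrow> 'b::real_normed_vector"
  assumes "bdry_cts \<T> f" "bdry_cts \<T> g"
  shows "bdry_cts \<T> (\<lambda>K F x. f K F x - g K F x)"
  unfolding bdry_cts_def
proof (intro ballI allI impI)
  fix K F assume K: "K \<in> \<T>" "F facet_of K"
  from assms(1) K obtain P where P: "continuous_on UNIV P" "\<And>x. x \<in> rel_interior F \<Longrightarrow> f K F x = P x"
    by (rule bdry_ctsE) blast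
  moreover from assms(2) K obtain Q where Q: "continuous_on UNIV Q" "\<And>x. x \<in> rel_interior F \<Longrightarrow> g K F x = Q x"
    by (rule bdry_ctsE) blast
  ultimately show "\<exists>P. continuous_on UNIV P \<and> (\<forall>x\<in>rel_interior F. f K F x - g K F x = P x)"
    by (intro exI[of _ "\<lambda>x. P x - Q x"]) (auto intro: continuous_intros)
qed

text \<open>Cell integrals are taken over \<open>lebesgue\<close>, whereas the cone formula lives on
  \<open>lborel\<close>. Off \<open>U\<close> the function \<open>f\<close> may be wild, so the
  passage is made with \<open>P\<close>, whose product with the indicator is Borel.\<close>

lemma set_integral_completion:
  fixes f P :: "'a::euclidean_space \<Rightarrow> real"
  assumes "open U" "continuous_on UNIV P" "\<And>x. x \<in> U \<Longrightarrow> f x = P x"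
  shows "(LINT x:U|lebesgue. f x) = (LINT x:U|lborel. P x)"
    "set_integrable lborel U P \<Longrightarrow> set_integrable lebesgue U f"
proof -
  have m: "(\<lambda>x. indicat_real U x *\<^sub>R P x) \<in> borel_measurable lborel"
  proof (intro borel_measurable_scaleR borel_measurable_indicator)
    show "U \<in> sets lborel" using assms(1) by simp
    show "P \<in> borel_measurable lborel" using borel_measurable_continuous_onI[OF assms(2)] by simp
  qed
  have eq: "indicat_real U x *\<^sub>R f x = indicat_real U x *\<^sub>R P x" for x
    using assms(3) by (simp add: indicator_def)
  show "(LINT x:U|lebesgue. f x) = (LINT x:U|lborel. P x)"
    unfolding set_lebesgue_integral_def eq by (rule integral_completion[OF m])
  show "set_integrable lborel U P \<Longrightarrow> set_integrable lebesgue U f"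
    unfolding set_integrable_def eq by (simp only: integrable_completion[OF m])
qed

abbreviation weighted ::
  "('a::euclidean_space set \<Rightarrow> 'a set \<Rightarrow> 'a \<Rightarrow> 'b::real_normed_vector) \<Rightarrow> 'a set \<Rightarrow> 'a set \<Rightarrow> 'a \<Rightarrow> 'b" where
  "weighted f \<equiv> \<lambda>K F x. (diameter K powr (1/2)) *\<^sub>R f K F x"

section \<open>Mesh inner products: Cauchy-Schwarz, weights, cancellation of fluxes\<close>

context mesh
begin

lemma norm_outward_normal:
  assumes "K \<in> \<T>" "F facet_of K"
  shows "norm (outward_normal K F) = 1"
proof -
  obtain C where "simplex_cell C K" using cell_simplex[OF assms(1)] .
  then interpret simplex_cell C K .
  obtain a where "a \<in> C" "F = opp a" using facet_iff assms(2) by blast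
  then show ?thesis by (rule facet_normal(1))
qed

lemma abs_inner_normal_le:
  assumes "K \<in> \<T>" "F facet_of K"
  shows "\<bar>v \<bullet> outward_normal K F\<bar> \<le> norm v"
  using Cauchy_Schwarz_ineq2[of v "outward_normal K F"] norm_outward_normal[OF assms] by simp

lemma diameter_pos:
  assumes "K \<in> \<T>" shows "0 < diameter K"
proof -
  obtain C where "simplex_cell C K" using cell_simplex[OF assms] .
  then interpret simplex_cell C K .
  obtain c where "c \<in> interior K" using interior_nonempty by blast
  then obtain e where e: "e > 0" "ball c e \<subseteq> K" by (meson mem_interior)
  obtain b where b: "b \<in> (Basis :: 'a set)" using nonempty_Basis by blast
  have "c + (e / 2) *\<^sub>R b \<in> ball c e" using e(1) b by (simp add: dist_norm)
  then have "norm (c + (e / 2) *\<^sub>R b - c) \<le> diameter K"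
    using e by (intro diameter_bounded_bound[OF compact_imp_bounded[OF compact_K(1)], unfolded dist_norm]) auto
  then show ?thesis using e(1) b by simp
qed

lemma cell_integrable:
  fixes f g :: "'a \<Rightarrow> 'b::real_inner"
  assumes "cell_cts \<T> f" "cell_cts \<T> g" "K \<in> \<T>"
  shows "set_integrable lebesgue (interior K) (\<lambda>x. f x \<bullet> g x)"
proof -
  obtain C where "simplex_cell C K" using cell_simplex[OF assms(3)] .
  then interpret simplex_cell C K .
  from assms(1,3) obtain P where P: "continuous_on UNIV P" "\<And>x. x \<in> interior K \<Longrightarrow> f x = P x" by (rule cell_ctsE) blast
  from assms(2,3) obtain Q where Q: "continuous_on UNIV Q" "\<And>x. x \<in> interior K \<Longrightarrow> g x = Q x" by (rule cell_ctsE) blast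
  have c: "continuous_on UNIV (\<lambda>x. P x \<bullet> Q x)" using P Q by (intro continuous_intros)
  show ?thesis
    by (rule set_integral_completion(2)[OF _ c]) (use P Q set_integrable_interior[OF c] in auto)
qed

lemma bdry_integrable:
  fixes f g :: "'a set \<Rightarrow> 'a set \<Rightarrow> 'a \<Rightarrow> 'b::real_inner"
  assumes "bdry_cts \<T> f" "bdry_cts \<T> g" "K \<in> \<T>" "F facet_of K"
  shows "set_integrable (face_lborel F) (rel_interior F) (\<lambda>x. f K F x \<bullet> g K F x)"
proof -
  obtain C where "simplex_cell C K" using cell_simplex[OF assms(3)] .
  then interpret simplex_cell C K .
  from assms(1,3,4) obtain P where P: "continuous_on UNIV P" "\<And>x. x \<in> rel_interior F \<Longrightarrow> f K F x = P x" by (rule bdry_ctsE) blast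
  from assms(2,3,4) obtain Q where Q: "continuous_on UNIV Q" "\<And>x. x \<in> rel_interior F \<Longrightarrow> g K F x = Q x" by (rule bdry_ctsE) blast
  have c: "continuous_on UNIV (\<lambda>x. P x \<bullet> Q x)" using P Q by (intro continuous_intros)
  have eq: "indicat_real (rel_interior F) x *\<^sub>R (f K F x \<bullet> g K F x) = indicat_real (rel_interior F) x *\<^sub>R (P x \<bullet> Q x)" for x
    using P Q by (simp add: indicator_def)
  show ?thesis using set_integrable_facet[OF c assms(4)] unfolding set_integrable_def eq .
qed

lemma cell_ip_nonneg: "0 \<le> cell_ip \<T> f f"
  unfolding cell_ip_def set_lebesgue_integral_def by (intro sum_nonneg integral_nonneg_AE) auto

lemma bdry_ip_nonneg: "0 \<le> bdry_ip \<T> f f"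
  unfolding bdry_ip_def set_lebesgue_integral_def by (intro sum_nonneg integral_nonneg_AE) auto

lemma cell_norm_nonneg: "0 \<le> cell_norm \<T> f"
  by (simp add: cell_norm_def cell_ip_nonneg)

lemma bdry_norm_nonneg: "0 \<le> bdry_norm \<T> f"
  by (simp add: bdry_norm_def bdry_ip_nonneg)

lemma cell_Cauchy_Schwarz:
  assumes "cell_cts \<T> f" "cell_cts \<T> g"
  shows "\<bar>cell_ip \<T> f g\<bar> \<le> cell_norm \<T> f * cell_norm \<T> g"
  unfolding cell_norm_def cell_ip_def
  by (rule sum_integral_Cauchy_Schwarz) (use assms cell_integrable in auto)

text \<open>The double sum is flattened into a single one over pairs, the shape that
  \<open>sum_integral_Cauchy_Schwarz\<close> requires.\<close>

lemma bdry_ip_Sigma: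
  "bdry_ip \<T> f g = (\<Sum>i\<in>Sigma \<T> (\<lambda>K. {F. F facet_of K}).
     (LINT x:rel_interior (snd i)|face_lborel (snd i). f (fst i) (snd i) x \<bullet> g (fst i) (snd i) x))"
  unfolding bdry_ip_def
  by (subst sum.Sigma) (auto simp: finite_cells finite_facets split_def)

lemma bdry_Cauchy_Schwarz:
  assumes "bdry_cts \<T> f" "bdry_cts \<T> g"
  shows "\<bar>bdry_ip \<T> f g\<bar> \<le> bdry_norm \<T> f * bdry_norm \<T> g"
  unfolding bdry_norm_def bdry_ip_Sigma
  by (rule sum_integral_Cauchy_Schwarz) (use assms bdry_integrable in auto)

lemma cell_ip_scaleR: "cell_ip \<T> (\<lambda>x. c *\<^sub>R f x) g = c * cell_ip \<T> f g"
  by (simp add: cell_ip_def sum_distrib_left)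

lemma bdry_ip_scaleR: "bdry_ip \<T> (\<lambda>K F x. c *\<^sub>R f K F x) g = c * bdry_ip \<T> f g"
  by (simp add: bdry_ip_def sum_distrib_left)

lemma cell_ip_add:
  assumes "cell_cts \<T> f" "cell_cts \<T> f'" "cell_cts \<T> g"
  shows "cell_ip \<T> (\<lambda>x. f x + f' x) g = cell_ip \<T> f g + cell_ip \<T> f' g"
  unfolding cell_ip_def inner_add_left sum.distrib[symmetric]
  by (intro sum.cong refl set_integral_add(2) cell_integrable assms)

lemma bdry_ip_add:
  assumes "bdry_cts \<T> f" "bdry_cts \<T> f'" "bdry_cts \<T> g"
  shows "bdry_ip \<T> (\<lambda>K F x. f K F x + f' K F x) g = bdry_ip \<T> f g + bdry_ip \<T> f' g"
  unfolding bdry_ip_def inner_add_left sum.distrib[symmetric]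
  by (intro sum.cong refl set_integral_add(2) bdry_integrable assms) auto

lemma bdry_ip_diff:
  assumes "bdry_cts \<T> f" "bdry_cts \<T> f'" "bdry_cts \<T> g"
  shows "bdry_ip \<T> (\<lambda>K F x. f K F x - f' K F x) g = bdry_ip \<T> f g - bdry_ip \<T> f' g"
  unfolding bdry_ip_def inner_diff_left sum_subtractf[symmetric]
  by (intro sum.cong refl set_integral_diff(2) bdry_integrable assms) auto

lemma bdry_ip_commute: "bdry_ip \<T> f g = bdry_ip \<T> g f"
  by (simp add: bdry_ip_def inner_commute)

lemma bdry_ip_cong:
  assumes "\<And>K F x. K \<in> \<T> \<Longrightarrow> F facet_of K \<Longrightarrow> x \<in> rel_interior F \<Longrightarrow> f K F x \<bullet> g K F x = f' K F x \<bullet> g' K F x"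
  shows "bdry_ip \<T> f g = bdry_ip \<T> f' g'"
proof -
  have "indicat_real (rel_interior F) x *\<^sub>R (f K F x \<bullet> g K F x) = indicat_real (rel_interior F) x *\<^sub>R (f' K F x \<bullet> g' K F x)"
    if "K \<in> \<T>" "F facet_of K" for K F x
    using assms[OF that] by (simp add: indicator_def)
  then show ?thesis
    unfolding bdry_ip_def set_lebesgue_integral_def
    by (intro sum.cong refl Bochner_Integration.integral_cong) blast+
qed

text \<open>Opposite half powers of the positive diameter cancel. One factor receives the weight of
  the trace inequality or of the facet pressure, the other that of a jump.\<close>

lemma bdry_ip_weights:
  "bdry_ip \<T> f g = bdry_ip \<T> (weighted f) (\<lambda>K F x. (diameter K powr (-1/2)) *\<^sub>R g K F x)"
proof (rule bdry_ip_cong)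
  fix K F x assume "K \<in> \<T>"
  then have "diameter K powr (-1/2) * diameter K powr (1/2) = 1"
    using diameter_pos[of K] by (simp flip: powr_add)
  then show "f K F x \<bullet> g K F x = (diameter K powr (1/2)) *\<^sub>R f K F x \<bullet> (diameter K powr (-1/2)) *\<^sub>R g K F x"
    by (simp flip: mult.assoc)
qed

lemma bdry_norm_mono:
  assumes "bdry_cts \<T> f" "bdry_cts \<T> g"
    "\<And>K F x. K \<in> \<T> \<Longrightarrow> F facet_of K \<Longrightarrow> x \<in> rel_interior F \<Longrightarrow> norm (f K F x) \<le> norm (g K F x)"
  shows "bdry_norm \<T> f \<le> bdry_norm \<T> g"
proof -
  have "bdry_ip \<T> f f \<le> bdry_ip \<T> g g"
    unfolding bdry_ip_def
  proof (intro sum_mono set_integral_mono)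
    fix K F x assume "K \<in> \<T>" "F \<in> {F. F facet_of K}" "x \<in> rel_interior F"
    then have "norm (f K F x) \<le> norm (g K F x)" using assms(3) by simp
    then have "(norm (f K F x))\<^sup>2 \<le> (norm (g K F x))\<^sup>2" by (intro power_mono) auto
    then show "f K F x \<bullet> f K F x \<le> g K F x \<bullet> g K F x" by (simp add: dot_square_norm)
  qed (use assms bdry_integrable in auto)
  then show ?thesis by (simp add: bdry_norm_def)
qed

lemma cell_norm_le_scaled:
  assumes "cell_cts \<T> f" "cell_cts \<T> g" "c \<ge> 0"
    "\<And>K x. K \<in> \<T> \<Longrightarrow> x \<in> interior K \<Longrightarrow> norm (f x) \<le> c * norm (g x)"
  shows "cell_norm \<T> f \<le> c * cell_norm \<T> g"
proof -
  have "cell_ip \<T> f f \<le> (\<Sum>K\<in>\<T>. (LINT x:interior K|lebesgue. c\<^sup>2 * (g x \<bullet> g x)))"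
    unfolding cell_ip_def
  proof (intro sum_mono set_integral_mono)
    fix K x assume "K \<in> \<T>" "x \<in> interior K"
    then have "norm (f x) \<le> c * norm (g x)" using assms(4) by simp
    then have "(norm (f x))\<^sup>2 \<le> (c * norm (g x))\<^sup>2" by (intro power_mono) auto
    then show "f x \<bullet> f x \<le> c\<^sup>2 * (g x \<bullet> g x)" by (simp add: dot_square_norm power_mult_distrib)
  qed (auto intro!: set_integrable_mult_right cell_integrable assms)
  also have "\<dots> = c\<^sup>2 * cell_ip \<T> g g" by (simp add: cell_ip_def sum_distrib_left)
  finally have "sqrt (cell_ip \<T> f f) \<le> sqrt (c\<^sup>2 * cell_ip \<T> g g)" by simp
  then show ?thesis using assms(3) by (simp add: cell_norm_def real_sqrt_mult)
qed

text \<open>The sum over cells and their facets is reordered so that the face is the outer index;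
  then the contributions of each single face cancel.\<close>

lemma bdry_ip_flux_zero:
  fixes q :: "'a \<Rightarrow> real"
  assumes dom: "open \<Omega>" "interior (closure \<Omega>) = \<Omega>" and v: "\<And>x. x \<in> frontier \<Omega> \<Longrightarrow> v x = 0"
  shows "bdry_ip \<T> (\<lambda>K F x. q x) (\<lambda>K F x. v x \<bullet> outward_normal K F) = 0"
proof -
  let ?I = "\<lambda>K F. LINT x:rel_interior F|face_lborel F. q x * (v x \<bullet> outward_normal K F)"
  have fin: "finite (mesh_faces \<T>)"
  proof -
    have "mesh_faces \<T> = (\<Union>K\<in>\<T>. {F. F facet_of K})" by (auto simp: mesh_faces_def)
    then show ?thesis using finite_cells finite_facets by simp
  qed
  have "bdry_ip \<T> (\<lambda>K F x. q x) (\<lambda>K F x. v x \<bullet> outward_normal K F) = (\<Sum>K\<in>\<T>. \<Sum>F | F \<in> mesh_faces \<T> \<and> F facet_of K. ?I K F)"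
    unfolding bdry_ip_def by (intro sum.cong refl) (auto simp: mesh_faces_def)
  also have "\<dots> = (\<Sum>F\<in>mesh_faces \<T>. \<Sum>K | K \<in> \<T> \<and> F facet_of K. ?I K F)"
    by (rule sum.swap_restrict[OF finite_cells fin])
  also have "\<dots> = 0" using sum_normal_flux_facet[OF dom v] by simp
  finally show ?thesis .
qed

end

section \<open>Piecewise polynomials\<close>

text \<open>Stating this through \<open>Basis\<close> covers scalars, vectors and the matrix-valued
  gradient at once.\<close>

abbreviation comp_poly :: "nat \<Rightarrow> (real^'d \<Rightarrow> 'b::euclidean_space) \<Rightarrow> bool" where
  "comp_poly m P \<equiv> \<forall>b\<in>Basis. (\<lambda>x. P x \<bullet> b) \<in> polys m"

definition cell_poly :: "nat \<Rightarrow> (real^'d) set set \<Rightarrow> (real^'d \<Rightarrow> 'b::euclidean_space) \<Rightarrow> bool" where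
  "cell_poly m \<T> f \<longleftrightarrow>
    (\<forall>K\<in>\<T>. \<exists>P. comp_poly m P \<and> (\<forall>x\<in>interior K. f x = P x))"

lemma cell_polyE:
  assumes "cell_poly m \<T> f" "K \<in> \<T>"
  obtains P where "comp_poly m P" "\<And>x. x \<in> interior K \<Longrightarrow> f x = P x"
  using assms unfolding cell_poly_def by blast

lemma continuous_on_polys: "p \<in> polys m \<Longrightarrow> continuous_on S p"
  by (intro continuous_on_real_polynomial_function polys_real_polynomial_function)

lemma continuous_on_component_polys:
  assumes "comp_poly m P"
  shows "continuous_on S P"
  unfolding continuous_on_componentwise[of S P] using assms continuous_on_polys by blast

lemma vec_polys_components:
  "p \<in> vec_polys m \<Longrightarrow> comp_poly m p"
  by (auto simp: vec_polys_def Basis_vec_def inner_axis)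

lemma cell_poly_V_cell: "v \<in> V_cell k \<T> \<Longrightarrow> cell_poly k \<T> v"
  unfolding V_cell_def cell_poly_def using vec_polys_components by blast

text \<open>The degree is raised from \<open>k - 1\<close> to \<open>k\<close>, so that velocities
  and pressures share one degree in the integration by parts.\<close>

lemma cell_poly_Q_cell: "q \<in> Q_cell \<Omega> k \<T> \<Longrightarrow> cell_poly k \<T> q"
proof -
  assume q: "q \<in> Q_cell \<Omega> k \<T>"
  show ?thesis
    unfolding cell_poly_def
  proof
    fix K assume "K \<in> \<T>"
    then obtain p where p: "p \<in> polys (k - 1)" "\<forall>x\<in>interior K. q x = p x"
      using q unfolding Q_cell_def by blast
    have "p \<in> polys k" using p(1) by (rule polys_mono[rotated]) simp
    then show "\<exists>P. (\<forall>b\<in>Basis. (\<lambda>x. P x \<bullet> b) \<in> polys k) \<and> (\<forall>x\<in>interior K. q x = P x)"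
      using p(2) by (intro exI[of _ p]) simp
  qed
qed

lemma cell_poly_continuous: "cell_poly m \<T> f \<Longrightarrow> cell_cts \<T> f"
  unfolding cell_cts_def
proof
  fix K assume "cell_poly m \<T> f" "K \<in> \<T>"
  then obtain P where P: "comp_poly m P" "\<And>x. x \<in> interior K \<Longrightarrow> f x = P x"
    by (rule cell_polyE) blast
  show "\<exists>P. continuous_on UNIV P \<and> (\<forall>x\<in>interior K. f x = P x)"
    using continuous_on_component_polys[OF P(1)] P(2) by (intro exI[of _ P]) simp
qed

lemma bdry_cts_faces:
  assumes "\<forall>F\<in>mesh_faces \<T>. \<exists>P. continuous_on UNIV P \<and> (\<forall>x\<in>rel_interior F. f x = P x)"
  shows "bdry_cts \<T> (\<lambda>K F x. f x)"
  using assms unfolding bdry_cts_def mesh_faces_def by blast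

lemma V_face_continuous:
  assumes "v \<in> V_face \<Omega> k \<T>" shows "bdry_cts \<T> (\<lambda>K F x. v x)"
proof (rule bdry_cts_faces, rule ballI)
  fix F assume "F \<in> mesh_faces \<T>"
  then obtain p where "p \<in> vec_polys k" "\<forall>x\<in>rel_interior F. v x = p x"
    using assms by (auto simp: V_face_def)
  then show "\<exists>P. continuous_on UNIV P \<and> (\<forall>x\<in>rel_interior F. v x = P x)"
    using continuous_on_component_polys[OF vec_polys_components] by blast
qed

lemma Q_face_continuous:
  assumes "q \<in> Q_face k \<T>" shows "bdry_cts \<T> (\<lambda>K F x. q x)"
  using assms continuous_on_polys by (intro bdry_cts_faces) (fastforce simp: Q_face_def)

text \<open>\<open>Lim\<close> is meaningful only along a nontrivial filter. Since \<open>K\<close>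
  is the closure of its interior, each of its points is approached from inside, and there
  \<open>f\<close> coincides with the continuous \<open>P\<close>.\<close>

lemma (in simplex_cell) cell_trace_eq:
  fixes f P :: "'a \<Rightarrow> 'b::t2_space"
  assumes P: "continuous_on UNIV P" and eq: "\<And>y. y \<in> interior K \<Longrightarrow> f y = P y" and x: "x \<in> K"
  shows "cell_trace K f x = P x"
  unfolding cell_trace_def
proof (rule tendsto_Lim)
  show "at x within interior K \<noteq> bot"
  proof (cases "x \<in> interior K")
    case True
    then have "at x within interior K = at x" by (rule at_within_open) simp
    then show ?thesis by simp
  next
    case False
    moreover have "x \<in> closure (interior K)" using x closure_interior_K by simp
    ultimately have "x islimpt interior K" by (simp add: closure_def)
    then show ?thesis by (simp add: trivial_limit_within)
  qed
  have "(P \<longlongrightarrow> P x) (at x within interior K)"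
    using P tendsto_within_subset[OF _ subset_UNIV] unfolding continuous_on_def by blast
  moreover have "\<forall>\<^sub>F y in at x within interior K. f y = P y"
    using eq by (simp add: eventually_at_filter)
  ultimately show "(f \<longlongrightarrow> P x) (at x within interior K)"
    by (simp add: tendsto_cong)
qed

lemma vec_polys_gradient:
  fixes P :: "real^'d \<Rightarrow> real^'d"
  assumes "comp_poly m P"
  obtains G where "comp_poly m G"
    "\<And>x. (P has_derivative (\<lambda>v. G x *v v)) (at x)"
    "\<And>i x. ((\<lambda>x. P x $ i) has_derivative (\<lambda>v. G x $ i \<bullet> v)) (at x)"
proof -
  have "(\<lambda>x. P x $ i) \<in> polys m" for i
    using bspec[OF assms, of "axis i 1"] by (simp add: inner_axis axis_in_Basis_iff)
  then have "\<forall>i. \<exists>p'. (\<forall>j. (\<lambda>x. p' x $ j) \<in> polys m) \<and> (\<forall>x. ((\<lambda>x. P x $ i) has_derivative (\<lambda>v. p' x \<bullet> v)) (at x))"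
    using polys_gradient by blast
  then obtain g where g: "\<And>i j. (\<lambda>x. g i x $ j) \<in> polys m"
    "\<And>i x. ((\<lambda>x. P x $ i) has_derivative (\<lambda>v. g i x \<bullet> v)) (at x)" by metis
  define G where "G x = (\<chi> i. g i x)" for x
  show thesis
  proof (rule that[of G])
    show "comp_poly m G"
    proof
      fix b :: "real^'d^'d" assume b: "b \<in> Basis"
      obtain i j where "b = axis i (axis j 1)" using b by (auto simp: Basis_vec_def)
      then show "(\<lambda>x. G x \<bullet> b) \<in> polys m" using g(1)[of i j] by (simp add: G_def inner_axis)
    qed
    show *: "((\<lambda>x. P x $ i) has_derivative (\<lambda>v. G x $ i \<bullet> v)) (at x)" for i x
      using g(2) by (simp add: G_def)
    show "(P has_derivative (\<lambda>v. G x *v v)) (at x)" for x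
    proof (subst has_derivative_componentwise_within, intro ballI)
      fix b :: "real^'d" assume "b \<in> Basis"
      then obtain i where b: "b = axis i 1" by (auto simp: Basis_vec_def)
      show "((\<lambda>x. P x \<bullet> b) has_derivative (\<lambda>v. (G x *v v) \<bullet> b)) (at x)"
        using *[of i x] by (simp add: b inner_axis matrix_vector_mul_component)
    qed
  qed
qed

lemma grad_vec_eq:
  fixes v :: "real^'d \<Rightarrow> real^'d"
  assumes "(P has_derivative (\<lambda>h. A *v h)) (at x)" "\<And>y. y \<in> interior K \<Longrightarrow> v y = P y" "x \<in> interior K"
  shows "grad_vec v x = A"
proof -
  have "(v has_derivative (\<lambda>h. A *v h)) (at x)"
    using assms by (intro has_derivative_transform_within_open[OF assms(1), of "interior K"]) auto
  then have "frechet_derivative v (at x) = (\<lambda>h. A *v h)" by (rule frechet_derivative_at[symmetric])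
  then show ?thesis by (simp add: grad_vec_def jacobian_def)
qed

lemma grad_eq:
  fixes q :: "real^'d \<Rightarrow> real"
  assumes "(Q has_derivative (\<lambda>h. w \<bullet> h)) (at x)" "\<And>y. y \<in> interior K \<Longrightarrow> q y = Q y" "x \<in> interior K"
  shows "grad q x = w"
proof -
  have "(q has_derivative (\<lambda>h. w \<bullet> h)) (at x)"
    using assms by (intro has_derivative_transform_within_open[OF assms(1), of "interior K"]) auto
  then have "frechet_derivative q (at x) = (\<lambda>h. w \<bullet> h)" by (rule frechet_derivative_at[symmetric])
  then show ?thesis by (simp add: grad_def vec_eq_iff inner_axis)
qed

lemma cell_poly_grad_vec:
  assumes "cell_poly m \<T> v"
  shows "cell_poly m \<T> (grad_vec v)"
  unfolding cell_poly_def
proof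
  fix K assume "K \<in> \<T>"
  with assms obtain P where P: "comp_poly m P" "\<And>x. x \<in> interior K \<Longrightarrow> v x = P x"
    by (rule cell_polyE) blast
  obtain G where G: "comp_poly m G" "\<And>x. (P has_derivative (\<lambda>v. G x *v v)) (at x)"
    by (rule vec_polys_gradient[OF P(1)]) blast+
  show "\<exists>G. comp_poly m G \<and> (\<forall>x\<in>interior K. grad_vec v x = G x)"
  proof (intro exI conjI ballI)
    show "(\<lambda>x. G x \<bullet> b) \<in> polys m" if "b \<in> Basis" for b using G(1) that by blast
    show "grad_vec v x = G x" if "x \<in> interior K" for x
      using G(2) P(2) that by (rule grad_vec_eq)
  qed
qed

lemma cell_poly_grad:
  fixes q :: "real^'d \<Rightarrow> real"
  assumes "cell_poly m \<T> q"
  shows "cell_poly m \<T> (grad q)"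
  unfolding cell_poly_def
proof
  fix K assume "K \<in> \<T>"
  with assms obtain Q where Q: "comp_poly m Q" "\<And>x. x \<in> interior K \<Longrightarrow> q x = Q x"
    by (rule cell_polyE) blast
  have "Q \<in> polys m" using bspec[OF Q(1), of 1] by simp
  then obtain g where g: "\<And>i. (\<lambda>x. g x $ i) \<in> polys m" "\<And>x. (Q has_derivative (\<lambda>v. g x \<bullet> v)) (at x)"
    using polys_gradient by blast
  show "\<exists>g. comp_poly m g \<and> (\<forall>x\<in>interior K. grad q x = g x)"
  proof (intro exI conjI ballI)
    show "(\<lambda>x. g x \<bullet> b) \<in> polys m" if "b \<in> Basis" for b
      using that g(1) by (auto simp: Basis_vec_def inner_axis)
    show "grad q x = g x" if "x \<in> interior K" for x using g(2) Q(2) that by (rule grad_eq)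
  qed
qed

lemma divergence_continuous:
  assumes "cell_poly m \<T> v"
  shows "cell_cts \<T> (divergence v)"
  unfolding cell_cts_def
proof
  fix K assume "K \<in> \<T>"
  with cell_poly_continuous[OF cell_poly_grad_vec[OF assms]]
  obtain G where G: "continuous_on UNIV G" "\<And>x. x \<in> interior K \<Longrightarrow> grad_vec v x = G x"
    by (rule cell_ctsE) blast
  show "\<exists>P. continuous_on UNIV P \<and> (\<forall>x\<in>interior K. divergence v x = P x)"
    using G by (intro exI[of _ "\<lambda>x. trace (G x)"]) (auto simp: divergence_def trace_def intro!: continuous_intros)
qed

section \<open>Trace bound and integration by parts for piecewise polynomials\<close>

locale poly_mesh = mesh \<Omega> \<T> for \<Omega> :: "(real^'d) set" and \<T>
begin

lemma cell_trace_poly: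
  assumes f: "cell_poly m \<T> f" and K: "K \<in> \<T>"
  obtains P where "comp_poly m P" "\<And>x. x \<in> interior K \<Longrightarrow> f x = P x"
    "\<And>F x. F facet_of K \<Longrightarrow> x \<in> rel_interior F \<Longrightarrow> cell_trace K f x = P x"
proof -
  obtain C where "simplex_cell C K" using cell_simplex[OF K] .
  then interpret simplex_cell C K .
  from f K obtain P where P: "comp_poly m P" "\<And>x. x \<in> interior K \<Longrightarrow> f x = P x"
    by (rule cell_polyE) blast
  have "cell_trace K f x = P x" if "F facet_of K" "x \<in> rel_interior F" for F x
  proof (rule cell_trace_eq[OF continuous_on_component_polys[OF P(1)] P(2)])
    show "x \<in> K" using that facet_iff facet_subset(1) by blast
  qed
  then show thesis using that P by blast
qed

lemma cell_trace_continuous: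
  assumes "cell_poly m \<T> f"
  shows "bdry_cts \<T> (\<lambda>K F x. cell_trace K f x)"
  unfolding bdry_cts_def
proof (intro ballI allI impI)
  fix K F assume K: "K \<in> \<T>" "F facet_of K"
  from assms K(1) obtain P where "comp_poly m P"
    "\<And>F x. F facet_of K \<Longrightarrow> x \<in> rel_interior F \<Longrightarrow> cell_trace K f x = P x"
    by (rule cell_trace_poly) blast
  then show "\<exists>P. continuous_on UNIV P \<and> (\<forall>x\<in>rel_interior F. cell_trace K f x = P x)"
    using continuous_on_component_polys K(2) by blast
qed

text \<open>The scalar inequality is applied to each component of \<open>f\<close>, the two half
  powers of the diameter combining to the full one. The factor \<open>Suc CARD('d)\<close> is the
  number of facets of a simplex.\<close>

lemma bdry_norm_trace_le:
  fixes f :: "real^'d \<Rightarrow> 'b::euclidean_space"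
  assumes f: "cell_poly m \<T> f" and M0: "M \<ge> 0"
    and M: "\<And>K F p. K \<in> \<T> \<Longrightarrow> F facet_of K \<Longrightarrow> p \<in> polys m \<Longrightarrow>
      diameter K * (LINT y:rel_interior F|face_lborel F. (p y)\<^sup>2) \<le> M * (LINT x:interior K|lborel. (p x)\<^sup>2)"
  shows "bdry_norm \<T> (weighted (\<lambda>K F. cell_trace K f)) \<le> sqrt (real (Suc CARD('d)) * M) * cell_norm \<T> f"
proof -
  let ?g = "\<lambda>K F x. (diameter K powr (1/2)) *\<^sub>R cell_trace K f x"
  have "bdry_ip \<T> ?g ?g \<le> (\<Sum>K\<in>\<T>. real (Suc CARD('d)) * M * (LINT x:interior K|lebesgue. f x \<bullet> f x))"
    unfolding bdry_ip_def
  proof (rule sum_mono)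
    fix K assume K: "K \<in> \<T>"
    obtain C where "simplex_cell C K" using cell_simplex[OF K] .
    then interpret simplex_cell C K .
    from f K obtain P where P: "comp_poly m P" "\<And>x. x \<in> interior K \<Longrightarrow> f x = P x"
      "\<And>F x. F facet_of K \<Longrightarrow> x \<in> rel_interior F \<Longrightarrow> cell_trace K f x = P x"
      by (rule cell_trace_poly) blast
    have Pc: "continuous_on UNIV P" using P(1) by (rule continuous_on_component_polys)
    let ?J = "\<lambda>F. LINT x:rel_interior F|face_lborel F. ?g K F x \<bullet> ?g K F x"
    let ?I = "LINT x:interior K|lebesgue. f x \<bullet> f x"
    have PP: "P x \<bullet> P x = (\<Sum>b\<in>Basis. (P x \<bullet> b)\<^sup>2)" for x
      by (subst euclidean_inner) (simp add: power2_eq_square)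
    have bc: "continuous_on UNIV (\<lambda>x. (P x \<bullet> b)\<^sup>2)" if "b \<in> Basis" for b
      using Pc by (intro continuous_intros)
    have I: "?I = (\<Sum>b\<in>Basis. LINT x:interior K|lborel. (P x \<bullet> b)\<^sup>2)"
    proof -
      have "?I = (LINT x:interior K|lborel. P x \<bullet> P x)"
        using Pc P(2) by (intro set_integral_completion) (auto intro: continuous_intros)
      also have "\<dots> = (\<Sum>b\<in>Basis. LINT x:interior K|lborel. (P x \<bullet> b)\<^sup>2)"
        unfolding PP set_lebesgue_integral_def scaleR_sum_right
        using set_integrable_interior[OF bc] by (intro Bochner_Integration.integral_sum) (auto simp: set_integrable_def)
      finally show ?thesis .
    qed
    have "(?J F) \<le> M * ?I"
      if F: "F facet_of K" for F
    proof -
      have d: "diameter K powr (1/2) * diameter K powr (1/2) = diameter K"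
        using diameter_pos[OF K] by (simp flip: powr_add)
      have "indicat_real (rel_interior F) x *\<^sub>R (?g K F x \<bullet> ?g K F x) = indicat_real (rel_interior F) x *\<^sub>R (diameter K * (\<Sum>b\<in>Basis. (P x \<bullet> b)\<^sup>2))" for x
        using P(3)[OF F, of x] by (simp add: indicator_def PP d flip: mult.assoc)
      then have "(?J F) = (LINT x:rel_interior F|face_lborel F. diameter K * (\<Sum>b\<in>Basis. (P x \<bullet> b)\<^sup>2))"
        unfolding set_lebesgue_integral_def by (intro Bochner_Integration.integral_cong) blast+
      also have "\<dots> = diameter K * (\<Sum>b\<in>Basis. LINT x:rel_interior F|face_lborel F. (P x \<bullet> b)\<^sup>2)"
        unfolding set_integral_mult_right
        unfolding set_lebesgue_integral_def scaleR_sum_right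
        using set_integrable_facet[OF bc F] by (subst Bochner_Integration.integral_sum) (auto simp: set_integrable_def)
      also have "\<dots> = (\<Sum>b\<in>Basis. diameter K * (LINT x:rel_interior F|face_lborel F. (P x \<bullet> b)\<^sup>2))"
        by (rule sum_distrib_left)
      also have "\<dots> \<le> (\<Sum>b\<in>Basis. M * (LINT x:interior K|lborel. (P x \<bullet> b)\<^sup>2))"
        by (intro sum_mono M K F bspec[OF P(1)])
      finally show ?thesis by (simp add: I sum_distrib_left)
    qed
    then have "(\<Sum>F | F facet_of K. ?J F) \<le>
      (\<Sum>F | F facet_of K. M * ?I)" by (intro sum_mono) auto
    also have "\<dots> = real (card {F. F facet_of K}) * (M * ?I)" by simp
    also have "card {F. F facet_of K} = Suc CARD('d)"
      unfolding facets_eq using card_image[OF inj_on_opposite_facet] card_C by simp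
    finally show "(\<Sum>F | F facet_of K. ?J F) \<le>
      real (Suc CARD('d)) * M * ?I" by (simp add: mult.assoc)
  qed
  also have "\<dots> = (real (Suc CARD('d)) * M) * cell_ip \<T> f f"
    by (simp add: cell_ip_def sum_distrib_left)
  finally have "sqrt (bdry_ip \<T> ?g ?g) \<le> sqrt ((real (Suc CARD('d)) * M) * cell_ip \<T> f f)" by simp
  then show ?thesis by (simp only: bdry_norm_def cell_norm_def real_sqrt_mult)
qed

text \<open>On each cell this is the product rule for \<open>q v\<close>:
  \<open>integral_directional_derivative\<close> is applied to \<open>q\<close> times the component
  \<open>i\<close> of \<open>v\<close> in the coordinate direction \<open>i\<close>, and the results
  are added.\<close>

lemma cell_integration_by_parts:
  fixes v :: "real^'d \<Rightarrow> real^'d" and q :: "real^'d \<Rightarrow> real"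
  assumes v: "cell_poly m \<T> v" and q: "cell_poly m \<T> q"
  shows "cell_ip \<T> q (divergence v) + cell_ip \<T> (grad q) v =
    bdry_ip \<T> (\<lambda>K F x. cell_trace K q x) (\<lambda>K F x. cell_trace K v x \<bullet> outward_normal K F)"
  unfolding cell_ip_def bdry_ip_def sum.distrib[symmetric]
proof (rule sum.cong[OF refl])
  fix K assume K: "K \<in> \<T>"
  obtain C where "simplex_cell C K" using cell_simplex[OF K] .
  then interpret simplex_cell C K .
  from v K obtain P where P: "comp_poly m P" "\<And>x. x \<in> interior K \<Longrightarrow> v x = P x"
    "\<And>F x. F facet_of K \<Longrightarrow> x \<in> rel_interior F \<Longrightarrow> cell_trace K v x = P x"
    by (rule cell_trace_poly) blast
  from q K obtain Q where Q: "comp_poly m Q" "\<And>x. x \<in> interior K \<Longrightarrow> q x = Q x"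
    "\<And>F x. F facet_of K \<Longrightarrow> x \<in> rel_interior F \<Longrightarrow> cell_trace K q x = Q x"
    by (rule cell_trace_poly) blast
  obtain G where G: "comp_poly m G" "\<And>x. (P has_derivative (\<lambda>v. G x *v v)) (at x)"
    "\<And>i x. ((\<lambda>x. P x $ i) has_derivative (\<lambda>v. G x $ i \<bullet> v)) (at x)"
    by (rule vec_polys_gradient[OF P(1)]) blast+
  have "Q \<in> polys m" using bspec[OF Q(1), of 1] by simp
  then obtain g where g: "\<And>i. (\<lambda>x. g x $ i) \<in> polys m" "\<And>x. (Q has_derivative (\<lambda>v. g x \<bullet> v)) (at x)"
    using polys_gradient by blast
  have Pc: "continuous_on UNIV P" using P(1) by (rule continuous_on_component_polys)
  have Qc: "continuous_on UNIV Q" using Q(1) by (rule continuous_on_component_polys)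
  have Gc: "continuous_on UNIV G" using G(1) by (rule continuous_on_component_polys)
  have gc: "continuous_on UNIV g"
    by (rule continuous_on_component_polys[of _ m]) (use g(1) in \<open>auto simp: Basis_vec_def inner_axis\<close>)
  have c1: "continuous_on UNIV (\<lambda>x. Q x * trace (G x))" unfolding trace_def by (intro continuous_intros Qc Gc)
  have c2: "continuous_on UNIV (\<lambda>x. g x \<bullet> P x)" by (intro continuous_intros gc Pc)
  let ?R = "\<lambda>F. LINT x:rel_interior F|face_lborel F. cell_trace K q x \<bullet> (cell_trace K v x \<bullet> outward_normal K F)"
  let ?S = "\<lambda>F i. (outward_normal K F \<bullet> axis i 1) * (LINT y:rel_interior F|face_lborel F. Q y * P y $ i)"
  have "(LINT x:interior K|lebesgue. q x \<bullet> divergence v x) + (LINT x:interior K|lebesgue. grad q x \<bullet> v x)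
    = (LINT x:interior K|lborel. Q x * trace (G x)) + (LINT x:interior K|lborel. g x \<bullet> P x)"
  proof (intro arg_cong2[where f="(+)"] set_integral_completion(1))
    show "continuous_on UNIV (\<lambda>x. Q x * trace (G x))" "continuous_on UNIV (\<lambda>x. g x \<bullet> P x)"
      by (rule c1, rule c2)
    show "q x \<bullet> divergence v x = Q x * trace (G x)" if "x \<in> interior K" for x
    proof -
      have "grad_vec v x = G x" using G(2) P(2) that by (rule grad_vec_eq)
      then show ?thesis using Q(2)[OF that] by (simp add: divergence_def)
    qed
    show "grad q x \<bullet> v x = g x \<bullet> P x" if "x \<in> interior K" for x
    proof -
      have "grad q x = g x" using g(2) Q(2) that by (rule grad_eq)
      then show ?thesis using P(2)[OF that] by simp
    qed
  qed auto
  also have "\<dots> = (LINT x:interior K|lborel. Q x * trace (G x) + g x \<bullet> P x)"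
    by (rule set_integral_add(2)[OF set_integrable_interior[OF c1] set_integrable_interior[OF c2], symmetric])
  \<comment> \<open>Each summand is the partial derivative in direction \<open>i\<close> of
    \<open>Q\<close> times the component \<open>i\<close> of \<open>P\<close>.\<close>
  also have "\<dots> = (LINT x:interior K|lborel. (\<Sum>i\<in>UNIV. (Q x *\<^sub>R (G x $ i) + (P x $ i) *\<^sub>R g x) \<bullet> axis i 1))"
    by (intro arg_cong[where f="set_lebesgue_integral lborel (interior K)"] ext)
      (simp add: trace_def inner_axis sum.distrib sum_distrib_left inner_vec_def[of "g x" "P x" for x] mult_ac)
  also have "\<dots> = (\<Sum>i\<in>UNIV. LINT x:interior K|lborel. (Q x *\<^sub>R (G x $ i) + (P x $ i) *\<^sub>R g x) \<bullet> axis i 1)"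
    unfolding set_lebesgue_integral_def scaleR_sum_right
    by (rule Bochner_Integration.integral_sum)
      (intro set_integrable_interior[unfolded set_integrable_def] continuous_intros Qc Gc gc Pc)
  also have "\<dots> = (\<Sum>i\<in>UNIV. \<Sum>F | F facet_of K. ?S F i)"
  proof (intro sum.cong refl integral_directional_derivative)
    fix i x
    show "((\<lambda>x. Q x * P x $ i) has_derivative (\<lambda>v. (Q x *\<^sub>R G x $ i + P x $ i *\<^sub>R g x) \<bullet> v)) (at x)"
      using has_derivative_mult[OF g(2)[of x] G(3)[of i x]]
      by (simp add: inner_add_left mult_ac)
    show "continuous_on UNIV (\<lambda>x. Q x *\<^sub>R G x $ i + P x $ i *\<^sub>R g x)" by (intro continuous_intros Qc Gc gc Pc)
  qed
  also have "\<dots> = (\<Sum>F | F facet_of K. \<Sum>i\<in>UNIV. ?S F i)"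
    by (rule sum.swap)
  also have "\<dots> = (\<Sum>F | F facet_of K. ?R F)"
  proof (rule sum.cong[OF refl])
    fix F assume "F \<in> {F. F facet_of K}"
    then have F: "F facet_of K" by simp
    have "(\<Sum>i\<in>UNIV. ?S F i) =
      (\<Sum>i\<in>UNIV. (LINT y:rel_interior F|face_lborel F. outward_normal K F $ i * (Q y * P y $ i)))"
      by (simp add: inner_axis)
    also have "\<dots> = (LINT y:rel_interior F|face_lborel F. (\<Sum>i\<in>UNIV. outward_normal K F $ i * (Q y * P y $ i)))"
      unfolding set_lebesgue_integral_def scaleR_sum_right
      by (rule Bochner_Integration.integral_sum[symmetric])
        (intro set_integrable_facet[unfolded set_integrable_def] continuous_intros Qc Pc F)
    also have "\<dots> = (?R F)"
    proof -
      have "indicat_real (rel_interior F) y *\<^sub>R (\<Sum>i\<in>UNIV. outward_normal K F $ i * (Q y * P y $ i)) =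
        indicat_real (rel_interior F) y *\<^sub>R (cell_trace K q y \<bullet> (cell_trace K v y \<bullet> outward_normal K F))" for y
        using P(3)[OF F, of y] Q(3)[OF F, of y] by (simp add: indicator_def inner_vec_def sum_distrib_left mult_ac)
      then show ?thesis
        unfolding set_lebesgue_integral_def by (intro Bochner_Integration.integral_cong) blast+
    qed
    finally show "(\<Sum>i\<in>UNIV. ?S F i) =
      (?R F)" .
  qed
  finally show "(LINT x:interior K|lebesgue. q x \<bullet> divergence v x) + (LINT x:interior K|lebesgue. grad q x \<bullet> v x)
    = (\<Sum>F | F facet_of K. ?R F)" .
qed

end

section \<open>Boundedness of the bilinear forms\<close>

lemma norm_matrix_vector_mult_le: "norm (A *v x) \<le> norm A * norm x" for A :: "real^'n^'m"
proof -
  have "norm (A *v x) = L2_set (\<lambda>i. norm (A $ i \<bullet> x)) UNIV"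
    by (simp add: norm_vec_def matrix_vector_mul_component)
  also have "\<dots> \<le> L2_set (\<lambda>i. norm (A $ i) * norm x) UNIV"
    by (rule L2_set_mono) (auto simp: Cauchy_Schwarz_ineq2)
  also have "\<dots> = norm A * norm x"
    by (simp add: norm_vec_def[of A] L2_set_left_distrib)
  finally show ?thesis .
qed

text \<open>The trace is the Frobenius product with the identity. The constant is the square root of
  the dimension, left in the form in which Cauchy-Schwarz delivers it.\<close>

lemma abs_trace_le:
  fixes A :: "real^'n^'n"
  shows "\<bar>trace A\<bar> \<le> norm (mat 1 :: real^'n^'n) * norm A"
proof -
  have "trace A = (mat 1 :: real^'n^'n) \<bullet> A"
    by (simp add: trace_def inner_vec_def mat_def if_distrib[of "\<lambda>c. c * _"] cong: if_cong)
  then show ?thesis by (simp add: Cauchy_Schwarz_ineq2)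
qed

lemma sum_mult_le_sqrt:
  fixes a b c d :: real
  shows "a * b + c * d \<le> sqrt (a\<^sup>2 + c\<^sup>2) * sqrt (b\<^sup>2 + d\<^sup>2)"
proof -
  have "0 \<le> (a * d - c * b)\<^sup>2" by simp
  then have "(a * b + c * d)\<^sup>2 \<le> (a\<^sup>2 + c\<^sup>2) * (b\<^sup>2 + d\<^sup>2)"
    by (simp add: power2_eq_square algebra_simps)
  then show ?thesis by (simp add: real_le_rsqrt real_sqrt_mult[symmetric])
qed

definition scaled_jump :: "(real^'d \<Rightarrow> 'b::real_normed_vector) \<Rightarrow> (real^'d \<Rightarrow> 'b) \<Rightarrow> (real^'d) set \<Rightarrow> (real^'d) set \<Rightarrow> real^'d \<Rightarrow> 'b"
  where "scaled_jump f fb = (\<lambda>K F x. (diameter K powr (-1/2)) *\<^sub>R (cell_trace K f x - fb x))"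

lemma V_spaceD:
  assumes "(v, vb) \<in> V_space \<Omega> k \<T>"
  shows "cell_poly k \<T> v" "bdry_cts \<T> (\<lambda>K F x. vb x)" "\<And>x. x \<in> frontier \<Omega> \<Longrightarrow> vb x = 0"
proof -
  have 1: "v \<in> V_cell k \<T>" "vb \<in> V_face \<Omega> k \<T>" using assms by (auto simp: V_space_def)
  show "cell_poly k \<T> v" by (rule cell_poly_V_cell[OF 1(1)])
  show "bdry_cts \<T> (\<lambda>K F x. vb x)" by (rule V_face_continuous[OF 1(2)])
  show "vb x = 0" if "x \<in> frontier \<Omega>" for x using 1(2) that by (simp add: V_face_def)
qed

lemma Q_spaceD:
  assumes "(q, qb) \<in> Q_space \<Omega> k \<T>"
  shows "cell_poly k \<T> q" "bdry_cts \<T> (\<lambda>K F x. qb x)"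
proof -
  have 1: "q \<in> Q_cell \<Omega> k \<T>" "qb \<in> Q_face k \<T>" using assms by (auto simp: Q_space_def)
  show "cell_poly k \<T> q" by (rule cell_poly_Q_cell[OF 1(1)])
  show "bdry_cts \<T> (\<lambda>K F x. qb x)" by (rule Q_face_continuous[OF 1(2)])
qed

text \<open>The trace inequality is an assumption with a given constant \<open>M\<close>. Every
  constant derived here is an expression in \<open>M\<close> and the dimension, so one value of
  \<open>M\<close> for a whole family of meshes gives uniform bounds.\<close>

locale fem = poly_mesh \<Omega> \<T> for \<Omega> :: "(real^'d) set" and \<T> +
  fixes k :: nat and M \<eta> \<nu> \<tau> :: real
  assumes dom: "open \<Omega>" "interior (closure \<Omega>) = \<Omega>" and \<eta>: "\<eta> > 1" and M0: "M \<ge> 0" and pos: "\<nu> > 0" "\<tau> > 0"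
    and M: "\<And>K F p. K \<in> \<T> \<Longrightarrow> F facet_of K \<Longrightarrow> p \<in> polys k \<Longrightarrow>
      diameter K * (LINT y:rel_interior F|face_lborel F. (p y)\<^sup>2) \<le> M * (LINT x:interior K|lborel. (p x)\<^sup>2)"
begin

abbreviation "Nv \<equiv> norm_v \<T> \<nu> \<tau> \<eta>"
abbreviation "Nq \<equiv> norm_q \<Omega> k \<T> \<nu> \<tau> \<eta>"
abbreviation "NX \<equiv> norm_X \<Omega> k \<T> \<nu> \<tau> \<eta>"
abbreviation "Nv1 \<equiv> norm_v1 \<T> \<eta>"
abbreviation "Nq0 \<equiv> norm_q0 \<T> \<eta>"
abbreviation "Nq1 \<equiv> norm_q1 \<T> \<eta>"

definition "Ct = sqrt (real (Suc CARD('d)) * M)"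

lemma Ct_nonneg: "Ct \<ge> 0" using M0 by (simp add: Ct_def)

lemma trace_le:
  fixes f :: "real^'d \<Rightarrow> 'b::euclidean_space"
  assumes "cell_poly k \<T> f"
  shows "bdry_norm \<T> (weighted (\<lambda>K F. cell_trace K f)) \<le> Ct * cell_norm \<T> f"
  unfolding Ct_def by (rule bdry_norm_trace_le[OF assms M0 M])

lemma norm_v1_sq:
  "(Nv1 (v, vb))\<^sup>2 = (cell_norm \<T> (grad_vec v))\<^sup>2 + \<eta> * (bdry_norm \<T> (scaled_jump v vb))\<^sup>2"
  using \<eta> by (simp add: scaled_jump_def)

lemma norm_q0_sq:
  "(Nq0 (q, qb))\<^sup>2 = (cell_norm \<T> q)\<^sup>2
     + inverse \<eta> * (bdry_norm \<T> (\<lambda>K F x. (diameter K powr (1/2)) *\<^sub>R qb x))\<^sup>2"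
  using \<eta> by simp

lemma norm_q1_sq:
  "(Nq1 (q, qb))\<^sup>2 = (cell_norm \<T> (grad q))\<^sup>2 + \<eta> * (bdry_norm \<T> (scaled_jump q qb))\<^sup>2"
  using \<eta> by (simp add: scaled_jump_def)

lemma norms_nonneg: "0 \<le> Nv1 vv" "0 \<le> Nq0 qq" "0 \<le> Nq1 qq"
  using \<eta> by (cases vv, simp; cases qq, simp)+

lemma norm_v_sq:
  "(Nv (v, vb))\<^sup>2 = \<tau> * (cell_norm \<T> v)\<^sup>2 + \<nu> * (Nv1 (v, vb))\<^sup>2"
  using pos by (simp del: norm_v1.simps)

lemma jump_continuous:
  assumes "cell_poly k \<T> f" "bdry_cts \<T> (\<lambda>K F x. fb x)"
  shows "bdry_cts \<T> (\<lambda>K F x. cell_trace K f x - fb x)" "bdry_cts \<T> (scaled_jump f fb)"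
proof -
  show *: "bdry_cts \<T> (\<lambda>K F x. cell_trace K f x - fb x)"
    by (rule bdry_cts_diff[OF cell_trace_continuous[OF assms(1)] assms(2)])
  show "bdry_cts \<T> (scaled_jump f fb)"
    unfolding scaled_jump_def by (rule bdry_cts_scaleR[OF *])
qed

text \<open>In the cell term the divergence is bounded by the gradient through
  \<open>abs_trace_le\<close>. In the boundary term, once the flux of \<open>vb\<close> has been
  removed, \<open>qb\<close> takes the positive half power of the diameter and the jump the negative
  one, as their norms demand.\<close>

lemma b_form_le_v1_q0:
  assumes v: "(v, vb) \<in> V_space \<Omega> k \<T>" and q: "(q, qb) \<in> Q_space \<Omega> k \<T>"
  shows "\<bar>b_form \<T> v (q, qb)\<bar> \<le> (norm (mat 1 :: real^'d^'d) + 1) * (Nv1 (v, vb) * Nq0 (q, qb))"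
proof -
  have vp: "cell_poly k \<T> v" and vbc: "bdry_cts \<T> (\<lambda>K F x. vb x)" and vb0: "\<And>x. x \<in> frontier \<Omega> \<Longrightarrow> vb x = 0"
    using V_spaceD[OF v] .
  have qp: "cell_poly k \<T> q" and qbc: "bdry_cts \<T> (\<lambda>K F x. qb x)"
    using Q_spaceD[OF q] .
  let ?J = "\<lambda>K F x. cell_trace K v x - vb x"
  let ?n1 = "Nv1 (v, vb)" and ?n0 = "Nq0 (q, qb)"
  let ?Q = "\<lambda>K F x. (diameter K powr (1/2)) *\<^sub>R qb x"
  define c where "c = norm (mat 1 :: real^'d^'d)"
  note Jc = jump_continuous[OF vp vbc]
  let ?W = "\<lambda>K F x. (diameter K powr (-1/2)) *\<^sub>R (?J K F x \<bullet> outward_normal K F)"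
  let ?B = "bdry_ip \<T> (\<lambda>K F x. qb x) (\<lambda>K F x. cell_trace K v x \<bullet> outward_normal K F)"
  have "?B =
    bdry_ip \<T> (\<lambda>K F x. qb x) (\<lambda>K F x. ?J K F x \<bullet> outward_normal K F)"
  proof -
    have "bdry_ip \<T> (\<lambda>K F x. ?J K F x \<bullet> outward_normal K F) (\<lambda>K F x. qb x) =
      bdry_ip \<T> (\<lambda>K F x. cell_trace K v x \<bullet> outward_normal K F) (\<lambda>K F x. qb x) - bdry_ip \<T> (\<lambda>K F x. vb x \<bullet> outward_normal K F) (\<lambda>K F x. qb x)"
      unfolding inner_diff_left
      by (intro bdry_ip_diff bdry_cts_inner cell_trace_continuous[OF vp] vbc qbc)
    moreover have "bdry_ip \<T> (\<lambda>K F x. vb x \<bullet> outward_normal K F) (\<lambda>K F x. qb x) = 0"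
      using bdry_ip_flux_zero[OF dom vb0] by (simp only: bdry_ip_commute)
    ultimately show ?thesis by (simp only: bdry_ip_commute)
  qed
  also have "\<dots> = bdry_ip \<T> ?Q ?W"
    by (rule bdry_ip_weights)
  finally have eq: "?B =
    bdry_ip \<T> ?Q ?W" .
  have Jn: "bdry_cts \<T> ?W"
    by (intro bdry_cts_scaleR bdry_cts_inner Jc(1))
  have b1: "\<bar>cell_ip \<T> q (divergence v)\<bar> \<le> c * (?n1 * ?n0)"
  proof -
    have "\<bar>cell_ip \<T> q (divergence v)\<bar> \<le> cell_norm \<T> q * cell_norm \<T> (divergence v)"
      by (intro cell_Cauchy_Schwarz cell_poly_continuous[OF qp] divergence_continuous[OF vp])
    also have "\<dots> \<le> cell_norm \<T> q * (c * cell_norm \<T> (grad_vec v))"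
      using abs_trace_le
      by (intro mult_left_mono cell_norm_le_scaled divergence_continuous[OF vp] cell_poly_continuous[OF cell_poly_grad_vec[OF vp]])
         (auto simp: c_def divergence_def cell_norm_nonneg)
    also have "\<dots> \<le> ?n0 * (c * ?n1)"
    proof (intro mult_mono)
      show "cell_norm \<T> q \<le> ?n0" by (rule power2_le_imp_le[OF _ norms_nonneg(2)]) (use \<eta> in \<open>simp add: norm_q0_sq del: norm_q0.simps\<close>)
      show "cell_norm \<T> (grad_vec v) \<le> ?n1" by (rule power2_le_imp_le[OF _ norms_nonneg(1)]) (use \<eta> in \<open>simp add: norm_v1_sq del: norm_v1.simps\<close>)
    qed (auto simp: c_def cell_norm_nonneg norms_nonneg simp del: norm_q0.simps)
    finally show ?thesis by (simp only: mult_ac)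
  qed
  have b2: "\<bar>?B\<bar> \<le> ?n1 * ?n0"
  proof -
    have "\<bar>?B\<bar> \<le>
      bdry_norm \<T> ?Q * bdry_norm \<T> ?W"
      unfolding eq by (intro bdry_Cauchy_Schwarz Jn bdry_cts_scaleR qbc)
    also have "\<dots> \<le> bdry_norm \<T> ?Q * bdry_norm \<T> (scaled_jump v vb)"
    proof (intro mult_left_mono bdry_norm_mono Jn Jc(2) bdry_norm_nonneg)
      fix K F x assume K: "K \<in> \<T>" "F facet_of K"
      show "norm ((diameter K powr (-1/2)) *\<^sub>R (?J K F x \<bullet> outward_normal K F)) \<le> norm (scaled_jump v vb K F x)"
        using abs_inner_normal_le[OF K, of "?J K F x"] by (simp add: scaled_jump_def abs_mult mult_left_mono)
    qed
    \<comment> \<open>The reciprocal weights in the two norms cancel, so no power of \<eta> enters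
      the constant.\<close>
    also have "\<dots> = (sqrt (inverse \<eta>) * bdry_norm \<T> ?Q) * (sqrt \<eta> * bdry_norm \<T> (scaled_jump v vb))"
      using \<eta> by (simp add: real_sqrt_inverse)
    also have "\<dots> \<le> ?n0 * ?n1"
    proof (intro mult_mono)
      show "sqrt (inverse \<eta>) * bdry_norm \<T> ?Q \<le> ?n0"
        by (rule power2_le_imp_le[OF _ norms_nonneg(2)]) (use \<eta> in \<open>simp add: norm_q0_sq power_mult_distrib del: norm_q0.simps\<close>)
      show "sqrt \<eta> * bdry_norm \<T> (scaled_jump v vb) \<le> ?n1"
        by (rule power2_le_imp_le[OF _ norms_nonneg(1)]) (use \<eta> in \<open>simp add: norm_v1_sq power_mult_distrib del: norm_v1.simps\<close>)
    qed (use \<eta> in \<open>auto simp: bdry_norm_nonneg norms_nonneg simp del: norm_q0.simps\<close>)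
    finally show ?thesis by (simp only: mult_ac)
  qed
  have "\<bar>b_form \<T> v (q, qb)\<bar> \<le> c * (?n1 * ?n0) + ?n1 * ?n0"
    using b1 b2 by (simp del: norm_v1.simps norm_q0.simps)
  then show ?thesis by (simp only: c_def distrib_right mult_1_left)
qed

text \<open>After integration by parts only \<open>grad q\<close> and the jump \<open>q - qb\<close>
  act on \<open>v\<close>, and no derivative of \<open>v\<close> is left. The trace inequality
  absorbs the boundary values of \<open>v\<close> into its cell norm, which is what carries the
  weight \<tau>.\<close>

lemma b_form_le_L2_q1:
  assumes v: "(v, vb) \<in> V_space \<Omega> k \<T>" and q: "(q, qb) \<in> Q_space \<Omega> k \<T>"
  shows "\<bar>b_form \<T> v (q, qb)\<bar> \<le> (1 + Ct) * (cell_norm \<T> v * Nq1 (q, qb))"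
proof -
  have vp: "cell_poly k \<T> v" by (rule V_spaceD(1)[OF v])
  have qp: "cell_poly k \<T> q" and qbc: "bdry_cts \<T> (\<lambda>K F x. qb x)"
    using Q_spaceD[OF q] .
  let ?J = "\<lambda>K F x. cell_trace K q x - qb x"
  let ?n1 = "Nq1 (q, qb)"
  let ?vn = "\<lambda>K F x. cell_trace K v x \<bullet> outward_normal K F"
  note Jc = jump_continuous[OF qp qbc]
  note vc = cell_trace_continuous[OF vp]
  have vnc: "bdry_cts \<T> ?vn" by (intro bdry_cts_inner vc)
  have "b_form \<T> v (q, qb) = cell_ip \<T> (grad q) v - (bdry_ip \<T> (\<lambda>K F x. cell_trace K q x) ?vn - bdry_ip \<T> (\<lambda>K F x. qb x) ?vn)"
    using cell_integration_by_parts[OF vp qp] by simp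
  also have "bdry_ip \<T> (\<lambda>K F x. cell_trace K q x) ?vn - bdry_ip \<T> (\<lambda>K F x. qb x) ?vn = bdry_ip \<T> ?J ?vn"
    by (rule bdry_ip_diff[symmetric]) (intro cell_trace_continuous[OF qp] qbc vnc)+
  also have "\<dots> = bdry_ip \<T> (weighted ?vn) (scaled_jump q qb)"
    unfolding scaled_jump_def by (subst bdry_ip_commute) (rule bdry_ip_weights)
  finally have eq: "b_form \<T> v (q, qb) = cell_ip \<T> (grad q) v - bdry_ip \<T> (weighted ?vn) (scaled_jump q qb)" .
  have b1: "\<bar>cell_ip \<T> (grad q) v\<bar> \<le> ?n1 * cell_norm \<T> v"
  proof -
    have "\<bar>cell_ip \<T> (grad q) v\<bar> \<le> cell_norm \<T> (grad q) * cell_norm \<T> v"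
      by (intro cell_Cauchy_Schwarz cell_poly_continuous[OF vp] cell_poly_continuous[OF cell_poly_grad[OF qp]])
    also have "\<dots> \<le> ?n1 * cell_norm \<T> v"
    proof (intro mult_right_mono cell_norm_nonneg)
      show "cell_norm \<T> (grad q) \<le> ?n1" by (rule power2_le_imp_le[OF _ norms_nonneg(3)]) (use \<eta> in \<open>simp add: norm_q1_sq del: norm_q1.simps\<close>)
    qed
    finally show ?thesis .
  qed
  have b2: "\<bar>bdry_ip \<T> (weighted ?vn) (scaled_jump q qb)\<bar> \<le> (Ct * cell_norm \<T> v) * ?n1"
  proof -
    have "\<bar>bdry_ip \<T> (weighted ?vn) (scaled_jump q qb)\<bar> \<le>
      bdry_norm \<T> (weighted ?vn) * bdry_norm \<T> (scaled_jump q qb)"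
      by (intro bdry_Cauchy_Schwarz bdry_cts_scaleR vnc Jc(2))
    also have "\<dots> \<le> (Ct * cell_norm \<T> v) * ?n1"
    proof (intro mult_mono bdry_norm_nonneg)
      have "bdry_norm \<T> (weighted ?vn) \<le> bdry_norm \<T> (weighted (\<lambda>K F. cell_trace K v))"
      proof (intro bdry_norm_mono bdry_cts_scaleR vnc vc)
        fix K F x assume K: "K \<in> \<T>" "F facet_of K"
        show "norm ((diameter K powr (1/2)) *\<^sub>R ?vn K F x) \<le> norm ((diameter K powr (1/2)) *\<^sub>R cell_trace K v x)"
          using abs_inner_normal_le[OF K, of "cell_trace K v x"] by (simp add: abs_mult mult_left_mono)
      qed
      also have "\<dots> \<le> Ct * cell_norm \<T> v" by (rule trace_le[OF vp])
      finally show "bdry_norm \<T> (weighted ?vn) \<le> Ct * cell_norm \<T> v" .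
      \<comment> \<open>Here \<eta> > 1 inserts the penalty weight that the jump does not carry in
        this term.\<close>
      have sq: "(bdry_norm \<T> (scaled_jump q qb))\<^sup>2 \<le> \<eta> * (bdry_norm \<T> (scaled_jump q qb))\<^sup>2"
        using mult_right_mono[of 1 \<eta> "(bdry_norm \<T> (scaled_jump q qb))\<^sup>2"] \<eta> by simp
      show "bdry_norm \<T> (scaled_jump q qb) \<le> ?n1"
        by (rule power2_le_imp_le[OF _ norms_nonneg(3)]) (use sq in \<open>simp add: norm_q1_sq add_increasing del: norm_q1.simps\<close>)
    qed (auto simp: Ct_nonneg cell_norm_nonneg)
    finally show ?thesis .
  qed
  have "\<bar>b_form \<T> v (q, qb)\<bar> \<le> ?n1 * cell_norm \<T> v + (Ct * cell_norm \<T> v) * ?n1"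
    unfolding eq using b1 b2 by linarith
  then show ?thesis by (simp add: algebra_simps del: norm_q1.simps b_form.simps)
qed

lemma b_form_add:
  assumes v: "(v, vb) \<in> V_space \<Omega> k \<T>" and q1: "(q1, qb1) \<in> Q_space \<Omega> k \<T>" and q2: "(q2, qb2) \<in> Q_space \<Omega> k \<T>"
  shows "b_form \<T> v (\<lambda>x. q1 x + q2 x, \<lambda>x. qb1 x + qb2 x) = b_form \<T> v (q1, qb1) + b_form \<T> v (q2, qb2)"
proof -
  have vp: "cell_poly k \<T> v" by (rule V_spaceD(1)[OF v])
  have "cell_cts \<T> q1" "cell_cts \<T> q2" "bdry_cts \<T> (\<lambda>K F x. qb1 x)" "bdry_cts \<T> (\<lambda>K F x. qb2 x)"
    using cell_poly_continuous Q_spaceD[OF q1] Q_spaceD[OF q2] by blast+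
  then show ?thesis
    by (simp add: cell_ip_add divergence_continuous[OF vp] bdry_ip_add bdry_cts_inner[OF cell_trace_continuous[OF vp]])
qed

text \<open>The sum of the constants of the two preceding bounds, which dominates each of
  them.\<close>

definition "Cb = norm (mat 1 :: real^'d^'d) + 2 + Ct"

lemma Cb_pos: "Cb > 0" using Ct_nonneg norm_ge_zero[of "mat 1 :: real^'d^'d"] unfolding Cb_def by linarith

text \<open>For each admissible splitting the two bounds are added and paired by Cauchy-Schwarz in
  the plane. The resulting constant is the same for all splittings, so the infimum can be taken
  afterwards.\<close>

lemma b_form_le:
  assumes v: "vv \<in> V_space \<Omega> k \<T>" and q: "qq \<in> Q_space \<Omega> k \<T>"
  shows "\<bar>b_form \<T> (fst vv) qq\<bar> \<le> Cb * Nv vv * Nq qq"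
proof -
  obtain v vb where vv: "vv = (v, vb)" by (cases vv)
  let ?N = "Nv (v, vb)"
  let ?b = "\<bar>b_form \<T> v qq\<bar>"
  define S where "S = {inverse \<nu> * (Nq0 q1)\<^sup>2 + inverse \<tau> * (Nq1 q2)\<^sup>2 | q1 q2.
        q1 \<in> Q_space \<Omega> k \<T> \<and> q2 \<in> Q_space \<Omega> k \<T> \<and>
        qq = (\<lambda>x. fst q1 x + fst q2 x, \<lambda>x. snd q1 x + snd q2 x)}"
  have N: "?N = sqrt ((sqrt \<nu> * Nv1 (v, vb))\<^sup>2 + (sqrt \<tau> * cell_norm \<T> v)\<^sup>2)"
    using pos by (simp add: power_mult_distrib add.commute del: norm_v1.simps)
  have key: "?b \<le> Cb * ?N * sqrt s" if s: "s \<in> S" for s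
  proof -
    obtain q1 qb1 q2 qb2 where Q: "(q1, qb1) \<in> Q_space \<Omega> k \<T>" "(q2, qb2) \<in> Q_space \<Omega> k \<T>"
      "qq = (\<lambda>x. q1 x + q2 x, \<lambda>x. qb1 x + qb2 x)"
      "s = inverse \<nu> * (Nq0 (q1, qb1))\<^sup>2 + inverse \<tau> * (Nq1 (q2, qb2))\<^sup>2"
      using s unfolding S_def by (auto simp del: norm_q0.simps norm_q1.simps)
    let ?n1 = "Nv1 (v, vb)" and ?n = "cell_norm \<T> v"
    let ?q0 = "Nq0 (q1, qb1)" and ?q1 = "Nq1 (q2, qb2)"
    have v': "(v, vb) \<in> V_space \<Omega> k \<T>" using v vv by simp
    have nn: "0 \<le> ?n1 * ?q0" "0 \<le> ?n * ?q1"
      by (intro mult_nonneg_nonneg norms_nonneg cell_norm_nonneg)+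
    have "?b \<le> \<bar>b_form \<T> v (q1, qb1)\<bar> + \<bar>b_form \<T> v (q2, qb2)\<bar>"
      unfolding Q(3) b_form_add[OF v' Q(1,2)] by linarith
    also have "\<dots> \<le> (norm (mat 1 :: real^'d^'d) + 1) * (?n1 * ?q0) + (1 + Ct) * (?n * ?q1)"
      by (rule add_mono[OF b_form_le_v1_q0[OF v' Q(1)] b_form_le_L2_q1[OF v' Q(2)]])
    also have "\<dots> \<le> Cb * (?n1 * ?q0) + Cb * (?n * ?q1)"
      using nn Ct_nonneg by (intro add_mono mult_right_mono) (simp_all add: Cb_def)
    \<comment> \<open>Reciprocal square roots of the parameters are inserted so that the velocity
      factors form \<open>Nv\<close> and the pressure factors form \<open>s\<close>.\<close>
    also have "\<dots> = Cb * ((sqrt \<nu> * ?n1) * (?q0 / sqrt \<nu>) + (sqrt \<tau> * ?n) * (?q1 / sqrt \<tau>))"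
      using pos by (simp add: distrib_left del: norm_v1.simps norm_q0.simps norm_q1.simps)
    also have "\<dots> \<le> Cb * (?N * sqrt ((?q0 / sqrt \<nu>)\<^sup>2 + (?q1 / sqrt \<tau>)\<^sup>2))"
      unfolding N using Cb_pos by (intro mult_left_mono sum_mult_le_sqrt) auto
    also have "(?q0 / sqrt \<nu>)\<^sup>2 + (?q1 / sqrt \<tau>)\<^sup>2 = s"
      using pos unfolding Q(4) by (simp add: power_divide field_simps del: norm_q0.simps norm_q1.simps)
    finally show ?thesis by (simp only: mult.assoc)
  qed
  have S0: "0 \<le> s" if "s \<in> S" for s
    using that pos unfolding S_def by (auto simp del: norm_q0.simps norm_q1.simps)
  \<comment> \<open>The splitting with zero second part is always admissible. Nonemptiness matters
    because \<open>Inf\<close> is a meaningful lower bound only for a nonempty set.\<close>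
  have Sne: "S \<noteq> {}"
  proof -
    obtain q qb where qq: "qq = (q, qb)" by (cases qq)
    have z: "(\<lambda>x. 0) \<in> polys m" for m by (rule polys_const)
    have "(\<lambda>x. 0, \<lambda>x. 0) \<in> Q_space \<Omega> k \<T>"
      by (auto simp: Q_space_def Q_cell_def Q_face_def intro!: bexI[where x="\<lambda>x. 0"] z)
    then have "inverse \<nu> * (Nq0 (q, qb))\<^sup>2 + inverse \<tau> * (Nq1 (\<lambda>x. 0, \<lambda>x. 0))\<^sup>2 \<in> S"
      unfolding S_def using q qq
      by (intro CollectI exI[of _ "(q, qb)"] exI[of _ "(\<lambda>x. 0, \<lambda>x. 0)"]) (simp del: norm_q0.simps norm_q1.simps)
    then show ?thesis by blast
  qed
  have N0: "0 \<le> ?N" using N by simp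
  have nq: "Nq qq = sqrt (Inf S)" by (simp add: norm_q_def S_def)
  have "?b \<le> Cb * ?N * sqrt (Inf S)"
  \<comment> \<open>Passing to the infimum divides by the velocity norm; when that norm is 0, any
    single splitting already forces the form to vanish.\<close>
  proof (cases "?N = 0")
    case True
    obtain s where "s \<in> S" using Sne by blast
    from key[OF this] show ?thesis unfolding True by simp
  next
    case False
    then have c: "Cb * ?N > 0" using N0 Cb_pos by simp
    have "(?b / (Cb * ?N))\<^sup>2 \<le> Inf S"
    proof (rule cInf_greatest[OF Sne])
      fix s assume s: "s \<in> S"
      have "?b / (Cb * ?N) \<le> sqrt s" using key[OF s] c by (simp add: divide_le_eq mult.commute)
      then have "(?b / (Cb * ?N))\<^sup>2 \<le> (sqrt s)\<^sup>2" using c by (intro power_mono) (auto intro!: divide_nonneg_pos)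
      then show "(?b / (Cb * ?N))\<^sup>2 \<le> s" using S0[OF s] by simp
    qed
    then have "?b / (Cb * ?N) \<le> sqrt (Inf S)" by (rule real_le_rsqrt)
    then show ?thesis using c by (simp add: divide_le_eq mult.commute)
  qed
  then show ?thesis by (simp only: nq vv fst_conv)
qed

text \<open>The 3 counts the mass, gradient and penalty terms, each bounded by plain Cauchy-Schwarz.
  The two consistency terms contribute \<open>Ct\<close> each and the two pressure couplings
  \<open>Cb\<close> each.\<close>

lemma a_form_le:
  assumes x: "x \<in> X_space \<Omega> k \<T>" and y: "y \<in> X_space \<Omega> k \<T>"
  shows "\<bar>a_form \<T> \<nu> \<tau> \<eta> x y\<bar> \<le>
    (3 + 2 * Ct + 2 * Cb) * NX x * NX y"
proof -
  obtain u ub p v vb q where xy: "x = ((u, ub), p)" "y = ((v, vb), q)"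
    by (metis surj_pair)
  have mem: "(u, ub) \<in> V_space \<Omega> k \<T>" "(v, vb) \<in> V_space \<Omega> k \<T>" "p \<in> Q_space \<Omega> k \<T>" "q \<in> Q_space \<Omega> k \<T>"
    using x y by (auto simp: xy X_space_def)
  have up: "cell_poly k \<T> u" and ubc: "bdry_cts \<T> (\<lambda>K F x. ub x)"
   and vp: "cell_poly k \<T> v" and vbc: "bdry_cts \<T> (\<lambda>K F x. vb x)"
    using V_spaceD(1,2)[OF mem(1)] V_spaceD(1,2)[OF mem(2)] .
  let ?Nu = "Nv (u, ub)" and ?Nv = "Nv (v, vb)"
  \<comment> \<open>Each bound keeps one summand of the squared velocity norm. The fourth drops
    \<eta> by means of \<eta> > 1, for the consistency terms, where the jump is weighted by \<nu>
    alone.\<close>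
  have parts: "sqrt \<tau> * cell_norm \<T> w \<le> Nv (w, wb)"
    "sqrt \<nu> * cell_norm \<T> (grad_vec w) \<le> Nv (w, wb)"
    "sqrt (\<nu> * \<eta>) * bdry_norm \<T> (scaled_jump w wb) \<le> Nv (w, wb)"
    "sqrt \<nu> * bdry_norm \<T> (scaled_jump w wb) \<le> Nv (w, wb)"
    "0 \<le> Nv (w, wb)" for w wb
  proof -
    show N0: "0 \<le> Nv (w, wb)" using pos by (simp del: norm_v1.simps)
    have sq: "(Nv (w, wb))\<^sup>2 = \<tau> * (cell_norm \<T> w)\<^sup>2 + \<nu> * (cell_norm \<T> (grad_vec w))\<^sup>2
      + (\<nu> * \<eta>) * (bdry_norm \<T> (scaled_jump w wb))\<^sup>2"
      unfolding norm_v_sq norm_v1_sq by (simp add: algebra_simps)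
    have le: "sqrt c * a \<le> Nv (w, wb)" if "c * a\<^sup>2 \<le> (Nv (w, wb))\<^sup>2" "0 \<le> c" for c a
      by (rule power2_le_imp_le[OF _ N0]) (use that in \<open>simp add: power_mult_distrib\<close>)
    have nn: "0 \<le> \<tau> * (cell_norm \<T> w)\<^sup>2" "0 \<le> \<nu> * (cell_norm \<T> (grad_vec w))\<^sup>2" "0 \<le> (\<nu> * \<eta>) * (bdry_norm \<T> (scaled_jump w wb))\<^sup>2"
      using pos \<eta> by simp_all
    show "sqrt \<tau> * cell_norm \<T> w \<le> Nv (w, wb)" "sqrt \<nu> * cell_norm \<T> (grad_vec w) \<le> Nv (w, wb)"
      and 3: "sqrt (\<nu> * \<eta>) * bdry_norm \<T> (scaled_jump w wb) \<le> Nv (w, wb)"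
      using nn sq pos \<eta> by (intro le; simp del: norm_v.simps)+
    have "sqrt \<nu> \<le> sqrt (\<nu> * \<eta>)" using pos \<eta> by simp
    then have "sqrt \<nu> * bdry_norm \<T> (scaled_jump w wb) \<le> sqrt (\<nu> * \<eta>) * bdry_norm \<T> (scaled_jump w wb)"
      by (rule mult_right_mono[OF _ bdry_norm_nonneg])
    then show "sqrt \<nu> * bdry_norm \<T> (scaled_jump w wb) \<le> Nv (w, wb)" using 3 by linarith
  qed
  have split: "s * (a * b) \<le> A * B" if "sqrt s * a \<le> A" "sqrt s * b \<le> B" "0 \<le> a" "0 \<le> b" "0 < s" for s a b A B :: real
  proof -
    have "s * (a * b) = (sqrt s * a) * (sqrt s * b)" using that(5) by simp
    also have "\<dots> \<le> A * B" using that by (intro mult_mono) (auto intro: order_trans[OF _ that(1)])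
    finally show ?thesis .
  qed
  have t0: "\<bar>\<tau> * cell_ip \<T> u v\<bar> \<le> ?Nu * ?Nv"
  proof -
    have "\<bar>\<tau> * cell_ip \<T> u v\<bar> \<le> \<tau> * (cell_norm \<T> u * cell_norm \<T> v)"
      using pos cell_Cauchy_Schwarz[OF cell_poly_continuous[OF up] cell_poly_continuous[OF vp]]
      by (simp add: abs_mult)
    also have "\<dots> \<le> ?Nu * ?Nv" by (rule split[OF parts(1) parts(1) cell_norm_nonneg cell_norm_nonneg pos(2)])
    finally show ?thesis .
  qed
  have t1: "\<bar>cell_ip \<T> (\<lambda>x. \<nu> *\<^sub>R grad_vec u x) (grad_vec v)\<bar> \<le> ?Nu * ?Nv"
  proof -
    have "\<bar>cell_ip \<T> (\<lambda>x. \<nu> *\<^sub>R grad_vec u x) (grad_vec v)\<bar> \<le> \<nu> * (cell_norm \<T> (grad_vec u) * cell_norm \<T> (grad_vec v))"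
      unfolding cell_ip_scaleR
      using pos cell_Cauchy_Schwarz[OF cell_poly_continuous[OF cell_poly_grad_vec[OF up]] cell_poly_continuous[OF cell_poly_grad_vec[OF vp]]]
      by (simp add: abs_mult)
    also have "\<dots> \<le> ?Nu * ?Nv" by (rule split[OF parts(2) parts(2) cell_norm_nonneg cell_norm_nonneg pos(1)])
    finally show ?thesis .
  qed
  let ?pen = "bdry_ip \<T> (\<lambda>K F x. (\<nu> * \<eta> * inverse (diameter K)) *\<^sub>R (cell_trace K u x - ub x)) (\<lambda>K F x. cell_trace K v x - vb x)"
  have t2: "\<bar>?pen\<bar> \<le> ?Nu * ?Nv"
  proof -
    have "?pen
      = bdry_ip \<T> (\<lambda>K F x. (\<nu> * \<eta>) *\<^sub>R scaled_jump u ub K F x) (scaled_jump v vb)"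
    proof (rule bdry_ip_cong)
      fix K F x assume K: "K \<in> \<T>"
      have h: "inverse (diameter K) = diameter K powr (-1/2) * diameter K powr (-1/2)"
      proof -
        have "diameter K powr (-1/2) * diameter K powr (-1/2) = diameter K powr (-1)" by (simp flip: powr_add)
        then show ?thesis using diameter_pos[OF K] by (simp only: powr_minus powr_one abs_of_pos)
      qed
      show "(\<nu> * \<eta> * inverse (diameter K)) *\<^sub>R (cell_trace K u x - ub x) \<bullet> (cell_trace K v x - vb x) =
        (\<nu> * \<eta>) *\<^sub>R scaled_jump u ub K F x \<bullet> scaled_jump v vb K F x"
        unfolding h scaled_jump_def inner_scaleR_left inner_scaleR_right by (simp only: mult_ac)
    qed
    also have "\<dots> = (\<nu> * \<eta>) * bdry_ip \<T> (scaled_jump u ub) (scaled_jump v vb)" by (rule bdry_ip_scaleR)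
    finally have "\<bar>?pen\<bar>
      = (\<nu> * \<eta>) * \<bar>bdry_ip \<T> (scaled_jump u ub) (scaled_jump v vb)\<bar>" using pos \<eta> by (simp add: abs_mult)
    also have "\<dots> \<le> (\<nu> * \<eta>) * (bdry_norm \<T> (scaled_jump u ub) * bdry_norm \<T> (scaled_jump v vb))"
      using pos \<eta> by (intro mult_left_mono bdry_Cauchy_Schwarz jump_continuous(2) up ubc vp vbc) auto
    also have "\<dots> \<le> ?Nu * ?Nv"
      using pos \<eta> by (intro split[OF parts(3) parts(3) bdry_norm_nonneg bdry_norm_nonneg]) simp
    finally show ?thesis .
  qed
  \<comment> \<open>Stated for arbitrary functions, because the two consistency terms differ by
    exchanging the roles of \<open>u\<close> and \<open>v\<close>.\<close>
  have t3: "\<bar>bdry_ip \<T> (\<lambda>K F x. \<nu> *\<^sub>R (cell_trace K (grad_vec w) x *v outward_normal K F)) (\<lambda>K F x. cell_trace K z x - zb x)\<bar>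
    \<le> Ct * (Nv (w, wb) * Nv (z, zb))"
    if wp: "cell_poly k \<T> w" and zp: "cell_poly k \<T> z" and zbc: "bdry_cts \<T> (\<lambda>K F x. zb x)" for w wb z zb
  proof -
    let ?G = "\<lambda>K F x. cell_trace K (grad_vec w) x *v outward_normal K F"
    have Gp: "cell_poly k \<T> (grad_vec w)" by (rule cell_poly_grad_vec[OF wp])
    have Gc: "bdry_cts \<T> ?G"
      by (rule bdry_cts_compose[OF cell_trace_continuous[OF Gp], of "\<lambda>K F A. A *v outward_normal K F"])
        (intro linear_continuous_on linear_conv_bounded_linear[THEN iffD1] linearI; simp add: matrix_vector_mult_add_rdistrib scaleR_matrix_vector_assoc)
    have "\<bar>bdry_ip \<T> (\<lambda>K F x. \<nu> *\<^sub>R ?G K F x) (\<lambda>K F x. cell_trace K z x - zb x)\<bar>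
      = \<nu> * \<bar>bdry_ip \<T> ?G (\<lambda>K F x. cell_trace K z x - zb x)\<bar>"
      unfolding bdry_ip_scaleR using pos by (simp add: abs_mult)
    also have "bdry_ip \<T> ?G (\<lambda>K F x. cell_trace K z x - zb x) = bdry_ip \<T> (weighted ?G) (scaled_jump z zb)"
      unfolding scaled_jump_def by (rule bdry_ip_weights)
    also have "\<nu> * \<bar>bdry_ip \<T> (weighted ?G) (scaled_jump z zb)\<bar> \<le>
      \<nu> * (bdry_norm \<T> (weighted ?G) * bdry_norm \<T> (scaled_jump z zb))"
      using pos by (intro mult_left_mono bdry_Cauchy_Schwarz bdry_cts_scaleR Gc jump_continuous(2) zp zbc) auto
    also have "\<dots> \<le> \<nu> * ((Ct * cell_norm \<T> (grad_vec w)) * bdry_norm \<T> (scaled_jump z zb))"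
    proof (intro mult_left_mono mult_right_mono bdry_norm_nonneg)
      have "bdry_norm \<T> (weighted ?G) \<le> bdry_norm \<T> (weighted (\<lambda>K F. cell_trace K (grad_vec w)))"
      proof (intro bdry_norm_mono bdry_cts_scaleR Gc cell_trace_continuous[OF Gp])
        fix K F x assume K: "K \<in> \<T>" "F facet_of K"
        have "norm (?G K F x) \<le> norm (cell_trace K (grad_vec w) x)"
          using norm_matrix_vector_mult_le[of "cell_trace K (grad_vec w) x" "outward_normal K F"] norm_outward_normal[OF K] by simp
        then show "norm ((diameter K powr (1/2)) *\<^sub>R ?G K F x) \<le> norm ((diameter K powr (1/2)) *\<^sub>R cell_trace K (grad_vec w) x)"
          by (simp add: mult_left_mono)
      qed
      also have "\<dots> \<le> Ct * cell_norm \<T> (grad_vec w)" by (rule trace_le[OF Gp])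
      finally show "bdry_norm \<T> (weighted ?G) \<le> Ct * cell_norm \<T> (grad_vec w)" .
    qed (use pos in simp)
    also have "\<dots> = Ct * (\<nu> * (cell_norm \<T> (grad_vec w) * bdry_norm \<T> (scaled_jump z zb)))" by (simp only: mult_ac)
    also have "\<dots> \<le> Ct * (Nv (w, wb) * Nv (z, zb))"
      by (intro mult_left_mono Ct_nonneg split[OF parts(2) parts(4) cell_norm_nonneg bdry_norm_nonneg pos(1)])
    finally show ?thesis .
  qed
  note t3a = t3[OF up vp vbc, of ub] and t3b = t3[OF vp up ubc, of vb]
  have b1: "\<bar>b_form \<T> v p\<bar> \<le> Cb * ?Nv * Nq p"
    using b_form_le[OF mem(2,3)] by (simp only: fst_conv)
  have b2: "\<bar>b_form \<T> u q\<bar> \<le> Cb * ?Nu * Nq q"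
    using b_form_le[OF mem(1,4)] by (simp only: fst_conv)
  let ?X = "NX x" and ?Y = "NX y"
  have X: "?Nu \<le> ?X" "Nq p \<le> ?X" "?Nv \<le> ?Y" "Nq q \<le> ?Y"
    unfolding xy norm_X.simps by (simp_all add: real_le_rsqrt del: norm_v.simps)
  note N0 = parts(5)
  have X0: "0 \<le> ?X" "0 \<le> ?Y" using X N0 order_trans by blast+
  have uv: "?Nu * ?Nv \<le> ?X * ?Y" using X N0 X0 by (intro mult_mono) auto
  have mono: "Cb * a * b \<le> Cb * (c * d)" if "a \<le> c" "b \<le> d" "0 \<le> a" "0 \<le> d" for a b c d
  proof -
    have "a * b \<le> a * d" by (intro mult_left_mono that)
    also have "\<dots> \<le> c * d" by (intro mult_right_mono that)
    finally show ?thesis using Cb_pos by (simp add: mult.assoc)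
  qed
  have vp': "Cb * ?Nv * Nq p \<le> Cb * (?X * ?Y)"
    using mono[OF X(3,2) N0 X0(1)] by (simp only: mult.commute[of ?Y])
  note uq' = mono[OF X(1,4) N0 X0(2)]
  have Cuv: "Ct * (?Nu * ?Nv) \<le> Ct * (?X * ?Y)" by (intro mult_left_mono uv Ct_nonneg)
  have t3b': "\<bar>bdry_ip \<T> (\<lambda>K F x. \<nu> *\<^sub>R (cell_trace K (grad_vec v) x *v outward_normal K F)) (\<lambda>K F x. cell_trace K u x - ub x)\<bar> \<le> Ct * (?Nu * ?Nv)"
    using t3b by (simp only: mult.commute)
  have abs_sum: "\<bar>s0 + (s1 + s2 - s3 - s4) + s5 + s6\<bar> \<le> 3 * P + 2 * R + 2 * S"
    if "\<bar>s0\<bar> \<le> P" "\<bar>s1\<bar> \<le> P" "\<bar>s2\<bar> \<le> P" "\<bar>s3\<bar> \<le> R" "\<bar>s4\<bar> \<le> R" "\<bar>s5\<bar> \<le> S" "\<bar>s6\<bar> \<le> S"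
    for s0 s1 s2 s3 s4 s5 s6 P R S :: real
    using that by linarith
  have a_eq: "a_form \<T> \<nu> \<tau> \<eta> x y = \<tau> * cell_ip \<T> u v + d_form \<T> \<nu> \<eta> (u, ub) (v, vb) + b_form \<T> v p + b_form \<T> u q"
    by (simp only: xy a_form.simps)
  have "\<bar>a_form \<T> \<nu> \<tau> \<eta> x y\<bar> \<le> 3 * (?X * ?Y) + 2 * (Ct * (?X * ?Y)) + 2 * (Cb * (?X * ?Y))"
    unfolding a_eq d_form.simps
    by (rule abs_sum[OF order_trans[OF t0 uv] order_trans[OF t1 uv] order_trans[OF t2 uv] order_trans[OF t3a Cuv]
        order_trans[OF t3b' Cuv] order_trans[OF b1 vp'] order_trans[OF b2 uq']])
  also have "\<dots> = (3 + 2 * Ct + 2 * Cb) * ?X * ?Y" by (simp add: algebra_simps)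
  finally show ?thesis .
qed

end

text \<open>The factor 4 is 2 for passing from diameter to radius and 2 for settling for more than
  half of the supremum. If the supremum is not positive, any ball inside \<open>K\<close> will do,
  so the argument never has to bound the set of diameters.\<close>

lemma inscribed_ball:
  fixes K :: "'a::euclidean_space set"
  assumes "simplex_cell C K"
  obtains c r where "ball c r \<subseteq> K" "r > 0" "inscribed_diameter K \<le> 4 * r"
proof -
  interpret simplex_cell C K by fact
  define S where "S = {2 * r | r c. 0 < r \<and> ball c r \<subseteq> K}"
  obtain c0 where "c0 \<in> interior K" using interior_nonempty by blast
  then obtain e where "e > 0" "ball c0 e \<subseteq> K" by (meson mem_interior)
  then have e: "2 * e \<in> S" "e > 0" unfolding S_def by blast+
  show thesis
  proof (cases "Sup S \<le> 0")
    case True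
    then show thesis using that[OF \<open>ball c0 e \<subseteq> K\<close> e(2)] e(2) by (simp add: inscribed_diameter_def S_def)
  next
    case False
    have "\<exists>s\<in>S. Sup S / 2 < s"
    proof (rule ccontr)
      assume "\<not> ?thesis"
      then have "Sup S \<le> Sup S / 2" using e(1) by (intro cSup_least) (auto simp: not_less)
      then show False using False by simp
    qed
    then obtain r c where "0 < r" "ball c r \<subseteq> K" "Sup S / 2 < 2 * r" unfolding S_def by blast
    then show thesis using that[of c r] by (simp add: inscribed_diameter_def S_def)
  qed
qed

theorem lemma7:
  fixes \<Omega> :: "(real^'d) set"
    and \<M> :: "(real^'d) set set set"
    and k :: nat
    and \<eta> :: real
  assumes "CARD('d) \<in> {2, 3}"
    and "polyhedral_domain \<Omega>"
    and "quasi_uniform_family \<Omega> \<M>"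
    and "k \<ge> 1"
    and "\<eta> > 1"
  shows "\<exists>c_b>0. \<forall>\<T>\<in>\<M>. \<forall>\<nu>>0. \<forall>\<tau>>0.
           \<forall>x\<in>X_space \<Omega> k \<T>. \<forall>y\<in>X_space \<Omega> k \<T>.
             \<bar>a_form \<T> \<nu> \<tau> \<eta> x y\<bar> \<le> c_b * norm_X \<Omega> k \<T> \<nu> \<tau> \<eta> x * norm_X \<Omega> k \<T> \<nu> \<tau> \<eta> y"
proof -
  obtain \<sigma> where \<sigma>: "\<sigma> > 0" "\<And>\<T> K. \<T> \<in> \<M> \<Longrightarrow> K \<in> \<T> \<Longrightarrow> diameter K \<le> \<sigma> * inscribed_diameter K"
    and conf: "\<And>\<T>. \<T> \<in> \<M> \<Longrightarrow> conforming_mesh \<Omega> \<T>"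
    using assms(3) unfolding quasi_uniform_family_def by blast
  show ?thesis
  \<comment> \<open>Here \<sigma> is the regularity constant of the whole family and 4 comes from
    \<open>inscribed_ball\<close>; thus \<open>M\<close> is fixed before a mesh or a parameter is
    chosen.\<close>
  proof (rule discrete_trace_inequality[where \<kappa>="4 * \<sigma>" and m=k and 'd='d])
    fix M :: real
    assume M0: "0 \<le> M" and M: "\<And>C K F c r p. simplex_cell C (K :: (real^'d) set) \<Longrightarrow> F facet_of K \<Longrightarrow>
      ball c r \<subseteq> K \<Longrightarrow> r > 0 \<Longrightarrow> diameter K \<le> 4 * \<sigma> * r \<Longrightarrow> p \<in> polys k \<Longrightarrow>
      diameter K * (LINT y:rel_interior F|face_lborel F. (p y)\<^sup>2) \<le> M * (LINT x:interior K|lborel. (p x)\<^sup>2)"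
    have fem: "fem \<Omega> \<T> k M \<eta> \<nu> \<tau>" if \<T>: "\<T> \<in> \<M>" and pos: "\<nu> > 0" "\<tau> > 0" for \<T> \<nu> \<tau>
    proof unfold_locales
      show mesh: "conforming_mesh \<Omega> \<T>" using conf[OF \<T>] .
      show "open \<Omega>" "interior (closure \<Omega>) = \<Omega>" using assms(2) by (auto simp: polyhedral_domain_def)
      show "1 < \<eta>" "0 \<le> M" "0 < \<nu>" "0 < \<tau>" by fact+
      fix K F and p :: "real^'d \<Rightarrow> real"
      assume K: "K \<in> \<T>" "F facet_of K" "p \<in> polys k"
      obtain C where C: "simplex_cell C K" using conforming_mesh_simplex_cell[OF mesh K(1)] .
      obtain c r where r: "ball c r \<subseteq> K" "r > 0" "inscribed_diameter K \<le> 4 * r" using inscribed_ball[OF C] .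
      have "diameter K \<le> \<sigma> * inscribed_diameter K" using \<sigma>(2)[OF \<T> K(1)] .
      also have "\<dots> \<le> \<sigma> * (4 * r)" using r(3) \<sigma>(1) by simp
      finally show "diameter K * (LINT y:rel_interior F|face_lborel F. (p y)\<^sup>2) \<le> M * (LINT x:interior K|lborel. (p x)\<^sup>2)"
        by (intro M[OF C K(2) r(1,2) _ K(3)]) simp
    qed
    \<comment> \<open>The constants of the locale are restated outside it, where no mesh and no
      parameters have been fixed, so that they can witness the outer existential.\<close>
    define Ct where "Ct = sqrt (real (Suc CARD('d)) * M)"
    define Cb where "Cb = norm (mat 1 :: real^'d^'d) + 2 + Ct"
    have "Ct \<ge> 0" using M0 by (simp add: Ct_def)
    moreover from this have "Cb \<ge> 0" by (simp add: Cb_def)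
    ultimately have "3 + 2 * Ct + 2 * Cb > 0" by linarith
    moreover have "\<bar>a_form \<T> \<nu> \<tau> \<eta> x y\<bar> \<le> (3 + 2 * Ct + 2 * Cb) * norm_X \<Omega> k \<T> \<nu> \<tau> \<eta> x * norm_X \<Omega> k \<T> \<nu> \<tau> \<eta> y"
      if "\<T> \<in> \<M>" "\<nu> > 0" "\<tau> > 0" "x \<in> X_space \<Omega> k \<T>" "y \<in> X_space \<Omega> k \<T>" for \<T> \<nu> \<tau> x y
      using fem.a_form_le[OF fem[OF that(1-3)] that(4,5)]
      unfolding fem.Cb_def[OF fem[OF that(1-3)]] fem.Ct_def[OF fem[OF that(1-3)]] Cb_def Ct_def .
    ultimately show ?thesis by blast
  qed
qed

end
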